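(* Let $\alpha\in(0,2]$, $H>0$, $\beta\in\mathbb{R}$, $p\in(0,+\infty]$ (with $1/\infty=0$). Let $\|\cdot\|=\{\|\cdot\|_I\}$ be a lower $(\beta,p)$-semi-norm and let $R$ be a continuous symmetric $\alpha$-stable Riemann-Liouville process with Hurst parameter $H$ (continuity meaning that $\alpha=2$ or $H>1/\alpha$). Suppose that $H>\beta+1/p$ if $\alpha=2$ and $H>\beta+1/p+1/\alpha$ if $\alpha<2$. Then, writing $\|R\|=\|R\|_{[0,1]}$, $$\liminf_{\varepsilon\downarrow0}\varepsilon^{\gamma}\log\mathbb{P}\left[\|R\|\le\varepsilon\right]>-\infty,$$ with $\gamma=(H-\beta-1/p)^{-1}$.
   Context: Semi-norms. Let $\mathcal{I}$ be the set of all closed bounded intervals of $\mathbb{R}$. Let $\mathcal{F}$ be a linear space of functions from $\mathbb{R}$ to $\mathbb{R}$ and, for each $I\in\mathcal{I}$, let $\mathcal{F}_I$ be a linear space of functions from $I$ to $\mathbb{R}$ such that the restriction $f_I$ of $f$ to $I$ belongs to $\mathcal{F}_I$ for every $f\in\mathcal{F}$. A semi-norm $\|\cdot\|$ on $\mathcal{F}$ is a family $\{\|\cdot\|_I,\ I\in\mathcal{I}\}$ of functionals $\mathcal{F}_I\to\mathbb{R}^+$ with $\|\lambda f\|_I=|\lambda|\,\|f\|_I$ and $\|f+g\|_I\le\|f\|_I+\|g\|_I$ for all $\lambda\in\mathbb{R}$, $f,g\in\mathcal{F}_I$. One writes $\|f\|_I=\|f_I\|_I$ for $f\in\mathcal{F}$.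 $\mathcal{C}^l_K$ denotes the class of all $l$-times continuously differentiable (continuous, if $l=0$) functions with compact support. A lower $(\beta,p)$-semi-norm is a semi-norm satisfying: (A) $\|\cdot\|_I\le\|\cdot\|_J$ for all $I,J\in\mathcal{I}$ with $I\subset J$; (B) $\|f\|_{I-c}=\|f(\cdot-c)\|_I$ for every $f\in\mathcal{F}$, $I\in\mathcal{I}$, $c\in\mathbb{R}$; (C) $\|f(c\,\cdot)\|_{I/c}=c^{\beta}\|f\|_I$ for every $f\in\mathcal{F}$, $I\in\mathcal{I}$, $c>0$; (E) there exists $l\in\mathbb{N}$ such that $\mathcal{C}^l_K\subset\mathcal{F}$; (F) for every $I\in\mathcal{I}$ and $f,f_n\in\mathcal{F}_I$, if $f_n\to f$ uniformly on $I$, then $\|f\|_I\le\limsup_n\|f_n\|_I$; (G) there exists $C_p>0$ such that for every $a_0<\dots<a_n$ in $\mathbb{R}$ and $f\in\mathcal{C}^l_K$ with $f(a_0)=\dots=f(a_n)=0$: $\|f\|_{[a_0,a_n]}\le C_p\left(\sum_{i=1}^n\|f\|_{[a_{i-1},a_i]}^p\right)^{1/p}$ if $p<+\infty$, and $\|f\|_{[a_0,a_n]}\le C_\infty\sup_{1\le i\le n}\|f\|_{[a_{i-1},a_i]}$ if $p=+\infty$. Process. Let $\{Z_t,\ t\ge0\}$ be the symmetric $\alpha$-stable Lévy process with $\mathbb{E}[e^{i\lambda Z_t}]=e^{-t|\lambda|^{\alpha}}$. The symmetric $\alpha$-stable Riemann-Liouville process with Hurst parameter $H$ is $R_0=0$,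 $R_t=\int_0^t(t-s)^{H-1/\alpha}\,dZ_s$ for $t>0$. It admits a continuous version if and only if $\alpha=2$ or $H>1/\alpha$. *)

theory Defs
  imports "HOL-Probability.Probability"
begin

section \<open>Semi-norms on functions of a real variable\<close>

definition closed_intervals :: "real set set" where
  "closed_intervals = {{a..b} | a b. a \<le> b}"

text \<open>
  A real function with domain \<^term>\<open>D\<close> is represented by the element of \<^term>\<open>extensional D\<close>
  with the same values on \<^term>\<open>D\<close>; for \<^term>\<open>D = UNIV\<close> this is no restriction.
\<close>

definition function_space :: "real set \<Rightarrow> (real \<Rightarrow> real) set \<Rightarrow> bool" where
  "function_space D V \<longleftrightarrow>
     V \<subseteq> extensional D \<and>
     (\<lambda>x\<in>D. 0) \<in> V \<and>
     (\<forall>f\<in>V. \<forall>g\<in>V. (\<lambda>x\<in>D. f x + g x) \<in> V) \<and>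
     (\<forall>c. \<forall>f\<in>V. (\<lambda>x\<in>D. c * f x) \<in> V)"

definition CK :: "nat \<Rightarrow> (real \<Rightarrow> real) set" where
  "CK l = {f. (\<forall>k<l. \<forall>x. (deriv ^^ k) f field_differentiable (at x)) \<and>
              continuous_on UNIV ((deriv ^^ l) f) \<and>
              compact (closure {x. f x \<noteq> 0})}"

locale seminorm_family =
  fixes F :: "(real \<Rightarrow> real) set"
    and FI :: "real set \<Rightarrow> (real \<Rightarrow> real) set"
    and N :: "real set \<Rightarrow> (real \<Rightarrow> real) \<Rightarrow> real"
  assumes space_F: "function_space UNIV F"
    and space_FI: "I \<in> closed_intervals \<Longrightarrow> function_space I (FI I)"
    and restrict_mem: "I \<in> closed_intervals \<Longrightarrow> f \<in> F \<Longrightarrow> restrict f I \<in> FI I"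
    and nonneg: "I \<in> closed_intervals \<Longrightarrow> f \<in> FI I \<Longrightarrow> 0 \<le> N I f"
    and homogeneous: "I \<in> closed_intervals \<Longrightarrow> f \<in> FI I \<Longrightarrow> N I (\<lambda>x\<in>I. c * f x) = \<bar>c\<bar> * N I f"
    and triangle: "I \<in> closed_intervals \<Longrightarrow> f \<in> FI I \<Longrightarrow> g \<in> FI I \<Longrightarrow>
           N I (\<lambda>x\<in>I. f x + g x) \<le> N I f + N I g"

text \<open>
  In \<open>translation\<close> and \<open>scaling\<close> the membership clause is what makes the semi-norm of the
  translated or rescaled function meaningful. The smoothness order in \<open>pseudo_additive\<close> is the
  same as the one witnessing the inclusion of the test functions into \<^term>\<open>F\<close>.
\<close>

locale lower_seminorm = seminorm_family F FI N
  for F :: "(real \<Rightarrow> real) set"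
    and FI :: "real set \<Rightarrow> (real \<Rightarrow> real) set"
    and N :: "real set \<Rightarrow> (real \<Rightarrow> real) \<Rightarrow> real" +
  fixes \<beta> :: real and p :: ereal
  assumes p_pos: "0 < p"
    and monotone: "I \<in> closed_intervals \<Longrightarrow> J \<in> closed_intervals \<Longrightarrow> I \<subseteq> J \<Longrightarrow> f \<in> F \<Longrightarrow>
           N I (restrict f I) \<le> N J (restrict f J)"
    and translation: "f \<in> F \<Longrightarrow> I \<in> closed_intervals \<Longrightarrow>
           (\<lambda>x\<in>I. f (x - c)) \<in> FI I \<and>
           N ((\<lambda>x. x - c) ` I) (restrict f ((\<lambda>x. x - c) ` I)) = N I (\<lambda>x\<in>I. f (x - c))"
    and scaling: "f \<in> F \<Longrightarrow> I \<in> closed_intervals \<Longrightarrow> 0 < c \<Longrightarrow>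
           (\<lambda>x\<in>(\<lambda>x. x / c) ` I. f (c * x)) \<in> FI ((\<lambda>x. x / c) ` I) \<and>
           N ((\<lambda>x. x / c) ` I) (\<lambda>x\<in>(\<lambda>x. x / c) ` I. f (c * x)) =
             c powr \<beta> * N I (restrict f I)"
    and lower_semicontinuous: "I \<in> closed_intervals \<Longrightarrow> f \<in> FI I \<Longrightarrow> (\<And>n. fs n \<in> FI I) \<Longrightarrow>
           uniform_limit I fs f sequentially \<Longrightarrow>
           ereal (N I f) \<le> limsup (\<lambda>n. ereal (N I (fs n)))"
    and pseudo_additive: "\<exists>l. CK l \<subseteq> F \<and>
           (\<exists>C>0. \<forall>n\<ge>1. \<forall>a :: nat \<Rightarrow> real. \<forall>f\<in>CK l.
              (\<forall>i<n. a i < a (Suc i)) \<longrightarrow> (\<forall>i\<le>n. f (a i) = 0) \<longrightarrow>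
              N {a 0..a n} (restrict f {a 0..a n}) \<le>
                C * (if p = \<infinity>
                     then (SUP i\<in>{1..n}. N {a (i - 1)..a i} (restrict f {a (i - 1)..a i}))
                     else (\<Sum>i=1..n. N {a (i - 1)..a i} (restrict f {a (i - 1)..a i})
                             powr real_of_ereal p) powr (1 / real_of_ereal p)))"


section \<open>Stable processes\<close>

text \<open>Processes are indexed by the reals; only the times \<open>t \<ge> 0\<close> are relevant.\<close>

locale symmetric_stable_levy = prob_space M
  for M :: "'w measure" +
  fixes \<alpha> :: real and Z :: "real \<Rightarrow> 'w \<Rightarrow> real"
  assumes stability_index: "0 < \<alpha>" "\<alpha> \<le> 2"
    and measurable_Z: "0 \<le> t \<Longrightarrow> Z t \<in> borel_measurable M"
    and start_Z: "AE \<omega> in M. Z 0 \<omega> = 0"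
    and independent_increments: "0 \<le> u 0 \<Longrightarrow> (\<And>i. i < n \<Longrightarrow> u i \<le> u (Suc i)) \<Longrightarrow>
           indep_vars (\<lambda>_. borel) (\<lambda>i \<omega>. Z (u (Suc i)) \<omega> - Z (u i) \<omega>) {..<n :: nat}"
    and stationary_increments: "0 \<le> s \<Longrightarrow> 0 \<le> h \<Longrightarrow>
           distr M borel (\<lambda>\<omega>. Z (s + h) \<omega> - Z s \<omega>) = distr M borel (Z h)"
    and cadlag: "AE \<omega> in M. \<forall>t\<ge>0. continuous (at_right t) (\<lambda>s. Z s \<omega>) \<and>
           (0 < t \<longrightarrow> (\<exists>y. ((\<lambda>s. Z s \<omega>) \<longlongrightarrow> y) (at_left t)))"
    and char_Z: "0 \<le> t \<Longrightarrow> char (distr M borel (Z t)) x = of_real (exp (- t * \<bar>x\<bar> powr \<alpha>))"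

definition step_function :: "nat \<Rightarrow> (nat \<Rightarrow> real) \<Rightarrow> (nat \<Rightarrow> real) \<Rightarrow> real \<Rightarrow> real" where
  "step_function n u c s = (\<Sum>i<n. c i * indicator {u i<..u (Suc i)} s)"

definition step_integral ::
    "(real \<Rightarrow> 'w \<Rightarrow> real) \<Rightarrow> nat \<Rightarrow> (nat \<Rightarrow> real) \<Rightarrow> (nat \<Rightarrow> real) \<Rightarrow> 'w \<Rightarrow> real" where
  "step_integral Z n u c \<omega> = (\<Sum>i<n. c i * (Z (u (Suc i)) \<omega> - Z (u i) \<omega>))"

text \<open>
  The integral over \<open>[0,t]\<close> of a deterministic function with respect to \<^term>\<open>Z\<close>: the limit in
  probability of the integrals of step functions converging to the integrand in \<open>L\<^sup>\<alpha>\<close>. The limit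
  is almost surely unique and does not depend on the approximating sequence.
\<close>

definition (in symmetric_stable_levy) has_stable_integral ::
    "(real \<Rightarrow> real) \<Rightarrow> real \<Rightarrow> ('w \<Rightarrow> real) \<Rightarrow> bool" where
  "has_stable_integral f t X \<longleftrightarrow>
     f \<in> borel_measurable borel \<and> X \<in> borel_measurable M \<and>
     (\<exists>n u c.
        (\<forall>k. 0 \<le> u k 0 \<and> (\<forall>i<n k. u k i \<le> u k (Suc i)) \<and> u k (n k) \<le> t) \<and>
        (\<lambda>k. \<integral>\<^sup>+s\<in>{0..t}. ennreal (\<bar>step_function (n k) (u k) (c k) s - f s\<bar> powr \<alpha>) \<partial>lborel)
          \<longlonglongrightarrow> 0 \<and>
        (\<forall>\<delta>>0. (\<lambda>k. prob {\<omega> \<in> space M. \<delta> < \<bar>step_integral Z (n k) (u k) (c k) \<omega> - X \<omega>\<bar>})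
          \<longlonglongrightarrow> 0))"

locale riemann_liouville_process = symmetric_stable_levy M \<alpha> Z
  for M :: "'w measure" and \<alpha> :: real and Z :: "real \<Rightarrow> 'w \<Rightarrow> real" +
  fixes H :: real and R :: "real \<Rightarrow> 'w \<Rightarrow> real"
  assumes hurst_pos: "0 < H"
    and measurable_R: "0 \<le> t \<Longrightarrow> R t \<in> borel_measurable M"
    and start_R: "AE \<omega> in M. R 0 \<omega> = 0"
    and integral_R: "0 < t \<Longrightarrow> has_stable_integral (\<lambda>s. (t - s) powr (H - 1 / \<alpha>)) t (R t)"

text \<open>The logarithm of a nonnegative number, with value \<^term>\<open>-\<infinity> :: ereal\<close> at zero.\<close>

definition ereal_ln :: "real \<Rightarrow> ereal" where
  "ereal_ln x = (if x = 0 then -\<infinity> else ereal (ln x))"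

end

theory Submission
  imports Defs
begin

text \<open>
  Decompose \<open>R\<close> on \<open>[0,1]\<close> as a uniformly convergent sum over dyadic levels \<open>j\<close> of \<open>O(2^j)\<close> rescaled
  smooth bumps whose coefficients are errors of local polynomial interpolation of \<open>R\<close>, hence of size
  \<open>2 powr (- j * H)\<close>. By pseudo-additivity and scaling, level \<open>j\<close> contributes at most
  \<open>2 powr (j * (\<beta> + 1/p))\<close> times the largest coefficient to the semi-norm, so it suffices to bound from
  below the probability that all coefficients obey prescribed tolerances.

  This is a collision argument. A linear functional of the increments of \<open>Z\<close> over a grid is a sum
  \<open>U + V\<close> of two iid symmetric parts (halve every cell), so \<open>U + V\<close> and \<open>U - V\<close> have the same law,
  and \<open>U - V\<close> is within tolerance as soon as the roundings of \<open>U\<close> and \<open>V\<close> agree. Two iid discrete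
  variables agree with probability at least \<open>exp (- 2 * E) / 4\<close> when \<open>E\<close> bounds the expected length of
  some code for them, and a product code has an expected length depending only on the moments of
  the marginals. No correlation inequality is needed. With \<open>2^J = \<epsilon> powr (- \<gamma>)\<close> the expected length is
  \<open>O(2^J)\<close>. Above level \<open>J\<close> this uses moments of an order \<open>s\<close> with \<open>s * \<delta> > 1\<close>, where the tolerance
  exceeds the size of the coefficients by \<open>2 powr (\<delta> * (j - J))\<close> and \<open>\<delta> < H - \<beta> - 1/p\<close>; for
  \<open>\<alpha> < 2\<close> this forces the additional \<open>1/\<alpha>\<close> in the hypothesis.
\<close>

section \<open>Smooth cutoffs and Lagrange interpolation\<close>

text \<open>Interpolation is used because its coefficients are finite combinations of values of
  \<open>R\<close>, hence limits of functionals of increments, and because it is exact on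
  polynomials of degree below \<open>m\<close>. With \<open>m > H\<close> the interpolation error of
  the kernel is \<alpha>-integrable at infinity, so the scale of a coefficient depends on its level
  but not on its position. The obstacle is that the coefficients of all levels are strongly
  dependent and, for \<alpha> < 2, heavy-tailed; expected code lengths simply add up, whatever the
  dependence. The tolerances express a balance around level \<open>J\<close>. At distance
  \<open>d\<close> below it there are about \<open>2^d\<close> times fewer coefficients, so the
  tolerance can shrink geometrically at the price of a moment of very low order. At distance
  \<open>d\<close> above it there are about \<open>2^d\<close> times more, so a coefficient must
  round to 0 and be almost free of cost except with probability of order
  \<open>2 powr (- s * \<delta> * d)\<close>, and this has to beat their number. Non-Gaussian stable
  laws only have moments of order \<open>s < \<alpha>\<close>, whereas the semi-norms of the levels
  are summable only for \<open>\<delta>\<close> below H - \<beta> - 1/p.\<close>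

primrec smooth :: "nat \<Rightarrow> (real \<Rightarrow> real) \<Rightarrow> bool" where
  "smooth 0 f \<longleftrightarrow> continuous_on UNIV f"
| "smooth (Suc l) f \<longleftrightarrow> (\<exists>f'. (\<forall>x. (f has_real_derivative f' x) (at x)) \<and> smooth l f')"

lemma smooth_SucE:
  assumes "smooth (Suc l) f"
  obtains f' where "\<forall>x. (f has_real_derivative f' x) (at x)" "smooth l f'"
  using assms by auto

lemma smooth_continuous: "smooth l f \<Longrightarrow> continuous_on UNIV f"
  by (cases l) (auto intro: continuous_at_imp_continuous_on DERIV_isCont)

lemma smooth_Suc_imp: "smooth (Suc l) f \<Longrightarrow> smooth l f"
proof (induction l arbitrary: f)
  case 0
  then show ?case using smooth_continuous[of "Suc 0" f] by simp
next
  case (Suc l)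
  obtain f' where "\<forall>x. (f has_real_derivative f' x) (at x)" "smooth (Suc l) f'"
    using Suc.prems(1) by (rule smooth_SucE)
  with Suc.IH[of f'] show ?case by auto
qed

lemma smooth_const: "smooth l (\<lambda>x. c)"
  by (induction l arbitrary: c) (auto intro!: exI[of _ "\<lambda>x. 0"])

lemma smooth_ident: "smooth l (\<lambda>x. x)"
  by (cases l) (auto intro!: exI[of _ "\<lambda>x. 1"] smooth_const)

lemma smooth_add: "smooth l f \<Longrightarrow> smooth l g \<Longrightarrow> smooth l (\<lambda>x. f x + g x)"
proof (induction l arbitrary: f g)
  case (Suc l)
  obtain f' where f': "\<forall>x. (f has_real_derivative f' x) (at x)" "smooth l f'"
    using Suc.prems(1) by (rule smooth_SucE)
  obtain g' where g': "\<forall>x. (g has_real_derivative g' x) (at x)" "smooth l g'"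
    using Suc.prems(2) by (rule smooth_SucE)
  note * = f'[rule_format] g'[rule_format]
  show ?case unfolding smooth.simps
    using Suc.IH[OF f'(2) g'(2)]
    by (intro exI[of _ "\<lambda>x. f' x + g' x"] conjI allI DERIV_add *)
qed (auto intro: continuous_on_add)

lemma smooth_mult: "smooth l f \<Longrightarrow> smooth l g \<Longrightarrow> smooth l (\<lambda>x. f x * g x)"
proof (induction l arbitrary: f g)
  case (Suc l)
  obtain f' where f': "\<forall>x. (f has_real_derivative f' x) (at x)" "smooth l f'"
    using Suc.prems(1) by (rule smooth_SucE)
  obtain g' where g': "\<forall>x. (g has_real_derivative g' x) (at x)" "smooth l g'"
    using Suc.prems(2) by (rule smooth_SucE)
  note * = f'[rule_format] g'[rule_format]
  have "smooth l (\<lambda>x. f' x * g x + g' x * f x)"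
    by (rule smooth_add[OF Suc.IH[OF f'(2) smooth_Suc_imp[OF Suc.prems(2)]]
          Suc.IH[OF g'(2) smooth_Suc_imp[OF Suc.prems(1)]]])
  then show ?case unfolding smooth.simps
    by (intro exI[of _ "\<lambda>x. f' x * g x + g' x * f x"] conjI allI DERIV_mult *)
qed (auto intro: continuous_on_mult)

lemma smooth_inverse: "smooth l f \<Longrightarrow> (\<And>x. f x \<noteq> 0) \<Longrightarrow> smooth l (\<lambda>x. inverse (f x))"
proof (induction l arbitrary: f)
  case (Suc l)
  obtain f' where f': "\<forall>x. (f has_real_derivative f' x) (at x)" "smooth l f'"
    using Suc.prems(1) by (rule smooth_SucE)
  note * = f'[rule_format]
  have "smooth l (\<lambda>x. inverse (f x))"
    by (rule Suc.IH[OF smooth_Suc_imp[OF Suc.prems(1)] Suc.prems(2)])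
  then have "smooth l (\<lambda>x. (-1) * (inverse (f x) * f' x * inverse (f x)))"
    using f'(2) by (intro smooth_mult smooth_const)
  then have "smooth l (\<lambda>x. - (inverse (f x) * f' x * inverse (f x)))" by simp
  then show ?case unfolding smooth.simps
    using Suc.prems(2)
    by (intro exI[of _ "\<lambda>x. - (inverse (f x) * f' x * inverse (f x))"] conjI allI DERIV_inverse' *)
qed (auto intro!: continuous_on_inverse)

lemma smooth_affine: "smooth l f \<Longrightarrow> smooth l (\<lambda>x. f (c * x + d))"
proof (induction l arbitrary: f)
  case 0
  then have "continuous_on UNIV f" by simp
  then show ?case by (auto intro!: continuous_intros continuous_on_compose2[of UNIV f])
next
  case (Suc l)
  obtain f' where f': "\<forall>x. (f has_real_derivative f' x) (at x)" "smooth l f'"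
    using Suc.prems(1) by (rule smooth_SucE)
  note * = f'[rule_format]
  have "((\<lambda>x. f (c * x + d)) has_real_derivative c * f' (c * x + d)) (at x)" for x
  proof -
    have "((\<lambda>x. c * x + d) has_real_derivative c) (at x)" by (auto intro!: derivative_eq_intros)
    from DERIV_chain2[where f = f, OF *(1)[of "c * x + d"] this] show ?thesis
      by (simp add: mult.commute)
  qed
  moreover have "smooth l (\<lambda>x. c * f' (c * x + d))"
    by (rule smooth_mult[OF smooth_const Suc.IH[OF f'(2)]])
  ultimately show ?case
    unfolding smooth.simps by (intro exI[of _ "\<lambda>x. c * f' (c * x + d)"]) blast
qed

lemma smooth_diff: "smooth l f \<Longrightarrow> smooth l g \<Longrightarrow> smooth l (\<lambda>x. f x - g x)"
  using smooth_add[of l f "\<lambda>x. (-1) * g x"] smooth_mult[OF smooth_const, of l g "-1"] by simp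

lemma smooth_prod: "(\<And>i. i \<in> A \<Longrightarrow> smooth l (f i)) \<Longrightarrow> smooth l (\<lambda>x. \<Prod>i\<in>A. f i x)"
  by (induction A rule: infinite_finite_induct) (auto intro: smooth_const smooth_mult)

lemma smooth_sum: "(\<And>i. i \<in> A \<Longrightarrow> smooth l (f i)) \<Longrightarrow> smooth l (\<lambda>x. \<Sum>i\<in>A. f i x)"
  by (induction A rule: infinite_finite_induct) (auto intro: smooth_const smooth_add)

text \<open>\<open>smooth\<close> carries the derivative along as an existential witness, which
  makes closure under sums, products and affine substitutions a plain induction. \<open>CK\<close>
  speaks of iterates of \<open>deriv\<close>; this is the bridge between the two.\<close>

lemma smooth_imp_deriv:
  "smooth l f \<Longrightarrow> (\<forall>k<l. \<forall>x. (deriv ^^ k) f field_differentiable (at x)) \<and>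
     continuous_on UNIV ((deriv ^^ l) f)"
proof (induction l arbitrary: f)
  case (Suc l)
  obtain f' where f': "\<forall>x. (f has_real_derivative f' x) (at x)" "smooth l f'"
    using Suc.prems(1) by (rule smooth_SucE)
  note * = f'[rule_format]
  have "deriv f = f'" using * DERIV_imp_deriv by blast
  with Suc.IH[OF *(2)] * show ?case
    by (auto simp: funpow_Suc_right field_differentiable_def less_Suc_eq_0_disj simp del: funpow.simps)
qed auto

lemma smooth_imp_CK:
  assumes "smooth l f" and supp: "\<And>x. R < \<bar>x\<bar> \<Longrightarrow> f x = 0"
  shows "f \<in> CK l"
proof -
  have "{x. f x \<noteq> 0} \<subseteq> cball 0 R" using supp by (fastforce simp: dist_real_def not_less[symmetric])
  then have "bounded {x. f x \<noteq> 0}" using bounded_cball bounded_subset by blast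
  then show ?thesis using smooth_imp_deriv[OF assms(1)] by (simp add: CK_def)
qed

section \<open>A partition of unity of class C^l by integer translates of one bump\<close>

definition ramp :: "nat \<Rightarrow> real \<Rightarrow> real" where
  "ramp l x = max 0 x ^ Suc l"

text \<open>The quotient goes from 0 to 1 on the unit interval, and its denominator never vanishes
  because \<open>x\<close> and \<open>1 - x\<close> are not both nonpositive. Smoothness of order
  \<open>l\<close> is thus inherited from \<open>ramp\<close> by algebra alone.\<close>

definition smooth_step :: "nat \<Rightarrow> real \<Rightarrow> real" where
  "smooth_step l x = ramp l x / (ramp l x + ramp l (1 - x))"

text \<open>Being a difference of two shifts of one step, it has integer translates that telescope,
  so they sum to 1 without any normalisation.\<close>

definition bump :: "nat \<Rightarrow> real \<Rightarrow> real" where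
  "bump l x = smooth_step l (x + 1) - smooth_step l x"

lemma ramp_deriv:
  "((\<lambda>x. max 0 x ^ Suc (Suc n)) has_real_derivative real (Suc (Suc n)) * max 0 x ^ Suc n) (at x)"
proof (cases "x = 0")
  case True
  have "((\<lambda>h. (max 0 (0 + h) ^ Suc (Suc n) - max 0 0 ^ Suc (Suc n)) / h) \<longlongrightarrow> (0::real)) (at 0)"
  proof (rule Lim_null_comparison)
    show "\<forall>\<^sub>F h in at 0. norm ((max 0 (0 + h) ^ Suc (Suc n) - max 0 0 ^ Suc (Suc n)) / h) \<le> \<bar>h\<bar> ^ Suc n"
      by (intro always_eventually allI) (auto simp: max_def abs_mult power_abs mult_nonpos_nonneg)
    show "((\<lambda>h::real. \<bar>h\<bar> ^ Suc n) \<longlongrightarrow> 0) (at 0)"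
      by (auto intro!: tendsto_eq_intros)
  qed
  then show ?thesis using True by (simp add: DERIV_def)
next
  case False
  show ?thesis
  proof (cases "x > 0")
    case True
    have "((\<lambda>x. x ^ Suc (Suc n)) has_real_derivative real (Suc (Suc n)) * max 0 x ^ Suc n) (at x)"
      using True DERIV_pow[of "Suc (Suc n)" x UNIV] by (simp add: max_def del: power_Suc)
    then show ?thesis
      by (rule DERIV_cong_ev[THEN iffD1, rotated -1])
        (use True in \<open>auto intro!: eventually_mono[OF eventually_gt_at_top]
           eventually_mono[OF eventually_nhds_in_open[of "{0<..}"]]\<close>)
  next
    case F: False
    have "((\<lambda>x. 0) has_real_derivative real (Suc (Suc n)) * max 0 x ^ Suc n) (at x)"
      using F False by (auto intro!: derivative_eq_intros)
    then show ?thesis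
      by (rule DERIV_cong_ev[THEN iffD1, rotated -1])
        (use F False in \<open>auto intro!: eventually_mono[OF eventually_nhds_in_open[of "{..<0}"]]\<close>)
  qed
qed

lemma smooth_ramp: "smooth l (ramp l)"
proof -
  have "smooth l (\<lambda>x. max 0 x ^ Suc l)"
  proof (induction l)
    case 0
    show ?case by (auto intro!: continuous_intros)
  next
    case (Suc l)
    have "smooth l (\<lambda>x. real (Suc (Suc l)) * max 0 x ^ Suc l)"
      by (intro smooth_mult smooth_const Suc)
    then show ?case unfolding smooth.simps
      by (intro exI[of _ "\<lambda>x. real (Suc (Suc l)) * max 0 x ^ Suc l"] conjI allI ramp_deriv)
  qed
  then show ?thesis by (simp add: ramp_def[abs_def])
qed

lemma ramp_denom_pos: "0 < ramp l x + ramp l (1 - x)"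
proof -
  have "0 \<le> ramp l x" "0 \<le> ramp l (1 - x)" by (auto simp: ramp_def)
  moreover have "0 < ramp l x \<or> 0 < ramp l (1 - x)"
    by (cases "0 < x") (auto simp: ramp_def max_def)
  ultimately show ?thesis by linarith
qed

lemma smooth_smooth_step: "smooth l (smooth_step l)"
proof -
  have 1: "smooth l (\<lambda>x. ramp l ((-1) * x + 1))" by (rule smooth_affine[OF smooth_ramp])
  have "smooth l (\<lambda>x. ramp l x * inverse (ramp l x + ramp l ((-1) * x + 1)))"
  proof (rule smooth_mult[OF smooth_ramp smooth_inverse[OF smooth_add[OF smooth_ramp 1]]])
    show "ramp l x + ramp l (-1 * x + 1) \<noteq> 0" for x
      using ramp_denom_pos[of l x] by (simp add: add.commute)
  qed
  then show ?thesis by (simp add: smooth_step_def[abs_def] divide_inverse)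
qed

lemma smooth_step_0: "x \<le> 0 \<Longrightarrow> smooth_step l x = 0"
  by (simp add: smooth_step_def ramp_def)

lemma smooth_step_1: "1 \<le> x \<Longrightarrow> smooth_step l x = 1"
  by (simp add: smooth_step_def ramp_def max_def)

lemma smooth_step_bounds: "0 \<le> smooth_step l x" "smooth_step l x \<le> 1"
proof -
  have "0 \<le> ramp l x" "0 \<le> ramp l (1 - x)" by (auto simp: ramp_def)
  then show "0 \<le> smooth_step l x" "smooth_step l x \<le> 1"
    using ramp_denom_pos[of l x] by (auto simp: smooth_step_def)
qed

lemma smooth_bump: "smooth l (bump l)"
proof -
  have "smooth l (\<lambda>x. smooth_step l (1 * x + 1) - smooth_step l x)"
    by (rule smooth_diff[OF smooth_affine[OF smooth_smooth_step] smooth_smooth_step])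
  then show ?thesis by (simp add: bump_def[abs_def])
qed

lemma bump_eq_0: "1 \<le> \<bar>x\<bar> \<Longrightarrow> bump l x = 0"
  by (cases "x \<ge> 0") (auto simp: bump_def smooth_step_0 smooth_step_1)

lemma abs_bump_le: "\<bar>bump l x\<bar> \<le> 1"
  using smooth_step_bounds[of l x] smooth_step_bounds[of l "x + 1"] by (auto simp: bump_def)

lemma sum_bump_telescope:
  "(\<Sum>i<n. bump l (x - real i)) = smooth_step l (x + 1) - smooth_step l (x + 1 - real n)"
  by (induction n) (auto simp: bump_def algebra_simps)

lemma sum_bump_window: "(\<Sum>n\<in>{\<lfloor>x\<rfloor>, \<lfloor>x\<rfloor> + 1}. bump l (x - real_of_int n)) = 1"
proof -
  have "{..<2::nat} = {0, 1}" by auto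
  then show ?thesis
    using sum_bump_telescope[of l "x - \<lfloor>x\<rfloor>" 2] smooth_step_0[of "x - real_of_int \<lfloor>x\<rfloor> + 1 - 2" l]
      smooth_step_1[of "x - real_of_int \<lfloor>x\<rfloor> + 1" l]
    by (simp add: diff_diff_eq add.commute) linarith
qed

text \<open>On the support of a coarse bump these five fine translates already form a partition of
  unity; this fixes the range of \<open>r\<close> in all that follows.\<close>

lemma sum_bump_half:
  assumes "\<bar>y\<bar> \<le> 1"
  shows "(\<Sum>r\<in>{-2..2::int}. bump l (2 * y - real_of_int r)) = 1"
proof -
  have "{-2..2::int} = {-2, -1, 0, 1, 2}" by auto
  moreover have "{..<5::nat} = {0, 1, 2, 3, 4}" by auto
  ultimately show ?thesis
    using sum_bump_telescope[of l "2 * y + 2" 5] assms smooth_step_1[of "2 * y + 2 + 1" l]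
      smooth_step_0[of "2 * y + 2 + 1 - 5" l]
    by (simp add: abs_le_iff) (simp add: diff_diff_eq add.commute)
qed

section \<open>Lagrange interpolation at the nodes 0, ..., m - 1\<close>

definition lagrange :: "nat \<Rightarrow> nat \<Rightarrow> real \<Rightarrow> real" where
  "lagrange m i x = (\<Prod>k\<in>{..<m} - {i}. (x - real k) / (real i - real k))"

lemma smooth_lagrange: "smooth l (lagrange m i)"
proof -
  have "smooth l (\<lambda>x. \<Prod>k\<in>{..<m} - {i}. (x - real k) * inverse (real i - real k))"
    by (intro smooth_prod smooth_mult smooth_diff smooth_ident smooth_const)
  then show ?thesis by (simp add: lagrange_def[abs_def] divide_inverse)
qed

lemma lagrange_node: "i < m \<Longrightarrow> k < m \<Longrightarrow> lagrange m i (real k) = (if i = k then 1 else 0)"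
  by (auto simp: lagrange_def intro!: prod.neutral)

text \<open>The same basis as formal polynomials, because uniqueness of interpolation is a statement
  about degrees.\<close>

definition lagrange_poly :: "nat \<Rightarrow> nat \<Rightarrow> real poly" where
  "lagrange_poly m i = (\<Prod>k\<in>{..<m} - {i}. smult (1 / (real i - real k)) [:- real k, 1:])"

lemma poly_lagrange: "poly (lagrange_poly m i) x = lagrange m i x"
  by (simp add: lagrange_poly_def lagrange_def poly_prod algebra_simps diff_divide_distrib)

lemma degree_lagrange: "i < m \<Longrightarrow> degree (lagrange_poly m i) < m"
proof -
  assume i: "i < m"
  have "degree (lagrange_poly m i) \<le> (\<Sum>k\<in>{..<m} - {i}. degree (smult (1 / (real i - real k)) [:- real k, 1:]))"
    unfolding lagrange_poly_def
    using degree_prod_sum_le[of "{..<m} - {i}" "\<lambda>k. smult (1 / (real i - real k)) [:- real k, 1:]"]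
    by (simp only: o_def finite_lessThan finite_Diff)
  also have "\<dots> \<le> (\<Sum>k\<in>{..<m} - {i}. 1)"
  proof (rule sum_mono)
    fix k
    show "degree (smult (1 / (real i - real k)) [:- real k, 1:]) \<le> 1"
      by (rule order_trans[OF degree_smult_le]) simp
  qed
  also have "\<dots> = m - 1" using i by simp
  finally show ?thesis using i by simp
qed

lemma lagrange_reproduce:
  assumes "degree p < m"
  shows "(\<Sum>i<m. poly p (real i) * lagrange m i x) = poly p x"
proof -
  \<comment> \<open>The interpolant minus \<open>p\<close> has degree below \<open>m\<close> and
    vanishes at \<open>m\<close> nodes.\<close>
  define q where "q = (\<Sum>i<m. smult (poly p (real i)) (lagrange_poly m i)) - p"
  have "degree (smult (poly p (real i)) (lagrange_poly m i)) \<le> m - 1" if "i < m" for i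
    using degree_smult_le[of "poly p (real i)" "lagrange_poly m i"] degree_lagrange[OF that]
    by linarith
  then have "degree (\<Sum>i<m. smult (poly p (real i)) (lagrange_poly m i)) \<le> m - 1"
    by (intro degree_sum_le) auto
  moreover have "degree p \<le> m - 1" using assms by linarith
  ultimately have "degree q \<le> m - 1" unfolding q_def by (rule degree_diff_le)
  then have "degree q < m" using assms by linarith
  moreover have "poly q (real k) = 0" if "k < m" for k
  proof -
    have "(\<Sum>i<m. poly p (real i) * lagrange m i (real k)) = (\<Sum>i<m. if i = k then poly p (real k) else 0)"
      by (rule sum.cong) (use that in \<open>auto simp: lagrange_node\<close>)
    then show ?thesis using that by (simp add: q_def poly_sum poly_lagrange)
  qed
  ultimately have "q = 0"
    using poly_eqI_degree[of "real ` {..<m}" q 0] by (auto simp: card_image)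
  then have "poly (\<Sum>i<m. smult (poly p (real i)) (lagrange_poly m i)) x = poly p x"
    by (simp add: q_def)
  then show ?thesis by (simp add: poly_sum poly_lagrange)
qed

text \<open>A basis polynomial seen through an affine change of variable still has degree below
  \<open>m\<close>, so interpolating it on another grid loses nothing. The case
  \<open>c = 1 / 2\<close>, \<open>d = r / 2\<close> is the passage from one dyadic level to the
  next.\<close>

lemma lagrange_reproduce_lagrange:
  assumes "i < m"
  shows "(\<Sum>k<m. lagrange m i (c * real k + d) * lagrange m k x) = lagrange m i (c * x + d)"
proof -
  have "degree (pcompose (lagrange_poly m i) [:d, c:]) < m"
    using degree_pcompose_le[of "lagrange_poly m i" "[:d, c:]"] degree_lagrange[OF assms]
    by (cases "c = 0") (auto intro: le_less_trans)
  from lagrange_reproduce[OF this, of x] show ?thesis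
    by (simp add: poly_pcompose poly_lagrange algebra_simps)
qed

section \<open>Multiresolution by local interpolation\<close>

text \<open>The variable is the local coordinate \<open>2 ^ j * t - n\<close> of the cell
  \<open>n\<close>, in which the nodes are 0, ..., m - 1 at every level.\<close>

definition interp :: "nat \<Rightarrow> nat \<Rightarrow> (real \<Rightarrow> real) \<Rightarrow> int \<Rightarrow> real \<Rightarrow> real" where
  "interp m j f n x = (\<Sum>i<m. f ((of_int n + real i) / 2 ^ j) * lagrange m i x)"

definition approx :: "nat \<Rightarrow> nat \<Rightarrow> nat \<Rightarrow> (real \<Rightarrow> real) \<Rightarrow> real \<Rightarrow> real" where
  "approx l m j f t =
     (\<Sum>n\<in>{\<lfloor>2 ^ j * t\<rfloor>, \<lfloor>2 ^ j * t\<rfloor> + 1}.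
        bump l (2 ^ j * t - of_int n) * interp m j f n (2 ^ j * t - of_int n))"

definition interp_error :: "nat \<Rightarrow> nat \<Rightarrow> (real \<Rightarrow> real) \<Rightarrow> int \<Rightarrow> real \<Rightarrow> real" where
  "interp_error m j f n y = f ((of_int n + y) / 2 ^ j) - interp m j f n y"

text \<open>The \<open>i\<close>-th node of the fine cell \<open>2 * n + r\<close>, in the local
  coordinate of the coarse cell \<open>n\<close>. It can be as small as -1, so the cell
  \<open>n = 0\<close> may read a negative time.\<close>

definition node :: "int \<Rightarrow> nat \<Rightarrow> real" where
  "node r i = (real i + of_int r) / 2"

definition dyadic_sum :: "(real \<Rightarrow> real) \<Rightarrow> nat \<Rightarrow> (nat \<Rightarrow> real) \<Rightarrow> real \<Rightarrow> real" where
  "dyadic_sum g j d t = (\<Sum>n\<le>2 ^ j. d n * g (2 ^ j * t - real n))"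

definition wavelet :: "nat \<Rightarrow> nat \<Rightarrow> int \<Rightarrow> nat \<Rightarrow> real \<Rightarrow> real" where
  "wavelet l m r i y = bump l y * (bump l (2 * y - of_int r) * lagrange m i (2 * y - of_int r))"

text \<open>\<open>b\<close> controls the values used at level 0, where the cells 0 and 1 read
  integer times up to \<open>m\<close>; \<open>e j\<close> controls the details between the levels
  \<open>j\<close> and \<open>j + 1\<close>.\<close>

definition coefficients_le :: "nat \<Rightarrow> (real \<Rightarrow> real) \<Rightarrow> real \<Rightarrow> (nat \<Rightarrow> real) \<Rightarrow> bool" where
  "coefficients_le m f b e \<longleftrightarrow> (\<forall>q\<le>m. \<bar>f (real q)\<bar> \<le> b) \<and>
     (\<forall>j n r i. n \<le> 2 ^ j \<longrightarrow> r \<in> {-2..2} \<longrightarrow> i < m \<longrightarrow>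
        \<bar>interp_error m j f (int n) (node r i)\<bar> \<le> e j)"

section \<open>The difference of two consecutive approximations\<close>

lemma bump_window:
  assumes "finite A" and A: "\<And>n. \<bar>x - of_int n\<bar> < 1 \<Longrightarrow> n \<in> A"
  shows "(\<Sum>n\<in>{\<lfloor>x\<rfloor>, \<lfloor>x\<rfloor> + 1}. bump l (x - of_int n) * g n) = (\<Sum>n\<in>A. bump l (x - of_int n) * g n)"
proof -
  let ?W = "{\<lfloor>x\<rfloor>, \<lfloor>x\<rfloor> + 1}"
  have W: "n \<in> ?W" if "\<bar>x - of_int n\<bar> < 1" for n
    using that by (auto simp: abs_less_iff) linarith
  have 0: "bump l (x - of_int n) = 0" if "n \<notin> ?W \<or> n \<notin> A" for n
    using W[of n] A[of n] that bump_eq_0[of "x - of_int n" l] by fastforce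
  have "(\<Sum>n\<in>?W. bump l (x - of_int n) * g n) = (\<Sum>n\<in>?W \<union> A. bump l (x - of_int n) * g n)"
    using 0 assms(1) by (intro sum.mono_neutral_left) auto
  also have "\<dots> = (\<Sum>n\<in>A. bump l (x - of_int n) * g n)"
    using 0 assms(1) by (intro sum.mono_neutral_right) auto
  finally show ?thesis .
qed

lemma bump_window_nat:
  assumes "0 \<le> x" "x \<le> 2 ^ j"
  shows "(\<Sum>n\<in>{\<lfloor>x\<rfloor>, \<lfloor>x\<rfloor> + 1}. bump l (x - of_int n) * g n)
    = (\<Sum>n\<le>2 ^ j. bump l (x - real n) * g (int n))"
proof -
  have "(\<Sum>n\<in>{\<lfloor>x\<rfloor>, \<lfloor>x\<rfloor> + 1}. bump l (x - of_int n) * g n)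
      = (\<Sum>n\<in>int ` {..2 ^ j}. bump l (x - of_int n) * g n)"
  proof (rule bump_window)
    fix n :: int
    assume "\<bar>x - of_int n\<bar> < 1"
    with assms have "-1 < real_of_int n" "real_of_int n < 2 ^ j + 1" by linarith+
    then have "-1 < n" "n < 2 ^ j + 1" by (simp_all flip: of_int_less_iff[where 'a = real])
    then have "n = int (nat n)" "nat n \<le> 2 ^ j" by (auto simp: nat_le_iff)
    then show "n \<in> int ` {..2 ^ j}" by blast
  qed simp
  also have "\<dots> = (\<Sum>n\<le>2 ^ j. bump l (x - real n) * g (int n))"
    by (subst sum.reindex) auto
  finally show ?thesis .
qed

text \<open>The coarse interpolant is a polynomial of degree below \<open>m\<close>, hence equal to
  its own interpolant at the fine nodes. In the difference, only the errors of the coarse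
  interpolant at these nodes remain.\<close>

lemma interp_refine:
  "interp m (Suc j) f (2 * n + r) (2 * y - of_int r) - interp m j f n y =
     (\<Sum>i<m. interp_error m j f n (node r i) * lagrange m i (2 * y - of_int r))"
proof -
  have 1: "interp m j f n y =
    (\<Sum>i<m. interp m j f n (node r i) * lagrange m i (2 * y - of_int r))"
  proof -
    have "(\<Sum>i<m. interp m j f n (node r i) * lagrange m i (2 * y - of_int r))
      = (\<Sum>i<m. \<Sum>k<m. f ((of_int n + real k) / 2 ^ j) *
           (lagrange m k (1 / 2 * real i + of_int r / 2) * lagrange m i (2 * y - of_int r)))"
      by (simp add: node_def interp_def sum_distrib_right add_divide_distrib mult.assoc)
    also have "\<dots> = (\<Sum>k<m. \<Sum>i<m. f ((of_int n + real k) / 2 ^ j) *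
           (lagrange m k (1 / 2 * real i + of_int r / 2) * lagrange m i (2 * y - of_int r)))"
      by (rule sum.swap)
    also have "\<dots> = (\<Sum>k<m. f ((of_int n + real k) / 2 ^ j) * lagrange m k y)"
      by (intro sum.cong refl, subst sum_distrib_left[symmetric], subst lagrange_reproduce_lagrange)
        (auto simp: field_simps)
    finally show ?thesis by (simp add: interp_def)
  qed
  have 2: "(of_int (2 * n + r) + real i) / 2 ^ Suc j = (of_int n + node r i) / 2 ^ j" for i
    by (simp add: node_def field_simps)
  show ?thesis
    unfolding 1 by (simp only: interp_error_def interp_def[of m "Suc j"] 2 left_diff_distrib sum_subtractf)
qed

lemma approx_diff:
  assumes "0 \<le> t" "t \<le> 1"
  shows "approx l m (Suc j) f t - approx l m j f t =
    (\<Sum>r\<in>{-2..2}. \<Sum>i<m. dyadic_sum (wavelet l m r i) j (\<lambda>n. interp_error m j f (int n) (node r i)) t)"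
proof -
  define x where "x = 2 ^ j * t"
  let ?W = "{\<lfloor>x\<rfloor>, \<lfloor>x\<rfloor> + 1}"
  have x: "0 \<le> x" "x \<le> 2 ^ j" using assms by (auto simp: x_def)
  \<comment> \<open>The fine approximation is re-centred at a coarse index \<open>n\<close> of the
    window: a fine index \<open>k\<close> with nonzero bump is within 2 of \<open>2 * n\<close>, and
    \<open>r\<close> is \<open>k - 2 * n\<close>.\<close>
  have 1: "approx l m (Suc j) f t = (\<Sum>r\<in>{-2..2}. bump l (2 * (x - of_int n) - of_int r) *
      interp m (Suc j) f (2 * n + r) (2 * (x - of_int n) - of_int r))" if "n \<in> ?W" for n
  proof -
    have y: "\<bar>x - of_int n\<bar> \<le> 1" using that by auto linarith+
    have x2: "2 ^ Suc j * t = 2 * x" by (simp add: x_def)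
    have "approx l m (Suc j) f t = (\<Sum>k\<in>{2*n-2..2*n+2}. bump l (2 * x - of_int k) * interp m (Suc j) f k (2 * x - of_int k))"
      unfolding approx_def x2
    proof (rule bump_window)
      fix k assume "\<bar>2 * x - real_of_int k\<bar> < 1"
      with y have "real_of_int (2 * n - 3) < real_of_int k" "real_of_int k < real_of_int (2 * n + 3)"
        by (auto simp: abs_le_iff abs_less_iff)
      then show "k \<in> {2*n-2..2*n+2}" unfolding of_int_less_iff by simp
    qed simp
    also have "\<dots> = (\<Sum>r\<in>{-2..2}. bump l (2 * (x - of_int n) - of_int r) *
      interp m (Suc j) f (2 * n + r) (2 * (x - of_int n) - of_int r))"
      by (rule sum.reindex_bij_witness[of _ "\<lambda>r. 2 * n + r" "\<lambda>k. k - 2 * n"]) (auto simp: algebra_simps)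
    finally show ?thesis .
  qed
  \<comment> \<open>The coarse partition of unity is inserted in front of the fine approximation, so
    that both levels become sums over the same \<open>n\<close>.\<close>
  have "approx l m (Suc j) f t - approx l m j f t =
    (\<Sum>n\<in>?W. bump l (x - of_int n)) * approx l m (Suc j) f t
      - (\<Sum>n\<in>?W. bump l (x - of_int n) * interp m j f n (x - of_int n))"
    by (simp only: sum_bump_window mult_1) (simp add: approx_def x_def)
  also have "\<dots> = (\<Sum>n\<in>?W. bump l (x - of_int n) *
      (approx l m (Suc j) f t - interp m j f n (x - of_int n)))"
    by (simp only: sum_distrib_right right_diff_distrib sum_subtractf)
  also have "\<dots> = (\<Sum>n\<in>?W. bump l (x - of_int n) *
      (\<Sum>r\<in>{-2..2}. bump l (2 * (x - of_int n) - of_int r) *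
        (\<Sum>i<m. interp_error m j f n (node r i) * lagrange m i (2 * (x - of_int n) - of_int r))))"
  proof (rule sum.cong)
    fix n assume n: "n \<in> ?W"
    let ?y = "x - of_int n"
    have y: "\<bar>?y\<bar> \<le> 1" using n by auto linarith+
    have "approx l m (Suc j) f t - interp m j f n ?y =
      (\<Sum>r\<in>{-2..2}. bump l (2 * ?y - of_int r) * interp m (Suc j) f (2 * n + r) (2 * ?y - of_int r))
       - (\<Sum>r\<in>{-2..2::int}. bump l (2 * ?y - of_int r)) * interp m j f n ?y"
      by (simp only: 1[OF n] sum_bump_half[OF y] mult_1)
    also have "\<dots> = (\<Sum>r\<in>{-2..2}. bump l (2 * ?y - of_int r) *
        (interp m (Suc j) f (2 * n + r) (2 * ?y - of_int r) - interp m j f n ?y))"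
      by (simp only: sum_distrib_right right_diff_distrib sum_subtractf)
    finally show "bump l ?y * (approx l m (Suc j) f t - interp m j f n ?y) = bump l ?y *
      (\<Sum>r\<in>{-2..2}. bump l (2 * ?y - of_int r) *
        (\<Sum>i<m. interp_error m j f n (node r i) * lagrange m i (2 * ?y - of_int r)))"
      by (simp only: interp_refine)
  qed simp
  also have "\<dots> = (\<Sum>n\<le>2 ^ j. bump l (x - real n) *
      (\<Sum>r\<in>{-2..2}. bump l (2 * (x - real n) - of_int r) *
        (\<Sum>i<m. interp_error m j f (int n) (node r i) * lagrange m i (2 * (x - real n) - of_int r))))"
    using bump_window_nat[OF x, of l "\<lambda>n. \<Sum>r\<in>{-2..2}. bump l (2 * (x - of_int n) - of_int r) *
        (\<Sum>i<m. interp_error m j f n (node r i) * lagrange m i (2 * (x - of_int n) - of_int r))"]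
    by (simp only: of_int_of_nat_eq)
  also have "\<dots> = (\<Sum>n\<le>2 ^ j. \<Sum>r\<in>{-2..2}. \<Sum>i<m.
       interp_error m j f (int n) (node r i) * wavelet l m r i (x - real n))"
    by (simp add: sum_distrib_left wavelet_def mult_ac)
  also have "\<dots> = (\<Sum>r\<in>{-2..2}. \<Sum>n\<le>2 ^ j. \<Sum>i<m.
       interp_error m j f (int n) (node r i) * wavelet l m r i (x - real n))"
    by (rule sum.swap)
  also have "\<dots> = (\<Sum>r\<in>{-2..2}. \<Sum>i<m. \<Sum>n\<le>2 ^ j.
       interp_error m j f (int n) (node r i) * wavelet l m r i (x - real n))"
    by (intro sum.cong refl sum.swap)
  finally show ?thesis by (simp only: dyadic_sum_def x_def)
qed

lemma approx_0:
  assumes "0 \<le> t" "t \<le> 1"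
  shows "approx l m 0 f t =
    (\<Sum>i<m. dyadic_sum (\<lambda>y. bump l y * lagrange m i y) 0 (\<lambda>n. f (real (n + i))) t)"
proof -
  have "approx l m 0 f t = (\<Sum>n\<le>2 ^ 0. bump l (t - real n) * interp m 0 f (int n) (t - real n))"
    unfolding approx_def
    using bump_window_nat[of t 0 l "\<lambda>n. interp m 0 f n (t - of_int n)"] assms by simp
  also have "\<dots> = (\<Sum>n\<le>2 ^ 0. \<Sum>i<m. f (real (n + i)) * (bump l (2 ^ 0 * t - real n) * lagrange m i (2 ^ 0 * t - real n)))"
    by (simp add: interp_def sum_distrib_left mult_ac)
  also have "\<dots> = (\<Sum>i<m. \<Sum>n\<le>2 ^ 0. f (real (n + i)) * (bump l (2 ^ 0 * t - real n) * lagrange m i (2 ^ 0 * t - real n)))"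
    by (rule sum.swap)
  finally show ?thesis by (simp only: dyadic_sum_def)
qed

lemma lagrange_bounded: "\<exists>B>0. \<forall>i<m. \<forall>x. \<bar>x\<bar> \<le> 1 \<longrightarrow> \<bar>lagrange m i x\<bar> \<le> B"
proof -
  have "\<exists>B. \<forall>x\<in>{-1..1}. norm (lagrange m i x) \<le> B" for i
  proof -
    have "continuous_on {-1..1} (lagrange m i)"
      using smooth_lagrange[of 0 m i] by (auto intro: continuous_on_subset)
    then have "bounded (lagrange m i ` {-1..1})"
      by (intro compact_imp_bounded compact_continuous_image) auto
    then show ?thesis by (auto simp: bounded_iff)
  qed
  then obtain B where B: "\<And>i x. x \<in> {-1..1} \<Longrightarrow> norm (lagrange m i x) \<le> B i" by metis
  have "0 \<le> B i" for i using norm_ge_zero order_trans[OF norm_ge_zero B[of 0 i]] by simp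
  then have "B i \<le> 1 + (\<Sum>i<m. B i)" "0 < 1 + (\<Sum>i<m. B i)" if "i < m" for i
    using member_le_sum[of i "{..<m}" B] that by (auto simp: add_pos_nonneg sum_nonneg)
  moreover have "0 < 1 + (\<Sum>i<m. B i)" using \<open>\<And>i. 0 \<le> B i\<close> by (simp add: add_pos_nonneg sum_nonneg)
  ultimately show ?thesis
    using B by (intro exI[of _ "1 + (\<Sum>i<m. B i)"])
      (fastforce simp: abs_le_iff intro: order_trans)
qed

lemma sum_lagrange: "0 < m \<Longrightarrow> (\<Sum>i<m. lagrange m i x) = 1"
  using lagrange_reproduce[of 1 m x] by simp

text \<open>Each local interpolant at \<open>t\<close> is a combination of values of
  \<open>f\<close> at points within \<open>(m + 1) / 2 ^ j\<close> of \<open>t\<close>, with bounded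
  weights of sum 1; uniform continuity on a compact set does the rest.\<close>

lemma approx_uniform_limit:
  assumes f: "continuous_on UNIV f" and m: "0 < m"
  shows "uniform_limit {0..1} (\<lambda>j. approx l m j f) f sequentially"
proof (rule uniform_limitI)
  fix e :: real
  assume e: "0 < e"
  obtain B where "B > 0 \<and> (\<forall>i<m. \<forall>x. \<bar>x\<bar> \<le> 1 \<longrightarrow> \<bar>lagrange m i x\<bar> \<le> B)"
    using lagrange_bounded ..
  then have B: "B > 0" "\<And>i x. i < m \<Longrightarrow> \<bar>x\<bar> \<le> 1 \<Longrightarrow> \<bar>lagrange m i x\<bar> \<le> B" by auto
  define S where "S = {- (real m + 1)..real m + 2}"
  have "uniformly_continuous_on S f"
    by (intro compact_uniformly_continuous continuous_on_subset[OF f]) (auto simp: S_def)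
  \<comment> \<open>Two cells, \<open>m\<close> nodes in each, weights at most \<open>B\<close>: the
    total error is at most \<open>2 * m * h * B = e / 2\<close>.\<close>
  moreover define h where "h = e / (4 * (real m * B))"
  have h: "0 < h" using e B m by (simp add: h_def)
  ultimately obtain d where d: "d > 0" "\<And>x y. x \<in> S \<Longrightarrow> y \<in> S \<Longrightarrow> dist y x < d \<Longrightarrow> dist (f y) (f x) < h"
    unfolding uniformly_continuous_on_def by metis
  have "(\<lambda>j. (real m + 1) / 2 ^ j) \<longlonglongrightarrow> 0" by (rule LIMSEQ_divide_realpow_zero) simp
  then have "\<forall>\<^sub>F j in sequentially. (real m + 1) / 2 ^ j < d"
    using d(1) by (rule order_tendstoD)
  then show "\<forall>\<^sub>F j in sequentially. \<forall>t\<in>{0..1}. dist (approx l m j f t) (f t) < e"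
  proof eventually_elim
    case (elim j)
    show ?case
    proof
      fix t :: real assume t: "t \<in> {0..1}"
      define x where "x = 2 ^ j * t"
      let ?W = "{\<lfloor>x\<rfloor>, \<lfloor>x\<rfloor> + 1}"
      have ft: "f t = (\<Sum>n\<in>?W. bump l (x - of_int n) * f t)"
        using sum_bump_window[of l x] by (simp only: sum_distrib_right[symmetric] mult_1)
      have bd: "\<bar>interp m j f n (x - of_int n) - f t\<bar> \<le> real m * (h * B)" if "n \<in> ?W" for n
      proof -
        have y: "\<bar>x - of_int n\<bar> \<le> 1" using that by auto linarith+
        have "interp m j f n (x - of_int n) - f t
          = (\<Sum>i<m. (f ((of_int n + real i) / 2 ^ j) - f t) * lagrange m i (x - of_int n))"
          using sum_lagrange[OF m, of "x - of_int n"]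
          by (simp add: interp_def left_diff_distrib sum_subtractf flip: sum_distrib_left)
        also have "\<bar>\<dots>\<bar> \<le> (\<Sum>i<m. h * B)"
        proof (rule order_trans[OF sum_abs], rule sum_mono)
          fix i assume i: "i \<in> {..<m}"
          have "(of_int n + real i) / 2 ^ j - t = (real i - (x - of_int n)) / 2 ^ j"
            by (simp add: x_def field_simps)
          moreover have "\<bar>real i - (x - of_int n)\<bar> \<le> real m + 1" using i y by (auto simp: abs_le_iff)
          ultimately have 1: "\<bar>(of_int n + real i) / 2 ^ j - t\<bar> \<le> (real m + 1) / 2 ^ j"
            by (simp add: divide_right_mono)
          also have "\<dots> \<le> real m + 1" by (simp add: divide_le_eq)
          finally have "(of_int n + real i) / 2 ^ j \<in> S" "t \<in> S" using t by (auto simp: S_def abs_le_iff)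
          then have "\<bar>f ((of_int n + real i) / 2 ^ j) - f t\<bar> < h"
            using d(2)[of t "(of_int n + real i) / 2 ^ j"] 1 elim by (simp add: dist_real_def)
          then show "\<bar>(f ((of_int n + real i) / 2 ^ j) - f t) * lagrange m i (x - of_int n)\<bar> \<le> h * B"
            unfolding abs_mult using i y by (intro mult_mono B(2)) auto
        qed
        finally show ?thesis by simp
      qed
      have "approx l m j f t - f t = (\<Sum>n\<in>?W. bump l (x - of_int n) * (interp m j f n (x - of_int n) - f t))"
        unfolding right_diff_distrib sum_subtractf ft[symmetric] by (simp only: approx_def x_def)
      also have "\<bar>\<dots>\<bar> \<le> (\<Sum>n\<in>?W. 1 * (real m * (h * B)))"
      proof (rule order_trans[OF sum_abs], rule sum_mono)
        fix n assume n: "n \<in> ?W"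
        show "\<bar>bump l (x - of_int n) * (interp m j f n (x - of_int n) - f t)\<bar> \<le> 1 * (real m * (h * B))"
          unfolding abs_mult by (rule mult_mono[OF abs_bump_le bd[OF n]]) auto
      qed
      also have "\<dots> = e / 2" using B m by (simp add: h_def)
      finally show "dist (approx l m j f t) (f t) < e" using e by (simp add: dist_real_def)
    qed
  qed
qed

lemma smooth_wavelet: "smooth l (wavelet l m r i)"
proof -
  have "smooth l (\<lambda>y. bump l y * (bump l (2 * y + (- of_int r)) * lagrange m i (2 * y + (- of_int r))))"
    by (rule smooth_mult[OF smooth_bump smooth_mult[OF smooth_affine[OF smooth_bump] smooth_affine[OF smooth_lagrange]]])
  then show ?thesis by (simp add: wavelet_def[abs_def])
qed

text \<open>Supports of neighbouring bumps overlap, while those of equal parity only touch.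
  Pseudo-additivity is therefore applied to even and odd positions separately.\<close>

lemma sum_split_parity:
  "(\<Sum>n\<le>2 * M + 1. h n) = (\<Sum>i\<le>M. h (2 * i)) + (\<Sum>i\<le>M. h (2 * i + 1))" for h :: "nat \<Rightarrow> real"
  by (induction M) (auto simp: numeral_eq_Suc)

section \<open>Lower semi-norms of wavelet sums\<close>

lemma closed_intervals_Icc [simp]: "a \<le> b \<Longrightarrow> {a..b} \<in> closed_intervals"
  by (auto simp: closed_intervals_def)

lemma inverse_ereal_nonneg: "0 < p \<Longrightarrow> 0 \<le> real_of_ereal (1 / p)"
  by (cases p) (auto simp: one_ereal_def)

context seminorm_family
begin

lemma F_zero: "(\<lambda>x. 0) \<in> F" and F_add: "f \<in> F \<Longrightarrow> g \<in> F \<Longrightarrow> (\<lambda>x. f x + g x) \<in> F"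
  and F_scale: "f \<in> F \<Longrightarrow> (\<lambda>x. c * f x) \<in> F"
  using space_F by (auto simp: function_space_def restrict_UNIV)

lemma N_restrict_scale:
  assumes "I \<in> closed_intervals" "f \<in> F"
  shows "N I (restrict (\<lambda>x. c * f x) I) = \<bar>c\<bar> * N I (restrict f I)"
proof -
  have "(\<lambda>x\<in>I. c * f x) = (\<lambda>x\<in>I. c * restrict f I x)" by auto
  then show ?thesis using homogeneous[OF assms(1) restrict_mem[OF assms]] by simp
qed

lemma N_restrict_zero: "I \<in> closed_intervals \<Longrightarrow> N I (restrict (\<lambda>x. 0) I) = 0"
  using N_restrict_scale[OF _ F_zero, of I 0] by simp

lemma N_restrict_add:
  assumes "I \<in> closed_intervals" "f \<in> F" "g \<in> F"
  shows "N I (restrict (\<lambda>x. f x + g x) I) \<le> N I (restrict f I) + N I (restrict g I)"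
proof -
  have "(\<lambda>x\<in>I. f x + g x) = (\<lambda>x\<in>I. restrict f I x + restrict g I x)" by auto
  then show ?thesis
    using triangle[OF assms(1) restrict_mem[OF assms(1,2)] restrict_mem[OF assms(1,3)]] by simp
qed

lemma N_restrict_sum:
  assumes I: "I \<in> closed_intervals" and "finite A" "\<And>a. a \<in> A \<Longrightarrow> g a \<in> F"
  shows "(\<lambda>x. \<Sum>a\<in>A. g a x) \<in> F \<and>
    N I (restrict (\<lambda>x. \<Sum>a\<in>A. g a x) I) \<le> (\<Sum>a\<in>A. N I (restrict (g a) I))"
  using assms(2,3)
proof (induction A)
  case empty
  then show ?case unfolding sum.empty N_restrict_zero[OF I] using F_zero by simp
next
  case (insert a A)
  have ga: "g a \<in> F" using insert by auto
  have IH: "(\<lambda>x. \<Sum>a\<in>A. g a x) \<in> F"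
    "N I (restrict (\<lambda>x. \<Sum>a\<in>A. g a x) I) \<le> (\<Sum>a\<in>A. N I (restrict (g a) I))"
    using insert.IH insert.prems by blast+
  have eq: "(\<lambda>x. \<Sum>a\<in>insert a A. g a x) = (\<lambda>x. g a x + (\<Sum>a\<in>A. g a x))"
    using insert.hyps by simp
  show ?case
    unfolding eq using F_add[OF ga IH(1)] N_restrict_add[OF I ga IH(1)] IH(2)
    sum.insert[OF insert.hyps, of "\<lambda>a. N I (restrict (g a) I)"] by linarith
qed

end

context lower_seminorm
begin

text \<open>Translation by \<open>y / c\<close> centres the interval at 0, where scaling applies.
  The exponent \<beta> enters the estimates here.\<close>

lemma N_rescaled:
  assumes f: "f \<in> F" "(\<lambda>x. f (c * x)) \<in> F" and c: "0 < c"
  shows "N {(y - 1) / c..(y + 1) / c} (\<lambda>t\<in>{(y - 1) / c..(y + 1) / c}. f (c * t - y))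
    = c powr \<beta> * N {-1..1} (restrict f {-1..1})"
proof -
  let ?I = "{(y - 1) / c..(y + 1) / c}" and ?J = "{- (1 / c)..1 / c}"
  have I: "?I \<in> closed_intervals" using c by (simp add: divide_right_mono)
  have IJ: "(\<lambda>x. x - y / c) ` ?I = ?J"
  proof -
    have "(\<lambda>x. x - y / c) ` ?I = {(y - 1) / c - y / c..(y + 1) / c - y / c}"
      using image_add_atLeastAtMost[of "- (y / c)" "(y - 1) / c" "(y + 1) / c"] by simp
    then show ?thesis by (simp add: diff_divide_distrib add_divide_distrib)
  qed
  have J: "(\<lambda>x. x / c) ` {-1..1} = ?J" using c by (simp add: image_divide_atLeastAtMost)
  have "N ?I (\<lambda>t\<in>?I. f (c * t - y)) = N ?I (\<lambda>t\<in>?I. f (c * (t - y / c)))"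
    using c by (simp add: right_diff_distrib)
  also have "\<dots> = N ?J (restrict (\<lambda>x. f (c * x)) ?J)"
    using translation[OF f(2) I, of "y / c"] by (simp only: IJ)
  also have "\<dots> = c powr \<beta> * N {-1..1} (restrict f {-1..1})"
    using scaling[OF f(1) _ c, of "{-1..1}"] by (simp add: J)
  finally show ?thesis .
qed

text \<open>Names the witnesses of the axiom, because the order \<open>l\<close> determines the
  bumps and has to be the same for all levels.\<close>

definition pseudo_additive_bound :: "nat \<Rightarrow> real \<Rightarrow> bool" where
  "pseudo_additive_bound l C \<longleftrightarrow> CK l \<subseteq> F \<and> 0 < C \<and> (\<forall>n\<ge>1. \<forall>a :: nat \<Rightarrow> real. \<forall>f\<in>CK l.
      (\<forall>i<n. a i < a (Suc i)) \<longrightarrow> (\<forall>i\<le>n. f (a i) = 0) \<longrightarrow>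
      N {a 0..a n} (restrict f {a 0..a n}) \<le>
        C * (if p = \<infinity>
             then (SUP i\<in>{1..n}. N {a (i - 1)..a i} (restrict f {a (i - 1)..a i}))
             else (\<Sum>i=1..n. N {a (i - 1)..a i} (restrict f {a (i - 1)..a i})
                     powr real_of_ereal p) powr (1 / real_of_ereal p)))"

lemma pseudo_additive_bound_exists: "\<exists>l C. pseudo_additive_bound l C"
  using pseudo_additive unfolding pseudo_additive_bound_def by blast

text \<open>Among \<open>n\<close> pieces of size at most \<open>y\<close>, the sum of p-th powers
  costs a factor \<open>n\<close> to the power 1/p. For \<open>p = \<infinity>\<close> the exponent
  \<open>real_of_ereal (1 / p)\<close> is 0, so the supremum is covered by the same formula.\<close>

lemma pseudo_additive_uniform:
  assumes bd: "pseudo_additive_bound l C" and n: "1 \<le> n" and f: "f \<in> CK l"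
    and a: "\<And>i. i < n \<Longrightarrow> a i < a (Suc i)" "\<And>i. i \<le> n \<Longrightarrow> f (a i) = 0"
    and y: "\<And>i. i < n \<Longrightarrow> N {a i..a (Suc i)} (restrict f {a i..a (Suc i)}) \<le> y" "0 \<le> y"
  shows "N {a 0..a n} (restrict f {a 0..a n}) \<le> C * (real n powr real_of_ereal (1 / p) * y)"
proof -
  let ?x = "\<lambda>i. N {a (i - 1)..a i} (restrict f {a (i - 1)..a i})"
  have C: "0 < C" and fF: "f \<in> F" using bd f by (auto simp: pseudo_additive_bound_def)
  have x: "0 \<le> ?x i" "?x i \<le> y" if "i \<in> {1..n}" for i
  proof -
    from that have "i = Suc (i - 1)" "i - 1 < n" by auto
    then obtain k where k: "i = Suc k" "k < n" by blast
    show "?x i \<le> y" using y(1)[OF k(2)] k by simp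
    have "{a k..a (Suc k)} \<in> closed_intervals" using a(1)[OF k(2)] by simp
    from nonneg[OF this restrict_mem[OF this fF]] show "0 \<le> ?x i" using k by simp
  qed
  have "N {a 0..a n} (restrict f {a 0..a n}) \<le>
        C * (if p = \<infinity> then (SUP i\<in>{1..n}. ?x i)
             else (\<Sum>i=1..n. ?x i powr real_of_ereal p) powr (1 / real_of_ereal p))"
    using bd n f a unfolding pseudo_additive_bound_def by blast
  also have "\<dots> \<le> C * (real n powr real_of_ereal (1 / p) * y)"
  proof (rule mult_left_mono)
    show "(if p = \<infinity> then (SUP i\<in>{1..n}. ?x i)
             else (\<Sum>i=1..n. ?x i powr real_of_ereal p) powr (1 / real_of_ereal p))
          \<le> real n powr real_of_ereal (1 / p) * y"
    proof (cases "p = \<infinity>")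
      case True
      have "(SUP i\<in>{1..n}. ?x i) \<le> y" using n x by (intro cSUP_least) auto
      then show ?thesis using True n by simp
    next
      case False
      with p_pos obtain q where q: "p = ereal q" "0 < q" by (cases p) auto
      have "(\<Sum>i=1..n. ?x i powr q) \<le> (\<Sum>i=1..n. y powr q)"
        using x q by (intro sum_mono powr_mono2) auto
      also have "\<dots> = real n * y powr q" by simp
      finally have "(\<Sum>i=1..n. ?x i powr q) powr (1 / q) \<le> (real n * y powr q) powr (1 / q)"
        using q by (intro powr_mono2 sum_nonneg) auto
      also have "\<dots> = real n powr (1 / q) * y"
        using y(2) q by (simp add: powr_mult powr_powr)
      finally have *: "(\<Sum>i=1..n. ?x i powr q) powr (1 / q) \<le> real n powr (1 / q) * y" .
      have P: "real_of_ereal (1 / p) = 1 / q"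
        unfolding q(1) one_ereal_def using q(2) by simp
      show ?thesis unfolding P using * q by simp
    qed
  qed (use C in simp)
  finally show ?thesis .
qed

lemma smooth_supp_CK:
  assumes "smooth l f" "\<And>y. 1 \<le> \<bar>y\<bar> \<Longrightarrow> f y = 0"
  shows "f \<in> CK l" "0 < c \<Longrightarrow> (\<lambda>x. f (c * x - y)) \<in> CK l"
proof -
  show "f \<in> CK l" using assms by (intro smooth_imp_CK[of _ _ 1]) auto
  assume c: "0 < c"
  show "(\<lambda>x. f (c * x - y)) \<in> CK l"
  proof (rule smooth_imp_CK)
    show "smooth l (\<lambda>x. f (c * x - y))"
      using smooth_affine[OF assms(1), of c "- y"] by simp
    fix x assume "(\<bar>y\<bar> + 1) / c < \<bar>x\<bar>"
    then have "\<bar>y\<bar> + 1 < \<bar>c * x\<bar>" using c by (simp add: abs_mult divide_less_eq mult.commute)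
    then show "f (c * x - y) = 0" by (intro assms(2)) linarith
  qed
qed

text \<open>Bumps centred at \<open>2 * i + b\<close> have supports that only touch, and the
  touching points serve as the zeros \<open>a i\<close>. On each piece a single bump survives, whose
  semi-norm is given by \<open>N_rescaled\<close>.\<close>

lemma level_bound_separated:
  assumes bd: "pseudo_additive_bound l C" and f: "smooth l f" "\<And>y. 1 \<le> \<bar>y\<bar> \<Longrightarrow> f y = 0"
    and d: "\<And>i. i \<le> M \<Longrightarrow> \<bar>d i\<bar> \<le> e" and M: "M = 2 ^ j" and b: "0 \<le> b" "b \<le> 1" and e: "0 \<le> e"
  shows "(\<lambda>t. \<Sum>i\<le>M. d i * f (2 ^ j * t - (2 * real i + b))) \<in> F" (is "?g \<in> F")
    and "N {0..1} (restrict (\<lambda>t. \<Sum>i\<le>M. d i * f (2 ^ j * t - (2 * real i + b))) {0..1})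
      \<le> C * (real (Suc M) powr real_of_ereal (1 / p) * (e * (2 powr (real j * \<beta>) * N {-1..1} (restrict f {-1..1}))))"
proof -
  define a where "a i = (2 * real i + b - 1) / 2 ^ j" for i
  have CKF: "CK l \<subseteq> F" using bd by (simp add: pseudo_additive_bound_def)
  have fF: "f \<in> F" "(\<lambda>x. f (c * x)) \<in> F" if "0 < c" for c
    using smooth_supp_CK[OF f] smooth_supp_CK(2)[OF f that, of 0] CKF by auto
  have fF': "(\<lambda>t. f (2 ^ j * t - y)) \<in> F" for y
    using smooth_supp_CK(2)[OF f, of "2 ^ j" y] CKF by auto
  have gsm: "smooth l ?g"
  proof (rule smooth_sum)
    fix i
    have "smooth l (\<lambda>t. f (2 ^ j * t + - (2 * real i + b)))"
      by (rule smooth_affine[OF f(1)])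
    from smooth_mult[OF smooth_const[of l "d i"] this]
    show "smooth l (\<lambda>t. d i * f (2 ^ j * t - (2 * real i + b)))"
      by (simp only: diff_conv_add_uminus)
  qed
  have g0: "?g (a i) = 0" for i
  proof (rule sum.neutral, rule ballI)
    fix k
    \<comment> \<open>An odd integer, so of absolute value at least 1, where \<open>f\<close>
      vanishes.\<close>
    have "2 ^ j * a i - (2 * real k + b) = of_int (2 * (int i - int k) - 1)" by (simp add: a_def)
    moreover have "1 \<le> \<bar>2 * (int i - int k) - 1\<bar>" by presburger
    then have "1 \<le> \<bar>real_of_int (2 * (int i - int k) - 1)\<bar>" by (simp only: of_int_abs[symmetric] of_int_1_le_iff)
    ultimately show "d k * f (2 ^ j * a i - (2 * real k + b)) = 0" using f(2) by simp
  qed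
  have gCK: "?g \<in> CK l"
  proof (rule smooth_imp_CK[OF gsm])
    fix t :: real assume t: "2 * real M + 2 < \<bar>t\<bar>"
    show "?g t = 0"
    proof (rule sum.neutral, rule ballI)
      fix k assume "k \<in> {..M}"
      then have k: "k \<le> M" by simp
      have "\<bar>t\<bar> \<le> \<bar>2 ^ j * t\<bar>" by (simp add: abs_mult mult_le_cancel_right1)
      with t k b have "1 \<le> \<bar>2 ^ j * t - (2 * real k + b)\<bar>" by linarith
      then show "d k * f (2 ^ j * t - (2 * real k + b)) = 0" using f(2) by simp
    qed
  qed
  then show gF: "?g \<in> F" using CKF by auto
  let ?y = "e * (2 powr (real j * \<beta>) * N {-1..1} (restrict f {-1..1}))"
  have Nf: "0 \<le> N {-1..1} (restrict f {-1..1})" using fF(1)[of 1] by (intro nonneg restrict_mem) auto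
  have piece: "N {a i..a (Suc i)} (restrict ?g {a i..a (Suc i)}) \<le> ?y" if i: "i < Suc M" for i
  proof -
    let ?I = "{a i..a (Suc i)}"
    have aa: "a i = ((2 * real i + b) - 1) / 2 ^ j" "a (Suc i) = ((2 * real i + b) + 1) / 2 ^ j"
      by (simp_all add: a_def)
    have I: "?I \<in> closed_intervals" unfolding aa by (simp add: divide_right_mono)
    have "restrict ?g ?I = restrict (\<lambda>t. d i * f (2 ^ j * t - (2 * real i + b))) ?I"
    proof (rule restrict_ext)
      fix t assume t: "t \<in> ?I"
      then have x: "2 * real i + b - 1 \<le> 2 ^ j * t" "2 ^ j * t \<le> 2 * real i + b + 1"
        unfolding aa by (auto simp: field_simps)
      have "?g t = (\<Sum>k\<in>{i}. d k * f (2 ^ j * t - (2 * real k + b)))"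
      proof (rule sum.mono_neutral_right)
        show "\<forall>k\<in>{..M} - {i}. d k * f (2 ^ j * t - (2 * real k + b)) = 0"
        proof
          fix k assume "k \<in> {..M} - {i}"
          then have "k \<noteq> i" by simp
          then have "real k + 1 \<le> real i \<or> real i + 1 \<le> real k" by linarith
          then have "1 \<le> \<bar>2 ^ j * t - (2 * real k + b)\<bar>" using x by linarith
          then show "d k * f (2 ^ j * t - (2 * real k + b)) = 0" using f(2) by simp
        qed
      qed (use i in auto)
      then show "?g t = d i * f (2 ^ j * t - (2 * real i + b))" by simp
    qed
    then have "N ?I (restrict ?g ?I) = \<bar>d i\<bar> * N ?I (restrict (\<lambda>t. f (2 ^ j * t - (2 * real i + b))) ?I)"
      using N_restrict_scale[OF I fF'] by simp
    also have "N ?I (restrict (\<lambda>t. f (2 ^ j * t - (2 * real i + b))) ?I)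
        = (2 ^ j) powr \<beta> * N {-1..1} (restrict f {-1..1})"
      unfolding aa by (rule N_rescaled[OF fF(1)[of 1] fF(2)]) auto
    also have "(2 ^ j) powr \<beta> = 2 powr (real j * \<beta>)" by (simp add: powr_powr flip: powr_realpow)
    also have "\<bar>d i\<bar> * (2 powr (real j * \<beta>) * N {-1..1} (restrict f {-1..1})) \<le> ?y"
      using d[of i] i Nf by (intro mult_right_mono) auto
    finally show ?thesis .
  qed
  have "N {a 0..a (Suc M)} (restrict ?g {a 0..a (Suc M)})
    \<le> C * (real (Suc M) powr real_of_ereal (1 / p) * ?y)"
  proof (rule pseudo_additive_uniform[OF bd _ gCK])
    show "a i < a (Suc i)" for i by (simp add: a_def divide_strict_right_mono)
  qed (use g0 piece e Nf in auto)
  moreover have "N {0..1} (restrict ?g {0..1}) \<le> N {a 0..a (Suc M)} (restrict ?g {a 0..a (Suc M)})"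
  proof (rule monotone[OF _ _ _ gF])
    \<comment> \<open>With \<open>M = 2 ^ j\<close> the pieces overshoot the unit interval for
      either parity, and monotonicity in the interval cuts them back.\<close>
    have "a 0 \<le> 0" "1 \<le> a (Suc M)" using b by (auto simp: a_def divide_le_eq M field_simps)
    then show "{a 0..a (Suc M)} \<in> closed_intervals" "{0..1} \<subseteq> {a 0..a (Suc M)}" by auto
  qed simp
  ultimately show "N {0..1} (restrict ?g {0..1}) \<le> C * (real (Suc M) powr real_of_ereal (1 / p) * ?y)"
    by linarith
qed

text \<open>A level consists of two separated families of \<open>2 ^ j + 1\<close> bumps. Each bump
  contributes \<open>2 powr (j * \<beta>)\<close> by scaling, and their number contributes
  \<open>2 powr (j / p)\<close> up to a constant; together this is the exponent \<beta> +
  1/p.\<close>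

lemma level_bound:
  assumes bd: "pseudo_additive_bound l C" and f: "smooth l f" "\<And>y. 1 \<le> \<bar>y\<bar> \<Longrightarrow> f y = 0"
  shows "\<exists>K\<ge>0. \<forall>j d e. (\<forall>n\<le>2 ^ j. \<bar>d n\<bar> \<le> e) \<longrightarrow>
     dyadic_sum f j d \<in> F \<and>
     N {0..1} (restrict (dyadic_sum f j d) {0..1})
       \<le> K * (2 powr (real j * (\<beta> + real_of_ereal (1 / p))) * e)"
proof -
  let ?P = "real_of_ereal (1 / p)" and ?Nf = "N {-1..1} (restrict f {-1..1})"
  have C: "0 < C" and CKF: "CK l \<subseteq> F" using bd by (auto simp: pseudo_additive_bound_def)
  have Nf: "0 \<le> ?Nf" using smooth_supp_CK(1)[OF f] CKF by (intro nonneg restrict_mem) auto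
  have "dyadic_sum f j d \<in> F \<and>
     N {0..1} (restrict (dyadic_sum f j d) {0..1})
       \<le> (2 * C * 2 powr ?P * ?Nf) * (2 powr (real j * (\<beta> + ?P)) * e)"
    if d: "\<forall>n\<le>2 ^ j. \<bar>d n\<bar> \<le> e" for j d e
  proof -
    have e: "0 \<le> e" using d[rule_format, of 0] by simp
    define M :: nat where "M = 2 ^ j"
    \<comment> \<open>Padding by zero up to the index \<open>2 * M + 1\<close> gives both parities
      the same number \<open>M + 1\<close> of members.\<close>
    define c where "c n = (if n \<le> M then d n else 0)" for n
    have c: "\<bar>c n\<bar> \<le> e" for n using d e by (auto simp: c_def M_def)
    let ?g = "\<lambda>b t. \<Sum>i\<le>M. c (2 * i + b) * f (2 ^ j * t - (2 * real i + real b))"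
    have eq: "dyadic_sum f j d = (\<lambda>t. ?g 0 t + ?g 1 t)"
    proof
      fix t
      have "(\<Sum>n\<le>2 ^ j. d n * f (2 ^ j * t - real n)) = (\<Sum>n\<le>M. c n * f (2 ^ j * t - real n))"
        by (simp add: M_def c_def)
      also have "\<dots> = (\<Sum>n\<le>2 * M + 1. c n * f (2 ^ j * t - real n))"
        by (rule sum.mono_neutral_left) (auto simp: c_def)
      also have "\<dots> = ?g 0 t + ?g 1 t" unfolding sum_split_parity by (simp add: add.commute)
      finally show "dyadic_sum f j d t = ?g 0 t + ?g 1 t" by (simp only: dyadic_sum_def)
    qed
    have sep: "?g b \<in> F" "N {0..1} (restrict (?g b) {0..1})
      \<le> C * (real (Suc M) powr ?P * (e * (2 powr (real j * \<beta>) * ?Nf)))" if "b \<le> 1" for b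
      using level_bound_separated[OF bd f, of M "\<lambda>i. c (2 * i + b)" e j "real b"] c that e
      by (auto simp: M_def)
    have Suc_M: "real (Suc M) powr ?P \<le> 2 powr ?P * 2 powr (real j * ?P)"
    proof -
      have "real (Suc M) powr ?P \<le> (2 * 2 ^ j) powr ?P"
        using p_pos by (intro powr_mono2 inverse_ereal_nonneg) (auto simp: M_def)
      also have "\<dots> = 2 powr ?P * 2 powr (real j * ?P)"
        by (simp add: powr_mult powr_powr flip: powr_realpow)
      finally show ?thesis .
    qed
    have "N {0..1} (restrict (\<lambda>t. ?g 0 t + ?g 1 t) {0..1})
      \<le> N {0..1} (restrict (?g 0) {0..1}) + N {0..1} (restrict (?g 1) {0..1})"
      by (rule N_restrict_add[OF _ sep(1) sep(1)]) auto
    also have "\<dots> \<le> 2 * (C * (real (Suc M) powr ?P * (e * (2 powr (real j * \<beta>) * ?Nf))))"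
      using sep(2)[of 0] sep(2)[of 1] by simp
    also have "\<dots> \<le> 2 * (C * ((2 powr ?P * 2 powr (real j * ?P)) * (e * (2 powr (real j * \<beta>) * ?Nf))))"
      using Suc_M C e Nf by (intro mult_left_mono mult_right_mono) auto
    also have "\<dots> = (2 * C * 2 powr ?P * ?Nf) * (2 powr (real j * (\<beta> + ?P)) * e)"
      by (simp add: distrib_left powr_add mult_ac)
    finally show ?thesis unfolding eq using F_add[OF sep(1)[of 0] sep(1)[of 1]] by simp
  qed
  then show ?thesis using C Nf by (intro exI[of _ "2 * C * 2 powr ?P * ?Nf"]) auto
qed

lemma bump_wavelet_supp:
  "1 \<le> \<bar>y\<bar> \<Longrightarrow> wavelet l m r i y = 0" "1 \<le> \<bar>y\<bar> \<Longrightarrow> bump l y * lagrange m i y = 0"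
  by (auto simp: wavelet_def bump_eq_0)

text \<open>The triangle inequality bounds the semi-norms of the partial sums uniformly in the
  number of levels. They converge uniformly to \<open>f\<close> on the unit interval, and lower
  semi-continuity carries the bound over.\<close>

theorem seminorm_le_wavelet_coeffs:
  assumes m: "0 < m"
  shows "\<exists>K\<ge>0. \<forall>f b e S. continuous_on UNIV f \<longrightarrow> restrict f {0..1} \<in> FI {0..1} \<longrightarrow>
    coefficients_le m f b e \<longrightarrow>
    (\<forall>L. (\<Sum>j<L. 2 powr (real j * (\<beta> + real_of_ereal (1 / p))) * e j) \<le> S) \<longrightarrow>
    N {0..1} (restrict f {0..1}) \<le> K * (b + S)"
proof -
  let ?\<theta> = "\<beta> + real_of_ereal (1 / p)" and ?I = "{0..1::real}"
  let ?N = "\<lambda>g. N ?I (restrict g ?I)"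
  have I: "?I \<in> closed_intervals" by simp
  obtain l C where bd: "pseudo_additive_bound l C" using pseudo_additive_bound_exists by auto
  \<comment> \<open>Only \<open>m\<close> functions occur at level 0 and \<open>5 * m\<close>
    wavelets above it, so a constant \<open>K\<close> can be chosen for each of them and the
    constants added.\<close>
  define P where "P g K \<longleftrightarrow> 0 \<le> K \<and> (\<forall>j d e. (\<forall>n\<le>2 ^ j. \<bar>d n\<bar> \<le> e) \<longrightarrow>
     dyadic_sum g j d \<in> F \<and> ?N (dyadic_sum g j d) \<le> K * (2 powr (real j * ?\<theta>) * e))" for g K
  have P: "P g (SOME K. P g K)" if "smooth l g" "\<And>y. 1 \<le> \<bar>y\<bar> \<Longrightarrow> g y = 0" for g
  proof -
    have "\<exists>K. P g K" using level_bound[OF bd that] unfolding P_def by auto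
    then show ?thesis by (rule someI_ex)
  qed
  let ?\<psi> = "\<lambda>i y. bump l y * lagrange m i y"
  define K1 where "K1 r i = (SOME K. P (wavelet l m r i) K)" for r i
  define K0 where "K0 i = (SOME K. P (?\<psi> i) K)" for i
  have "P (wavelet l m r i) (K1 r i)" for r i
    unfolding K1_def by (rule P[OF smooth_wavelet bump_wavelet_supp(1)])
  then have K1: "K1 r i \<ge> 0" "(\<forall>n\<le>2 ^ j. \<bar>d n\<bar> \<le> e) \<Longrightarrow> dyadic_sum (wavelet l m r i) j d \<in> F \<and>
     ?N (dyadic_sum (wavelet l m r i) j d) \<le> K1 r i * (2 powr (real j * ?\<theta>) * e)" for r i j d e
    unfolding P_def by blast+
  have "P (?\<psi> i) (K0 i)" for i
    unfolding K0_def by (rule P[OF smooth_mult[OF smooth_bump smooth_lagrange] bump_wavelet_supp(2)])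
  then have K0: "K0 i \<ge> 0" "(\<forall>n\<le>2 ^ j. \<bar>d n\<bar> \<le> e) \<Longrightarrow> dyadic_sum (?\<psi> i) j d \<in> F \<and>
     ?N (dyadic_sum (?\<psi> i) j d) \<le> K0 i * (2 powr (real j * ?\<theta>) * e)" for i j d e
    unfolding P_def by blast+
  define KK0 where "KK0 = (\<Sum>i<m. K0 i)"
  define KK1 where "KK1 = (\<Sum>r\<in>{-2..2}. \<Sum>i<m. K1 r i)"
  have KK: "0 \<le> KK0" "0 \<le> KK1" using K0(1) K1(1) by (auto simp: KK0_def KK1_def intro!: sum_nonneg)
  have "?N f \<le> (KK0 + KK1) * (b + S)"
    if f: "continuous_on UNIV f" "restrict f ?I \<in> FI ?I"
      and be: "coefficients_le m f b e"
      and S: "\<forall>L. (\<Sum>j<L. 2 powr (real j * ?\<theta>) * e j) \<le> S" for f b e S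
  proof -
    have b: "\<forall>q\<le>m. \<bar>f (real q)\<bar> \<le> b" using be by (simp add: coefficients_le_def)
    have b_pos: "0 \<le> b" using b[rule_format, of 0] by auto
    have S0: "0 \<le> S" using S[rule_format, of 0] by simp
    let ?h0 = "\<lambda>i. dyadic_sum (?\<psi> i) 0 (\<lambda>n. f (real (n + i)))"
    let ?h1 = "\<lambda>j r i. dyadic_sum (wavelet l m r i) j (\<lambda>n. interp_error m j f (int n) (node r i))"
    define g0 where "g0 t = (\<Sum>i<m. ?h0 i t)" for t
    define g where "g j t = (\<Sum>r\<in>{-2..2}. \<Sum>i<m. ?h1 j r i t)" for j t
    have g0F: "g0 \<in> F \<and> ?N g0 \<le> KK0 * b"
    proof -
      have *: "?h0 i \<in> F \<and> ?N (?h0 i) \<le> K0 i * (2 powr (real 0 * ?\<theta>) * b)" if "i \<in> {..<m}" for i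
      proof (rule K0(2), intro allI impI)
        fix n :: nat assume "n \<le> 2 ^ 0"
        with that have "n + i \<le> m" by simp
        then show "\<bar>f (real (n + i))\<bar> \<le> b" by (rule b[rule_format])
      qed
      have "g0 \<in> F \<and> ?N g0 \<le> (\<Sum>i<m. ?N (?h0 i))"
        unfolding g0_def[abs_def] using * by (intro N_restrict_sum[OF I]) blast+
      moreover have "(\<Sum>i<m. ?N (?h0 i)) \<le> (\<Sum>i<m. K0 i * (2 powr (real 0 * ?\<theta>) * b))"
        using * by (intro sum_mono) blast
      moreover have "(\<Sum>i<m. K0 i * (2 powr (real 0 * ?\<theta>) * b)) = KK0 * b"
        by (simp add: KK0_def sum_distrib_right)
      ultimately show ?thesis by linarith
    qed
    have gF: "g j \<in> F \<and> ?N (g j) \<le> KK1 * (2 powr (real j * ?\<theta>) * e j)" for j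
    proof -
      have *: "?h1 j r i \<in> F \<and> ?N (?h1 j r i) \<le> K1 r i * (2 powr (real j * ?\<theta>) * e j)"
        if "r \<in> {-2..2}" "i \<in> {..<m}" for r i
        using be that unfolding coefficients_le_def by (intro K1(2)) auto
      have **: "(\<lambda>t. \<Sum>i<m. ?h1 j r i t) \<in> F \<and> ?N (\<lambda>t. \<Sum>i<m. ?h1 j r i t) \<le> (\<Sum>i<m. ?N (?h1 j r i))"
        if "r \<in> {-2..2}" for r
        using *[OF that] by (intro N_restrict_sum[OF I]) blast+
      have "g j \<in> F \<and> ?N (g j) \<le> (\<Sum>r\<in>{-2..2}. ?N (\<lambda>t. \<Sum>i<m. ?h1 j r i t))"
        unfolding g_def[abs_def] using ** by (intro N_restrict_sum[OF I]) blast+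
      moreover have "(\<Sum>r\<in>{-2..2}. ?N (\<lambda>t. \<Sum>i<m. ?h1 j r i t)) \<le> (\<Sum>r\<in>{-2..2}. \<Sum>i<m. ?N (?h1 j r i))"
        using ** by (intro sum_mono) blast
      moreover have "\<dots> \<le> (\<Sum>r\<in>{-2..2}. \<Sum>i<m. K1 r i * (2 powr (real j * ?\<theta>) * e j))"
        using * by (intro sum_mono) blast
      moreover have "\<dots> = KK1 * (2 powr (real j * ?\<theta>) * e j)"
        by (simp add: KK1_def sum_distrib_right)
      ultimately show ?thesis by linarith
    qed
    define h where "h J t = g0 t + (\<Sum>j<J. g j t)" for J t
    have h: "h J \<in> F \<and> ?N (h J) \<le> (KK0 + KK1) * (b + S)" for J
    proof -
      have 1: "(\<lambda>t. \<Sum>j<J. g j t) \<in> F \<and> ?N (\<lambda>t. \<Sum>j<J. g j t) \<le> (\<Sum>j<J. ?N (g j))"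
        using gF by (intro N_restrict_sum[OF I]) auto
      have "?N (h J) \<le> ?N g0 + ?N (\<lambda>t. \<Sum>j<J. g j t)"
        unfolding h_def[abs_def] using g0F 1 by (intro N_restrict_add[OF I]) auto
      also have "\<dots> \<le> KK0 * b + (\<Sum>j<J. KK1 * (2 powr (real j * ?\<theta>) * e j))"
        using g0F 1 gF by (intro add_mono order_trans[OF conjunct2[OF 1]] sum_mono) auto
      also have "\<dots> = KK0 * b + KK1 * (\<Sum>j<J. 2 powr (real j * ?\<theta>) * e j)"
        by (simp add: sum_distrib_left)
      also have "\<dots> \<le> KK0 * b + KK1 * S" using KK S by (intro add_left_mono mult_left_mono) auto
      also have "\<dots> \<le> (KK0 + KK1) * (b + S)"
        using KK b_pos S0 by (simp add: algebra_simps)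
      finally show ?thesis unfolding h_def[abs_def] using F_add[of g0] g0F 1 by simp
    qed
    have hap: "restrict (h J) ?I = restrict (approx l m J f) ?I" for J
    proof (rule restrict_ext)
      fix t assume t: "t \<in> ?I"
      have "approx l m J f t = g0 t + (\<Sum>j<J. g j t)"
      proof (induction J)
        case 0
        then show ?case using approx_0[of t l m f] t by (simp add: g0_def)
      next
        case (Suc J)
        then show ?case using approx_diff[of t l m J f] t by (simp add: g_def)
      qed
      then show "h J t = approx l m J f t" by (simp add: h_def)
    qed
    have "uniform_limit ?I (\<lambda>J. restrict (h J) ?I) (restrict f ?I) sequentially"
      using approx_uniform_limit[OF f(1) m, of l] unfolding hap
      by (rule uniform_limit_cong'[THEN iffD1, rotated -1]) auto
    then have "ereal (?N f) \<le> limsup (\<lambda>J. ereal (?N (h J)))"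
      by (rule lower_semicontinuous[OF I f(2) restrict_mem[OF I conjunct1[OF h]]])
    also have "\<dots> \<le> ereal ((KK0 + KK1) * (b + S))"
      using h by (intro Limsup_bounded always_eventually) auto
    finally show ?thesis by simp
  qed
  then show ?thesis using KK by (intro exI[of _ "KK0 + KK1"]) auto
qed

end

section \<open>Moments, codes and collisions\<close>

text \<open>\<mu> is symmetric stable with scale parameter \<open>A\<close>. Stating the bound with
  some positive \<open>B \<ge> A\<close> includes the point mass at 0, where
  \<open>A = 0\<close>.\<close>

definition moment_const :: "real \<Rightarrow> real \<Rightarrow> real \<Rightarrow> bool" where
  "moment_const \<alpha> s C \<longleftrightarrow> 0 \<le> C \<and> (\<forall>\<mu> A B. real_distribution \<mu> \<longrightarrow> 0 \<le> A \<longrightarrow> A \<le> B \<longrightarrow> 0 < B \<longrightarrow>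
     (\<forall>x. char \<mu> x = of_real (exp (- A * \<bar>x\<bar> powr \<alpha>))) \<longrightarrow>
     (\<integral>\<^sup>+x. ennreal (\<bar>x\<bar> powr s) \<partial>\<mu>) \<le> ennreal (C * B powr (s / \<alpha>)))"

lemma dyadic_scale:
  assumes "1 \<le> (y::real)"
  obtains k :: nat where "2 ^ k \<le> y" "y < 2 ^ Suc k"
proof -
  obtain n where n: "y < 2 ^ n" using real_arch_pow[of 2 y] by auto
  define m where "m = (LEAST n. y < 2 ^ n)"
  have m: "y < 2 ^ m" unfolding m_def by (rule LeastI[of "\<lambda>n. y < 2 ^ n", OF n])
  with assms obtain k where k: "m = Suc k" by (cases m) auto
  then have "\<not> y < 2 ^ k" using not_less_Least[of k "\<lambda>n. y < 2 ^ n"] by (simp add: m_def)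
  with m k show ?thesis by (intro that[of k]) auto
qed

text \<open>If |x| is at least \<open>v\<close>, some \<open>k\<close> brings |x| / (2^k v) into [1,
  2), where 1 - cos is at least 1 - cos 1, so that a single term of the series dominates.
  Integrating this inequality expresses a moment through the characteristic function alone.\<close>

lemma cos_series_lower_bound:
  assumes v: "0 < v" and s: "0 < s"
  shows "ennreal (\<bar>x\<bar> powr s) \<le> ennreal (v powr s) +
    ennreal ((2 * v) powr s / (1 - cos 1)) * (\<Sum>k. ennreal (2 powr (s * real k) * (1 - cos (inverse (2 ^ k * v) * x))))"
    (is "_ \<le> _ + ennreal ?c * (\<Sum>k. ?f k)")
proof (cases "\<bar>x\<bar> < v")
  case True
  then have "ennreal (\<bar>x\<bar> powr s) \<le> ennreal (v powr s)"
    using s by (intro ennreal_leI powr_mono2) auto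
  then show ?thesis by (rule order_trans) simp
next
  case False
  have c1: "0 < 1 - cos (1::real)" using cos_monotone_0_pi[of 0 1] pi_gt3 by simp
  obtain k where k: "2 ^ k \<le> \<bar>x\<bar> / v" "\<bar>x\<bar> / v < 2 ^ Suc k"
    using dyadic_scale[of "\<bar>x\<bar> / v"] False v by (auto simp: field_simps)
  define y where "y = inverse (2 ^ k * v) * \<bar>x\<bar>"
  have "1 \<le> y" "y \<le> 2" using k v by (auto simp: y_def field_simps)
  then have "cos y \<le> cos 1" using pi_gt3 by (intro cos_monotone_0_pi_le) auto
  moreover have "cos (inverse (2 ^ k * v) * x) = cos y"
    using v by (cases "0 \<le> x") (auto simp: y_def)
  ultimately have 1: "1 - cos 1 \<le> 1 - cos (inverse (2 ^ k * v) * x)" by simp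
  have "\<bar>x\<bar> \<le> (2 * v) * 2 powr real k" using k(2) v by (simp add: powr_realpow field_simps)
  then have "\<bar>x\<bar> powr s \<le> ((2 * v) * 2 powr real k) powr s" using s by (intro powr_mono2) auto
  also have "\<dots> = (2 * v) powr s * 2 powr (s * real k)"
    using v by (simp add: powr_mult powr_powr mult.commute)
  also have "\<dots> = ?c * (2 powr (s * real k) * (1 - cos 1))" using c1 by simp
  also have "\<dots> \<le> ?c * (2 powr (s * real k) * (1 - cos (inverse (2 ^ k * v) * x)))"
    using 1 c1 by (intro mult_left_mono) auto
  finally have "ennreal (\<bar>x\<bar> powr s) \<le> ennreal (?c * (2 powr (s * real k) * (1 - cos (inverse (2 ^ k * v) * x))))"
    by (rule ennreal_leI)
  also have "\<dots> = ennreal ?c * ?f k" using c1 by (intro ennreal_mult) auto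
  finally have 2: "ennreal (\<bar>x\<bar> powr s) \<le> ennreal ?c * ?f k" .
  have "sum ?f {k} \<le> suminf ?f" by (rule sum_le_suminf) auto
  then have "?f k \<le> suminf ?f" by (simp only: sum.insert sum.empty finite.emptyI empty_iff not_False_eq_True add_0_right)
  then have "ennreal ?c * ?f k \<le> ennreal ?c * suminf ?f" by (rule mult_left_mono) simp
  also have "\<dots> \<le> ennreal (v powr s) + ennreal ?c * suminf ?f" by (rule add_increasing) auto
  finally show ?thesis by (rule order_trans[OF 2])
qed

text \<open>The mean of 1 - cos (u X) is 1 - exp (- A u^\<alpha>), at most B u^\<alpha>. The
  \<open>k\<close>-th term of the cosine series is then at most 2^((s - \<alpha>) k), a geometric
  sequence of ratio below 1 because s < \<alpha>.\<close>

lemma moment_const_subcritical: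
  assumes s: "0 < s" "s < \<alpha>"
  shows "\<exists>C. moment_const \<alpha> s C"
proof -
  define q where "q = (2::real) powr (s - \<alpha>)"
  have q: "0 \<le> q" "q < 1" using s by (auto simp: q_def powr_less_one)
  have c1: "0 < 1 - cos (1::real)" using cos_monotone_0_pi[of 0 1] pi_gt3 by simp
  define C where "C = 1 + 2 powr s / (1 - cos 1) * (1 / (1 - q))"
  have C: "0 \<le> C" using q c1 by (simp add: C_def)
  have "(\<integral>\<^sup>+x. ennreal (\<bar>x\<bar> powr s) \<partial>\<mu>) \<le> ennreal (C * B powr (s / \<alpha>))"
    if \<mu>: "real_distribution \<mu>" and AB: "0 \<le> A" "A \<le> B" "0 < B"
      and ch: "\<forall>x. char \<mu> x = of_real (exp (- A * \<bar>x\<bar> powr \<alpha>))" for \<mu> A B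
  proof -
    interpret real_distribution \<mu> by fact
    \<comment> \<open>This choice makes \<open>B * inverse (2 ^ k * v) powr \<alpha>\<close> equal
      to \<open>2 powr (- \<alpha> * k)\<close>, free of \<open>B\<close>.\<close>
    define v where "v = B powr (1 / \<alpha>)"
    have v: "0 < v" "v powr \<alpha> = B" using AB s by (auto simp: v_def powr_powr)
    have re: "(\<integral>x. cos (u * x) \<partial>\<mu>) = Re (char \<mu> u)" for u
      unfolding char_def by (subst integral_Re[symmetric]) (auto intro!: integrable_iexp simp: Re_exp)
    have cosint: "(\<integral>\<^sup>+x. ennreal (2 powr (s * real k) * (1 - cos (inverse (2 ^ k * v) * x))) \<partial>\<mu>)
        \<le> ennreal (q ^ k)" for k
    proof -
      let ?u = "inverse (2 ^ k * v)"
      have u: "0 < ?u" using v by simp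
      have int: "integrable \<mu> (\<lambda>x. cos (?u * x))"
        by (rule integrable_const_bound[where B = 1]) auto
      have "(\<integral>x. cos (?u * x) \<partial>\<mu>) = Re (char \<mu> ?u)"
        by (rule re)
      also have "\<dots> = exp (- A * ?u powr \<alpha>)" using ch u by simp
      finally have 1: "(\<integral>x. 1 - cos (?u * x) \<partial>\<mu>) = 1 - exp (- A * ?u powr \<alpha>)"
        using int prob_space by (subst Bochner_Integration.integral_diff) auto
      also have "\<dots> \<le> A * ?u powr \<alpha>" using exp_ge_add_one_self[of "- A * ?u powr \<alpha>"] by simp
      also have "\<dots> \<le> B * ?u powr \<alpha>" using AB by (intro mult_right_mono) auto
      also have "?u powr \<alpha> = 2 powr (- \<alpha> * real k) / B"
        using v by (simp add: powr_mult powr_powr inverse_eq_divide powr_divide powr_minus_divide mult.commute flip: powr_realpow)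
      finally have 2: "(\<integral>x. 1 - cos (?u * x) \<partial>\<mu>) \<le> 2 powr (- \<alpha> * real k)" using AB by simp
      have "(\<integral>\<^sup>+x. ennreal (2 powr (s * real k) * (1 - cos (?u * x))) \<partial>\<mu>)
        = ennreal (\<integral>x. 2 powr (s * real k) * (1 - cos (?u * x)) \<partial>\<mu>)"
        using int by (intro nn_integral_eq_integral) auto
      also have "(\<integral>x. 2 powr (s * real k) * (1 - cos (?u * x)) \<partial>\<mu>)
        = 2 powr (s * real k) * (\<integral>x. 1 - cos (?u * x) \<partial>\<mu>)" by simp
      also have "\<dots> \<le> 2 powr (s * real k) * 2 powr (- \<alpha> * real k)"
        using 2 by (intro mult_left_mono) auto
      also have "\<dots> = q ^ k"
        by (simp add: q_def powr_power algebra_simps flip: powr_add)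
      finally show ?thesis by (simp add: ennreal_leI)
    qed
    have "(\<integral>\<^sup>+x. ennreal (\<bar>x\<bar> powr s) \<partial>\<mu>) \<le> (\<integral>\<^sup>+x. ennreal (v powr s) +
      ennreal ((2 * v) powr s / (1 - cos 1)) * (\<Sum>k. ennreal (2 powr (s * real k) * (1 - cos (inverse (2 ^ k * v) * x)))) \<partial>\<mu>)"
      by (intro nn_integral_mono cos_series_lower_bound v s)
    also have "\<dots> = ennreal (v powr s) + ennreal ((2 * v) powr s / (1 - cos 1)) *
      (\<Sum>k. \<integral>\<^sup>+x. ennreal (2 powr (s * real k) * (1 - cos (inverse (2 ^ k * v) * x))) \<partial>\<mu>)"
      using emeasure_space_1 by (simp add: nn_integral_add nn_integral_cmult nn_integral_suminf)
    also have "\<dots> \<le> ennreal (v powr s) + ennreal ((2 * v) powr s / (1 - cos 1)) * (\<Sum>k. ennreal (q ^ k))"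
      by (intro add_left_mono mult_left_mono suminf_le cosint) auto
    also have "(\<Sum>k. ennreal (q ^ k)) = ennreal (1 / (1 - q))"
      using q by (subst suminf_ennreal2) (auto simp: suminf_geometric summable_geometric)
    also have "ennreal (v powr s) + ennreal ((2 * v) powr s / (1 - cos 1)) * ennreal (1 / (1 - q))
       = ennreal (C * v powr s)"
    proof -
      have "ennreal ((2 * v) powr s / (1 - cos 1)) * ennreal (1 / (1 - q))
        = ennreal ((2 * v) powr s / (1 - cos 1) * (1 / (1 - q)))"
        using q c1 by (intro ennreal_mult[symmetric]) auto
      moreover have "ennreal (v powr s) + ennreal ((2 * v) powr s / (1 - cos 1) * (1 / (1 - q)))
        = ennreal (v powr s + (2 * v) powr s / (1 - cos 1) * (1 / (1 - q)))"
        using q c1 by (intro ennreal_plus[symmetric]) auto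
      moreover have "v powr s + (2 * v) powr s / (1 - cos 1) * (1 / (1 - q)) = C * v powr s"
        using v by (simp add: C_def powr_mult distrib_right)
      ultimately show ?thesis by simp
    qed
    also have "v powr s = B powr (s / \<alpha>)" by (simp add: v_def powr_powr)
    finally show ?thesis .
  qed
  with C show ?thesis by (intro exI[of _ C]) (auto simp: moment_const_def)
qed

text \<open>At index 2 the law is normal of variance \<open>2 * A\<close>, so moments of arbitrarily
  high order are available.\<close>

lemma moment_const_gaussian:
  assumes k: "0 < k"
  shows "\<exists>C. moment_const 2 (real (2 * k)) C"
proof -
  interpret std: real_distribution std_normal_distribution by (rule real_dist_normal_dist)
  define m where "m = (\<integral>x. x ^ (2 * k) \<partial>std_normal_distribution)"
  have m0: "0 \<le> m" unfolding m_def by (intro integral_nonneg_AE) auto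
  define C where "C = 2 ^ k * m"
  have "(\<integral>\<^sup>+x. ennreal (\<bar>x\<bar> powr (real (2 * k))) \<partial>\<mu>) \<le> ennreal (C * B powr (real (2 * k) / 2))"
    if \<mu>: "real_distribution \<mu>" and AB: "0 \<le> A" "A \<le> B" "0 < B"
      and ch: "\<forall>x. char \<mu> x = of_real (exp (- A * \<bar>x\<bar> powr 2))" for \<mu> A B
  proof -
    define c where "c = sqrt (2 * A)"
    let ?\<nu> = "distr std_normal_distribution borel (\<lambda>x. c * x)"
    have "\<mu> = ?\<nu>"
    proof (rule Levy_uniqueness[OF \<mu>])
      show "real_distribution ?\<nu>" by (rule std.real_distribution_distr) auto
      have "char ?\<nu> t = char std_normal_distribution (c * t)" for t
        unfolding char_def by (subst integral_distr) (auto simp: mult_ac)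
      then show "char \<mu> = char ?\<nu>"
        using AB ch by (auto simp: char_std_normal_distribution c_def power_mult_distrib fun_eq_iff)
    qed
    then have "(\<integral>\<^sup>+x. ennreal (\<bar>x\<bar> powr (real (2 * k))) \<partial>\<mu>)
        = (\<integral>\<^sup>+x. ennreal (\<bar>c * x\<bar> powr (real (2 * k))) \<partial>std_normal_distribution)"
      by (simp add: nn_integral_distr)
    also have "\<dots> = (\<integral>\<^sup>+x. ennreal ((2 * A) ^ k * x ^ (2 * k)) \<partial>std_normal_distribution)"
    proof (intro nn_integral_cong arg_cong[of _ _ ennreal])
      fix x
      have "\<bar>c * x\<bar> powr (real (2 * k)) = \<bar>c * x\<bar> ^ (2 * k)"
        using k by (cases "c * x = 0") (auto simp del: of_nat_mult simp: powr_realpow)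
      also have "\<dots> = (2 * A) ^ k * x ^ (2 * k)"
        using AB by (simp add: power_mult c_def power_mult_distrib)
      finally show "\<bar>c * x\<bar> powr (real (2 * k)) = (2 * A) ^ k * x ^ (2 * k)" .
    qed
    also have "\<dots> = ennreal (\<integral>x. (2 * A) ^ k * x ^ (2 * k) \<partial>std_normal_distribution)"
      using AB std_normal_distribution_even_moments(2)[of k] by (intro nn_integral_eq_integral) auto
    also have "\<dots> = ennreal ((2 * A) ^ k * m)" by (simp add: m_def)
    also have "\<dots> \<le> ennreal (C * B ^ k)"
      using AB m0 by (intro ennreal_leI) (auto simp: C_def power_mult_distrib mult_ac intro!: mult_left_mono power_mono)
    also have "B ^ k = B powr (real (2 * k) / 2)" using AB by (simp add: powr_realpow)
    finally show ?thesis .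
  qed
  moreover have "0 \<le> C" using m0 by (simp add: C_def)
  ultimately show ?thesis by (intro exI[of _ C]) (auto simp: moment_const_def)
qed

text \<open>A sub-probability on the integers, so that \<open>- ln\<close> of it acts as a code
  length. The parameter \<eta> is the mass reserved for nonzero integers: a small \<eta> makes 0
  almost free and charges every other integer an additional \<open>ln (1 / \<eta>)\<close>.\<close>

definition code_weight :: "real \<Rightarrow> int \<Rightarrow> real" where
  "code_weight \<eta> n = (if n = 0 then 1 - \<eta> else \<eta> / (4 * (of_int n)\<^sup>2))"

lemma code_weight_pos: "0 < \<eta> \<Longrightarrow> \<eta> \<le> 1 / 2 \<Longrightarrow> 0 < code_weight \<eta> n"
  by (simp add: code_weight_def)

lemma code_weight_le_1: "0 < \<eta> \<Longrightarrow> \<eta> \<le> 1 / 2 \<Longrightarrow> code_weight \<eta> n \<le> 1"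
proof (cases "n = 0")
  case False
  assume \<eta>: "0 < \<eta>" "\<eta> \<le> 1 / 2"
  have "1 \<le> \<bar>n\<bar>" using False by simp
  then have "1 \<le> \<bar>real_of_int n\<bar>" by linarith
  then have "1 \<le> (real_of_int n)\<^sup>2" using one_le_power[of "\<bar>real_of_int n\<bar>" 2] by simp
  then show ?thesis using \<eta> False by (simp add: code_weight_def divide_le_eq)
qed (simp add: code_weight_def)

lemma sum_inverse_squares: "0 < n \<Longrightarrow> (\<Sum>i<n. 1 / (real (Suc i))\<^sup>2) \<le> 2 - 1 / real n"
proof (induction n rule: nat_induct_non_zero)
  case (Suc n)
  have "1 / (real (Suc n))\<^sup>2 \<le> 1 / (real n * real (Suc n))"
    using Suc.hyps by (intro divide_left_mono) (auto simp: power2_eq_square)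
  also have "\<dots> = 1 / real n - 1 / real (Suc n)" using Suc.hyps by (simp add: field_simps)
  finally show ?case using Suc.IH by simp
qed simp

text \<open>The inverse squares of the positive integers sum to at most 2, which together with the
  factor 1/4 leaves \<open>\<eta> / 2\<close> for each sign.\<close>

lemma sum_code_weight_le_1:
  assumes \<eta>: "0 < \<eta>" "\<eta> \<le> 1 / 2" and "finite A"
  shows "(\<Sum>n\<in>A. code_weight \<eta> n) \<le> 1"
proof -
  define m where "m = Suc (Max ((\<lambda>n. nat \<bar>n\<bar>) ` insert 0 A))"
  let ?P = "(\<lambda>i. int (Suc i)) ` {..<m}" and ?Q = "(\<lambda>i. - int (Suc i)) ` {..<m}"
  have sq: "(\<Sum>i<m. 1 / (real (Suc i))\<^sup>2) \<le> 2"
    by (rule order_trans[OF sum_inverse_squares]) (auto simp: m_def)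
  have sub: "A \<subseteq> insert 0 (?P \<union> ?Q)"
  proof
    fix n assume n: "n \<in> A"
    then have "nat \<bar>n\<bar> \<in> (\<lambda>n. nat \<bar>n\<bar>) ` insert 0 A" by blast
    then have "nat \<bar>n\<bar> \<le> Max ((\<lambda>n. nat \<bar>n\<bar>) ` insert 0 A)" using assms(3) by (intro Max_ge) auto
    then have "nat \<bar>n\<bar> < m" by (simp add: m_def)
    then show "n \<in> insert 0 (?P \<union> ?Q)"
    proof (cases n "0::int" rule: linorder_cases)
      case less
      then have "n = - int (Suc (nat \<bar>n\<bar> - 1))" "nat \<bar>n\<bar> - 1 < m" using \<open>nat \<bar>n\<bar> < m\<close> by auto
      then show ?thesis by blast
    next
      case greater
      then have "n = int (Suc (nat \<bar>n\<bar> - 1))" "nat \<bar>n\<bar> - 1 < m" using \<open>nat \<bar>n\<bar> < m\<close> by auto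
      then show ?thesis by blast
    qed simp
  qed
  have P: "(\<Sum>n\<in>?P. code_weight \<eta> n) \<le> \<eta> / 2"
  proof -
    have "(\<Sum>n\<in>?P. code_weight \<eta> n) = (\<Sum>i<m. \<eta> / 4 * (1 / (real (Suc i))\<^sup>2))"
      by (subst sum.reindex) (auto simp: code_weight_def inj_on_def intro!: sum.cong)
    also have "\<dots> = \<eta> / 4 * (\<Sum>i<m. 1 / (real (Suc i))\<^sup>2)" by (rule sum_distrib_left[symmetric])
    also have "\<dots> \<le> \<eta> / 4 * 2" using sq \<eta> by (intro mult_left_mono) auto
    finally show ?thesis by simp
  qed
  have Q: "(\<Sum>n\<in>?Q. code_weight \<eta> n) = (\<Sum>n\<in>?P. code_weight \<eta> n)"
    by (rule sum.reindex_bij_witness[of _ uminus uminus]) (auto simp: code_weight_def)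
  have "(\<Sum>n\<in>A. code_weight \<eta> n) \<le> (\<Sum>n\<in>insert 0 (?P \<union> ?Q). code_weight \<eta> n)"
    using sub \<eta> by (intro sum_mono2) (auto intro: less_imp_le[OF code_weight_pos])
  also have "\<dots> = code_weight \<eta> 0 + ((\<Sum>n\<in>?P. code_weight \<eta> n) + (\<Sum>n\<in>?Q. code_weight \<eta> n))"
    by (subst sum.insert) (auto simp del: of_nat_Suc intro!: sum.union_disjoint)
  also have "\<dots> \<le> (1 - \<eta>) + (\<eta> / 2 + \<eta> / 2)"
    using P unfolding Q by (intro add_mono) (auto simp: code_weight_def)
  finally show ?thesis by simp
qed

text \<open>If \<open>x\<close> rounds to 0, the cost is at most \<open>2 * \<eta>\<close>.
  Otherwise \<open>y = 2 * \<bar>x\<bar>\<close> is at least 1 and dominates the rounded value; then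
  \<open>ln y \<le> y powr s / s\<close> and \<open>1 \<le> y powr s\<close> turn the logarithm into
  a moment of order \<open>s\<close>.\<close>

lemma code_weight_cost:
  assumes \<eta>: "0 < \<eta>" "\<eta> \<le> 1 / 2" and s: "0 < s"
  shows "- ln (code_weight \<eta> \<lfloor>x + 1 / 2\<rfloor>) \<le> 2 * \<eta> + (2 * \<bar>x\<bar>) powr s * (ln (4 / \<eta>) + 2 / s)"
proof -
  have l4: "0 \<le> ln (4 / \<eta>)" using \<eta> by simp
  show ?thesis
  proof (cases "\<lfloor>x + 1 / 2\<rfloor> = 0")
    case True
    have "- ln (1 - \<eta>) \<le> \<eta> + 2 * \<eta>\<^sup>2" using ln_one_minus_pos_lower_bound[of \<eta>] \<eta> by simp
    also have "2 * \<eta>\<^sup>2 \<le> \<eta>" using \<eta> mult_left_mono[of \<eta> "1 / 2" \<eta>] by (simp add: power2_eq_square)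
    finally show ?thesis using True l4 s by (simp add: code_weight_def add_increasing2)
  next
    case False
    define n where "n = \<lfloor>x + 1 / 2\<rfloor>"
    have n: "\<bar>real_of_int n\<bar> \<le> \<bar>x\<bar> + 1 / 2" unfolding n_def by linarith
    have n1: "1 \<le> \<bar>real_of_int n\<bar>" using False unfolding n_def by linarith
    define y where "y = 2 * \<bar>x\<bar>"
    have y: "\<bar>real_of_int n\<bar> \<le> y" "1 \<le> y" using n n1 by (auto simp: y_def)
    have "- ln (code_weight \<eta> n) = ln (4 / \<eta>) + 2 * ln \<bar>real_of_int n\<bar>"
    proof -
      have "code_weight \<eta> n = \<eta> / (4 * \<bar>real_of_int n\<bar>\<^sup>2)" using False by (simp add: code_weight_def n_def)
      moreover have "\<eta> / (4 * \<bar>real_of_int n\<bar>\<^sup>2) = \<eta> / 4 / \<bar>real_of_int n\<bar>\<^sup>2" by simp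
      moreover have "ln (\<eta> / 4 / \<bar>real_of_int n\<bar>\<^sup>2) = ln (\<eta> / 4) - ln (\<bar>real_of_int n\<bar>\<^sup>2)"
        using \<eta> n1 by (subst ln_div) auto
      moreover have "ln (\<bar>real_of_int n\<bar>\<^sup>2) = 2 * ln \<bar>real_of_int n\<bar>"
        using n1 ln_realpow[of "\<bar>real_of_int n\<bar>" 2] by simp
      moreover have "ln (\<eta> / 4) = - ln (4 / \<eta>)" using \<eta> by (simp add: ln_div)
      ultimately show ?thesis by simp
    qed
    also have "\<dots> \<le> ln (4 / \<eta>) + 2 * ln y" using y n1 by simp
    also have "ln y \<le> y powr s / s"
    proof -
      have "s * ln y = ln (y powr s)" using y by (simp add: ln_powr)
      also have "\<dots> \<le> y powr s" using y ln_bound[of "y powr s"] by simp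
      finally show ?thesis using s by (simp add: field_simps)
    qed
    also have "ln (4 / \<eta>) + 2 * (y powr s / s) \<le> y powr s * (ln (4 / \<eta>) + 2 / s)"
    proof -
      have "1 \<le> y powr s" using y s by (simp add: ge_one_powr_ge_zero)
      then have "1 * ln (4 / \<eta>) \<le> y powr s * ln (4 / \<eta>)" using l4 by (rule mult_right_mono)
      then show ?thesis by (simp add: distrib_left mult.commute)
    qed
    finally show ?thesis using \<eta> by (simp add: n_def y_def)
  qed
qed

text \<open>By Markov's inequality the code length is at most \<open>2 * e\<close> with probability
  at least 1/2. At most \<open>exp (2 * e)\<close> values have a code so short, as the weights sum
  to at most 1. Cauchy-Schwarz on these values bounds the sum of the squared probabilities below by
  \<open>(1 / 2)\<^sup>2 * exp (- 2 * e)\<close>, and by independence this sum is a probability of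
  collision. \<open>B\<close> is any event that contains all collisions.\<close>

lemma (in prob_space) collision_probability:
  assumes X: "X \<in> measurable M S" and Y: "Y \<in> measurable M S"
    and sing: "\<And>n. n \<in> space S \<Longrightarrow> {n} \<in> sets S"
    and indep: "indep_var S X S Y"
    and eq: "distr M S X = distr M S Y"
    and q: "\<And>n. n \<in> space S \<Longrightarrow> 0 < q n" "\<And>n. n \<in> space S \<Longrightarrow> q n \<le> 1"
      "\<And>A. finite A \<Longrightarrow> A \<subseteq> space S \<Longrightarrow> (\<Sum>n\<in>A. q n) \<le> 1"
    and q_meas: "(\<lambda>\<omega>. q (X \<omega>)) \<in> borel_measurable M"
    and e: "0 < e" "(\<integral>\<^sup>+\<omega>. ennreal (- ln (q (X \<omega>))) \<partial>M) \<le> ennreal e"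
    and B: "B \<in> events" "\<And>\<omega>. \<omega> \<in> space M \<Longrightarrow> X \<omega> = Y \<omega> \<Longrightarrow> \<omega> \<in> B"
  shows "exp (- 2 * e) / 4 \<le> prob B"
proof -
  define A where "A = {n \<in> space S. exp (- 2 * e) \<le> q n}"
  have card: "real (card F) \<le> exp (2 * e)" if "finite F" "F \<subseteq> A" for F
  proof -
    have "real (card F) * exp (- 2 * e) = (\<Sum>n\<in>F. exp (- 2 * e))" by simp
    also have "\<dots> \<le> (\<Sum>n\<in>F. q n)" using that by (intro sum_mono) (auto simp: A_def)
    also have "\<dots> \<le> 1" using that by (intro q(3)) (auto simp: A_def)
    finally show ?thesis by (simp add: exp_minus field_simps)
  qed
  have fin: "finite A"
  proof (rule ccontr)
    assume "infinite A"
    from infinite_arbitrarily_large[OF this, of "Suc (nat \<lceil>exp (2 * e)\<rceil>)"]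
    obtain F where "finite F" "card F = Suc (nat \<lceil>exp (2 * e)\<rceil>)" "F \<subseteq> A" by auto
    with card[of F] show False by (simp; linarith)
  qed
  have AS: "A \<in> sets S"
  proof -
    have "A = (\<Union>n\<in>A. {n})" by auto
    also have "\<dots> \<in> sets S" using fin sing by (intro sets.finite_UN) (auto simp: A_def)
    finally show ?thesis .
  qed
  define p where "p n = prob (X -` {n} \<inter> space M)" for n
  have p_Y: "prob (Y -` {n} \<inter> space M) = p n" if "n \<in> A" for n
  proof -
    have "measure (distr M S X) {n} = measure (distr M S Y) {n}" by (simp add: eq)
    then show ?thesis using that sing X Y by (simp add: measure_distr p_def A_def)
  qed
  have meas: "X -` {n} \<inter> space M \<in> events" "Y -` {n} \<inter> space M \<in> events" if "n \<in> A" for n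
    using that sing by (auto intro!: measurable_sets[OF X] measurable_sets[OF Y] simp: A_def)
  have half: "1 / 2 \<le> prob (X -` A \<inter> space M)"
  proof -
    let ?E = "{\<omega>\<in>space M. ennreal (2 * e) \<le> ennreal (- ln (q (X \<omega>)))}"
    have "ennreal (2 * e) * emeasure M ?E \<le> (\<integral>\<^sup>+\<omega>. ennreal (- ln (q (X \<omega>))) \<partial>M)"
    proof -
      have "ennreal (2 * e) * emeasure M ?E = (\<integral>\<^sup>+\<omega>. ennreal (2 * e) * indicator ?E \<omega> \<partial>M)"
        using q_meas by (subst nn_integral_cmult_indicator) auto
      also have "\<dots> \<le> (\<integral>\<^sup>+\<omega>. ennreal (- ln (q (X \<omega>))) \<partial>M)"
        by (intro nn_integral_mono) (auto split: split_indicator)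
      finally show ?thesis .
    qed
    also have "\<dots> \<le> ennreal e" by (rule e(2))
    finally have "ennreal (2 * e * prob ?E) \<le> ennreal e"
      using e(1) by (simp add: emeasure_eq_measure ennreal_mult)
    then have E: "prob ?E \<le> 1 / 2" using e(1) by (simp add: ennreal_le_iff)
    have "space M - ?E \<subseteq> X -` A \<inter> space M"
    proof
      fix \<omega> assume \<omega>: "\<omega> \<in> space M - ?E"
      then have XS: "X \<omega> \<in> space S" using measurable_space[OF X] by auto
      have "- ln (q (X \<omega>)) < 2 * e" using \<omega> e(1) by (auto simp: not_le ennreal_less_iff ln_le_zero_iff
            q(1)[OF XS] q(2)[OF XS])
      then have "exp (- 2 * e) \<le> exp (ln (q (X \<omega>)))" by (intro iffD2[OF exp_le_cancel_iff]) linarith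
      then show "\<omega> \<in> X -` A \<inter> space M" using \<omega> XS q(1)[OF XS] by (simp add: A_def)
    qed
    then have "prob (space M - ?E) \<le> prob (X -` A \<inter> space M)"
      by (intro finite_measure_mono measurable_sets[OF X AS])
    moreover have "prob (space M - ?E) = 1 - prob ?E" using q_meas by (intro prob_compl) auto
    ultimately show ?thesis using E by linarith
  qed
  have "X -` A \<inter> space M = (\<Union>n\<in>A. X -` {n} \<inter> space M)" by auto
  moreover have "prob (\<Union>n\<in>A. X -` {n} \<inter> space M) = (\<Sum>n\<in>A. p n)"
    unfolding p_def using meas(1)
    by (intro finite_measure_finite_Union[OF fin]) (auto simp: disjoint_family_on_def)
  ultimately have "prob (X -` A \<inter> space M) = (\<Sum>n\<in>A. p n)" by (simp only:)
  with half have "(1 / 2)\<^sup>2 \<le> (\<Sum>n\<in>A. p n)\<^sup>2" by (intro power_mono) auto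
  also have "\<dots> \<le> (\<Sum>n\<in>A. (p n)\<^sup>2) * card A" by (rule sum_squared_le_sum_of_squares)
  also have "\<dots> \<le> (\<Sum>n\<in>A. (p n)\<^sup>2) * exp (2 * e)"
    using card[OF fin] by (intro mult_left_mono sum_nonneg) auto
  finally have 1: "exp (- 2 * e) / 4 \<le> (\<Sum>n\<in>A. (p n)\<^sup>2)"
    by (simp add: exp_minus field_simps power2_eq_square)
  let ?C = "\<lambda>n. (X -` {n} \<inter> space M) \<inter> (Y -` {n} \<inter> space M)"
  have "prob (?C n) = (p n)\<^sup>2" if "n \<in> A" for n
  proof -
    have n: "{n} \<in> sets S" using that sing by (auto simp: A_def)
    have "?C n = (\<lambda>\<omega>. (X \<omega>, Y \<omega>)) -` ({n} \<times> {n}) \<inter> space M" by auto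
    then show ?thesis
      using indep_varD[OF indep n n] p_Y[OF that] by (simp add: p_def power2_eq_square)
  qed
  then have "(\<Sum>n\<in>A. (p n)\<^sup>2) = (\<Sum>n\<in>A. prob (?C n))" by simp
  also have "\<dots> = prob (\<Union>n\<in>A. ?C n)"
    using fin meas by (intro finite_measure_finite_Union[symmetric]) (auto simp: disjoint_family_on_def)
  also have "\<dots> \<le> prob B" using B by (intro finite_measure_mono) auto
  finally show ?thesis using 1 by linarith
qed

section \<open>Small balls for linear functionals of increments\<close>

lemma (in prob_space) indep_vars_reindex_inj:
  assumes "indep_vars (\<lambda>_. N) W I" "inj_on f J" "f ` J \<subseteq> I"
  shows "indep_vars (\<lambda>_. N) (\<lambda>j. W (f j)) J"
proof -
  have 1: "indep_vars (\<lambda>j. PiM {f j} (\<lambda>_. N)) (\<lambda>j \<omega>. restrict (\<lambda>i. W i \<omega>) {f j}) J"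
    using assms by (intro indep_vars_restrict[OF assms(1)]) (auto simp: disjoint_family_on_def inj_on_def)
  have "indep_vars (\<lambda>_. N) (\<lambda>j \<omega>. (\<lambda>x. x (f j)) (restrict (\<lambda>i. W i \<omega>) {f j})) J"
    by (rule indep_vars_compose2[OF 1]) auto
  then show ?thesis by simp
qed

lemma (in prob_space) distr_eq_if_char_eq:
  assumes "random_variable borel X" "random_variable borel Y"
    and "\<And>x. char (distr M borel X) x = char (distr M borel Y) x"
  shows "distr M borel X = distr M borel Y"
  using assms by (intro Levy_uniqueness real_distribution_distr) (auto simp: fun_eq_iff)

lemma (in prob_space) char_distr_cmult:
  fixes X :: "'a \<Rightarrow> real"
  assumes [measurable]: "random_variable borel X"
  shows "char (distr M borel (\<lambda>\<omega>. c * X \<omega>)) x = char (distr M borel X) (c * x)"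
  unfolding char_def by (simp add: integral_distr mult_ac)

text \<open>
  Bounds the expected code length of \<open>X / \<epsilon>\<close> rounded to an integer when \<open>X\<close> is symmetric stable with
  \<open>E (exp (i * x * X)) = exp (- A * \<bar>x\<bar> powr \<alpha>)\<close> and \<open>A \<le> B\<close>.
\<close>

definition coding_cost :: "real \<Rightarrow> real \<Rightarrow> real \<Rightarrow> real \<Rightarrow> real \<Rightarrow> real \<Rightarrow> real" where
  "coding_cost \<alpha> s C \<eta> B \<epsilon> =
     2 * \<eta> + (ln (4 / \<eta>) + 2 / s) * ((2 / \<epsilon>) powr s * (C * B powr (s / \<alpha>)))"

lemma coding_cost_pos:
  "0 < \<eta> \<Longrightarrow> \<eta> \<le> 1 / 2 \<Longrightarrow> 0 < s \<Longrightarrow> 0 \<le> C \<Longrightarrow> 0 < coding_cost \<alpha> s C \<eta> B \<epsilon>"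
  by (auto simp: coding_cost_def intro!: add_pos_nonneg mult_nonneg_nonneg)

lemma nn_integral_coding_cost:
  assumes \<mu>: "real_distribution \<mu>" and AB: "0 \<le> A" "A \<le> B" "0 < B"
    and ch: "\<forall>x. char \<mu> x = of_real (exp (- A * \<bar>x\<bar> powr \<alpha>))"
    and \<eta>: "0 < \<eta>" "\<eta> \<le> 1 / 2" and s: "0 < s" and C: "moment_const \<alpha> s C" and \<epsilon>: "0 < \<epsilon>"
  shows "(\<integral>\<^sup>+x. ennreal (- ln (code_weight \<eta> \<lfloor>x / \<epsilon> + 1 / 2\<rfloor>)) \<partial>\<mu>) \<le> ennreal (coding_cost \<alpha> s C \<eta> B \<epsilon>)"
proof -
  interpret real_distribution \<mu> by fact
  define K where "K = ln (4 / \<eta>) + 2 / s"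
  have K: "0 \<le> K" using \<eta> s by (simp add: K_def)
  have C0: "0 \<le> C" using C by (simp add: moment_const_def)
  have m: "(\<integral>\<^sup>+x. ennreal (\<bar>x\<bar> powr s) \<partial>\<mu>) \<le> ennreal (C * B powr (s / \<alpha>))"
    using C \<mu> AB ch unfolding moment_const_def by blast
  have "(\<integral>\<^sup>+x. ennreal (- ln (code_weight \<eta> \<lfloor>x / \<epsilon> + 1 / 2\<rfloor>)) \<partial>\<mu>)
    \<le> (\<integral>\<^sup>+x. ennreal (2 * \<eta>) + ennreal (K * (2 / \<epsilon>) powr s) * ennreal (\<bar>x\<bar> powr s) \<partial>\<mu>)"
  proof (rule nn_integral_mono)
    fix x
    have "(2 * \<bar>x / \<epsilon>\<bar>) powr s = (2 / \<epsilon>) powr s * \<bar>x\<bar> powr s"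
      using \<epsilon> by (simp flip: powr_mult)
    then have "- ln (code_weight \<eta> \<lfloor>x / \<epsilon> + 1 / 2\<rfloor>) \<le> 2 * \<eta> + (K * (2 / \<epsilon>) powr s) * \<bar>x\<bar> powr s"
      using code_weight_cost[OF \<eta> s, of "x / \<epsilon>"] by (simp add: K_def mult_ac)
    then show "ennreal (- ln (code_weight \<eta> \<lfloor>x / \<epsilon> + 1 / 2\<rfloor>))
       \<le> ennreal (2 * \<eta>) + ennreal (K * (2 / \<epsilon>) powr s) * ennreal (\<bar>x\<bar> powr s)"
      using K \<eta> by (simp add: ennreal_leI flip: ennreal_mult ennreal_plus)
  qed
  also have "\<dots> = ennreal (2 * \<eta>) + ennreal (K * (2 / \<epsilon>) powr s) * (\<integral>\<^sup>+x. ennreal (\<bar>x\<bar> powr s) \<partial>\<mu>)"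
    using emeasure_space_1 by (simp add: nn_integral_add nn_integral_cmult)
  also have "\<dots> \<le> ennreal (2 * \<eta>) + ennreal (K * (2 / \<epsilon>) powr s) * ennreal (C * B powr (s / \<alpha>))"
    using m by (intro add_left_mono mult_left_mono) auto
  also have "\<dots> = ennreal (coding_cost \<alpha> s C \<eta> B \<epsilon>)"
    using K \<eta> C0 by (simp add: coding_cost_def K_def mult_ac flip: ennreal_mult ennreal_plus)
  finally show ?thesis .
qed

context symmetric_stable_levy
begin

lemma measurable_increment: "0 \<le> s \<Longrightarrow> 0 \<le> t \<Longrightarrow> (\<lambda>\<omega>. Z t \<omega> - Z s \<omega>) \<in> borel_measurable M"
  using measurable_Z by (intro borel_measurable_diff) auto

lemma char_increment:
  assumes "0 \<le> s" "s \<le> t"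
  shows "char (distr M borel (\<lambda>\<omega>. Z t \<omega> - Z s \<omega>)) x = of_real (exp (- (t - s) * \<bar>x\<bar> powr \<alpha>))"
  using stationary_increments[of s "t - s"] char_Z[of "t - s" x] assms by simp

text \<open>\<open>X\<close> and \<open>Y\<close> collect the increments over the left and the right
  halves of the cells, so each functional is \<open>\<Lambda> a\<close> of \<open>X\<close> plus
  \<open>\<Lambda> a\<close> of \<open>Y\<close>. Symmetry lets \<open>Y'\<close>, the negative of
  \<open>Y\<close>, take the place of \<open>Y\<close>. All functionals are rounded to one integer
  vector, and a collision of two such vectors controls them simultaneously.\<close>

lemma small_ball_grid:
  fixes v :: "nat \<Rightarrow> real" and b :: "'i \<Rightarrow> nat \<Rightarrow> real"
  assumes v: "0 \<le> v 0" "\<And>j. j < N \<Longrightarrow> v j \<le> v (Suc j)" and N: "0 < N"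
    and I: "finite I" "I \<noteq> {}"
    and B: "\<And>a. a \<in> I \<Longrightarrow> (\<Sum>j<N. \<bar>b a j\<bar> powr \<alpha> * (v (Suc j) - v j)) \<le> B a" "\<And>a. a \<in> I \<Longrightarrow> 0 < B a"
    and \<epsilon>: "\<And>a. a \<in> I \<Longrightarrow> 0 < \<epsilon> a"
    and \<eta>: "\<And>a. a \<in> I \<Longrightarrow> 0 < \<eta> a" "\<And>a. a \<in> I \<Longrightarrow> \<eta> a \<le> 1 / 2"
    and s: "\<And>a. a \<in> I \<Longrightarrow> 0 < s a" and C: "\<And>a. a \<in> I \<Longrightarrow> moment_const \<alpha> (s a) (C a)"
  shows "exp (- 2 * (\<Sum>a\<in>I. coding_cost \<alpha> (s a) (C a) (\<eta> a) (B a) (\<epsilon> a))) / 4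
    \<le> prob {\<omega>\<in>space M. \<forall>a\<in>I. \<bar>\<Sum>j<N. b a j * (Z (v (Suc j)) \<omega> - Z (v j) \<omega>)\<bar> \<le> \<epsilon> a}"
proof -
  let ?d = "distr M borel"
  let ?cost = "\<lambda>a. coding_cost \<alpha> (s a) (C a) (\<eta> a) (B a) (\<epsilon> a)"
  let ?cw = "\<lambda>a x. code_weight (\<eta> a) \<lfloor>x / \<epsilon> a + 1 / 2\<rfloor>"
  let ?L = "\<lambda>a \<omega>. \<Sum>j<N. b a j * (Z (v (Suc j)) \<omega> - Z (v j) \<omega>)"
  \<comment> \<open>Even indices are the points of the grid, odd ones the midpoints of its
    cells.\<close>
  define w where "w i = (if even i then v (i div 2) else (v (i div 2) + v (Suc (i div 2))) / 2)" for i
  define h where "h j = (v (Suc j) - v j) / 2" for j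
  have w_mono: "w i \<le> w (Suc i)" if "i < 2 * N" for i
  proof -
    have "i div 2 < N" using that by linarith
    from v(2)[OF this] show ?thesis by (cases "even i") (auto simp: w_def elim!: evenE oddE)
  qed
  have h0: "0 \<le> h j" if "j < N" for j using v(2)[OF that] by (simp add: h_def)
  have w0: "0 \<le> w 0" using v by (simp add: w_def)
  have w_ge0: "0 \<le> w i" if "i \<le> 2 * N" for i
    using that by (induction i) (use w0 w_mono in \<open>auto intro: order_trans\<close>)
  define W where "W i \<omega> = Z (w (Suc i)) \<omega> - Z (w i) \<omega>" for i \<omega>
  have indW: "indep_vars (\<lambda>_. borel) W {..<2 * N}"
    using independent_increments[of w "2 * N"] w0 w_mono by (simp add: W_def[abs_def])
  have Wm: "W i \<in> borel_measurable M" if "i < 2 * N" for i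
    unfolding W_def using w_ge0 that by (intro measurable_increment) auto
  have w_even: "w (2 * j) = v j" "w (Suc (2 * j)) = (v j + v (Suc j)) / 2" "w (Suc (Suc (2 * j))) = v (Suc j)" for j
    by (auto simp: w_def)
  have chW: "char (?d (W (2 * j))) x = of_real (exp (- h j * \<bar>x\<bar> powr \<alpha>))"
    "char (?d (W (Suc (2 * j)))) x = of_real (exp (- h j * \<bar>x\<bar> powr \<alpha>))" if "j < N" for j x
  proof -
    have "0 \<le> w (2 * j)" "0 \<le> w (Suc (2 * j))" using that by (auto intro!: w_ge0)
    moreover have "w (2 * j) \<le> w (Suc (2 * j))" "w (Suc (2 * j)) \<le> w (Suc (Suc (2 * j)))"
      using that by (auto intro!: w_mono)
    moreover have "w (Suc (2 * j)) - w (2 * j) = h j" "w (Suc (Suc (2 * j))) - w (Suc (2 * j)) = h j"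
      unfolding w_even h_def by (auto simp: field_simps)
    ultimately show "char (?d (W (2 * j))) x = of_real (exp (- h j * \<bar>x\<bar> powr \<alpha>))"
      "char (?d (W (Suc (2 * j)))) x = of_real (exp (- h j * \<bar>x\<bar> powr \<alpha>))"
      using char_increment[of "w (2 * j)" "w (Suc (2 * j))" x]
        char_increment[of "w (Suc (2 * j))" "w (Suc (Suc (2 * j)))" x]
      by (simp_all only: W_def[abs_def])
  qed
  let ?P = "PiM {..<N} (\<lambda>_. borel :: real measure)"
  define X where "X \<omega> = (\<lambda>j\<in>{..<N}. W (2 * j) \<omega>)" for \<omega>
  define Y where "Y \<omega> = (\<lambda>j\<in>{..<N}. W (Suc (2 * j)) \<omega>)" for \<omega>
  define Y' where "Y' \<omega> = (\<lambda>j\<in>{..<N}. - W (Suc (2 * j)) \<omega>)" for \<omega>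
  have ind_even: "indep_vars (\<lambda>_. borel) (\<lambda>j. W (2 * j)) {..<N}"
    by (rule indep_vars_reindex_inj[OF indW]) (auto simp: inj_on_def)
  have ind_odd: "indep_vars (\<lambda>_. borel) (\<lambda>j. W (Suc (2 * j))) {..<N}"
    by (rule indep_vars_reindex_inj[OF indW]) (auto simp: inj_on_def)
  have ind_odd': "indep_vars (\<lambda>_. borel) (\<lambda>j \<omega>. - W (Suc (2 * j)) \<omega>) {..<N}"
    using indep_vars_compose2[OF ind_odd, of "\<lambda>_ x. - x" "\<lambda>_. borel"] by simp
  have Wm': "W (2 * j) \<in> borel_measurable M" "W (Suc (2 * j)) \<in> borel_measurable M" if "j \<in> {..<N}" for j
    using that by (auto intro!: Wm)
  have N0: "{..<N} \<noteq> {}" using N by auto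
  have dX: "distr M ?P X = (\<Pi>\<^sub>M j\<in>{..<N}. ?d (W (2 * j)))"
    using ind_even Wm' unfolding X_def[abs_def]
    by (subst indep_vars_iff_distr_eq_PiM'[OF N0, symmetric]) auto
  have dY: "distr M ?P Y = (\<Pi>\<^sub>M j\<in>{..<N}. ?d (W (Suc (2 * j))))"
    using ind_odd Wm' unfolding Y_def[abs_def]
    by (subst indep_vars_iff_distr_eq_PiM'[OF N0, symmetric]) auto
  have dY': "distr M ?P Y' = (\<Pi>\<^sub>M j\<in>{..<N}. ?d (\<lambda>\<omega>. - W (Suc (2 * j)) \<omega>))"
    using ind_odd' Wm' unfolding Y'_def[abs_def]
    by (subst indep_vars_iff_distr_eq_PiM'[OF N0, symmetric]) auto
  have e1: "?d (W (2 * j)) = ?d (W (Suc (2 * j)))" if "j \<in> {..<N}" for j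
    using that Wm' chW by (intro distr_eq_if_char_eq) auto
  have e2: "?d (W (2 * j)) = ?d (\<lambda>\<omega>. - W (Suc (2 * j)) \<omega>)" if "j \<in> {..<N}" for j
  proof (rule distr_eq_if_char_eq)
    show "char (?d (W (2 * j))) x = char (?d (\<lambda>\<omega>. - W (Suc (2 * j)) \<omega>)) x" for x
      using char_distr_cmult[OF Wm'(2)[OF that], of "-1" x] chW[of j] that by simp
  qed (use Wm' that in auto)
  have XY: "distr M ?P X = distr M ?P Y"
    unfolding dX dY by (rule PiM_cong) (auto simp: e1)
  have XY': "distr M ?P X = distr M ?P Y'"
    unfolding dX dY' by (rule PiM_cong) (auto simp: e2)
  have indXY: "indep_var ?P X ?P Y"
  proof -
    let ?A = "(\<lambda>j. 2 * j) ` {..<N}" and ?B = "(\<lambda>j. Suc (2 * j)) ` {..<N}"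
    have 1: "indep_var (PiM ?A (\<lambda>_. borel)) (\<lambda>\<omega>. restrict (\<lambda>i. W i \<omega>) ?A)
       (PiM ?B (\<lambda>_. borel)) (\<lambda>\<omega>. restrict (\<lambda>i. W i \<omega>) ?B)"
    proof (rule indep_var_restrict[OF indW])
      show "?A \<inter> ?B = {}" by auto presburger
    qed (auto simp: image_subset_iff)
    have "indep_var ?P ((\<lambda>x. \<lambda>j\<in>{..<N}. x (2 * j)) \<circ> (\<lambda>\<omega>. restrict (\<lambda>i. W i \<omega>) ?A))
       ?P ((\<lambda>x. \<lambda>j\<in>{..<N}. x (Suc (2 * j))) \<circ> (\<lambda>\<omega>. restrict (\<lambda>i. W i \<omega>) ?B))"
      by (rule indep_var_compose[OF 1]; intro measurable_restrict measurable_component_singleton; auto)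
    moreover have "(\<lambda>x. \<lambda>j\<in>{..<N}. x (2 * j)) \<circ> (\<lambda>\<omega>. restrict (\<lambda>i. W i \<omega>) ?A) = X"
      by (auto simp: X_def fun_eq_iff)
    moreover have "(\<lambda>x. \<lambda>j\<in>{..<N}. x (Suc (2 * j))) \<circ> (\<lambda>\<omega>. restrict (\<lambda>i. W i \<omega>) ?B) = Y"
      by (auto simp: Y_def fun_eq_iff)
    ultimately show ?thesis by simp
  qed
  have indXY': "indep_var ?P X ?P Y'"
  proof -
    have "(\<lambda>y. \<lambda>j\<in>{..<N}. - y j) \<in> measurable ?P ?P"
      by (intro measurable_restrict borel_measurable_uminus measurable_component_singleton)
    from indep_var_compose[OF indXY measurable_ident this]
    have "indep_var ?P (id \<circ> X) ?P ((\<lambda>y. \<lambda>j\<in>{..<N}. - y j) \<circ> Y)" by (simp add: id_def)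
    moreover have "(\<lambda>y. \<lambda>j\<in>{..<N}. - y j) \<circ> Y = Y'" by (auto simp: Y_def Y'_def fun_eq_iff)
    ultimately show ?thesis by simp
  qed
  have Xm: "X \<in> measurable M ?P" and Ym: "Y \<in> measurable M ?P" and Ym': "Y' \<in> measurable M ?P"
    using indXY indXY' by (auto dest: indep_var_rv1 indep_var_rv2)
  define \<Lambda> where "\<Lambda> a x = (\<Sum>j<N. b a j * x j)" for a and x :: "nat \<Rightarrow> real"
  have \<Lambda>m: "\<Lambda> a \<in> borel_measurable ?P" for a
    unfolding \<Lambda>_def by (intro borel_measurable_sum borel_measurable_times borel_measurable_const measurable_component_singleton) auto
  define D where "D = {z \<in> space (?P \<Otimes>\<^sub>M ?P). \<forall>a\<in>I. \<bar>\<Lambda> a (fst z) + \<Lambda> a (snd z)\<bar> \<le> \<epsilon> a}"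
  have Dm: "D \<in> sets (?P \<Otimes>\<^sub>M ?P)"
  proof -
    note [measurable] = \<Lambda>m
    show ?thesis unfolding D_def using I(1) by measurable
  qed
  \<comment> \<open>Both pairs are independent with the same marginals; this is what exchanges the
    sum of the two parts for their difference.\<close>
  have joint: "distr M (?P \<Otimes>\<^sub>M ?P) (\<lambda>\<omega>. (X \<omega>, Y \<omega>)) = distr M (?P \<Otimes>\<^sub>M ?P) (\<lambda>\<omega>. (X \<omega>, Y' \<omega>))"
    using indXY indXY' XY XY' unfolding indep_var_distribution_eq by metis
  have pairm: "(\<lambda>\<omega>. (X \<omega>, Y \<omega>)) \<in> measurable M (?P \<Otimes>\<^sub>M ?P)" "(\<lambda>\<omega>. (X \<omega>, Y' \<omega>)) \<in> measurable M (?P \<Otimes>\<^sub>M ?P)"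
    using Xm Ym Ym' by auto
  have XS: "X \<omega> \<in> space ?P" "Y \<omega> \<in> space ?P" "Y' \<omega> \<in> space ?P" for \<omega>
    by (auto simp: X_def Y_def Y'_def space_PiM)
  have \<Lambda>Y': "\<Lambda> a (Y' \<omega>) = - \<Lambda> a (Y \<omega>)" for a \<omega>
    by (simp add: \<Lambda>_def Y_def Y'_def sum_negf)
  let ?G = "{\<omega>\<in>space M. \<forall>a\<in>I. \<bar>?L a \<omega>\<bar> \<le> \<epsilon> a}"
  let ?G' = "{\<omega>\<in>space M. \<forall>a\<in>I. \<bar>\<Lambda> a (X \<omega>) - \<Lambda> a (Y \<omega>)\<bar> \<le> \<epsilon> a}"
  have sumXY: "\<Lambda> a (X \<omega>) + \<Lambda> a (Y \<omega>) = ?L a \<omega>" for a \<omega>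
    unfolding \<Lambda>_def X_def Y_def sum.distrib[symmetric]
    by (intro sum.cong refl) (simp add: W_def w_even flip: distrib_left)
  have G: "?G = (\<lambda>\<omega>. (X \<omega>, Y \<omega>)) -` D \<inter> space M"
    using XS by (auto simp: D_def sumXY space_pair_measure)
  have G': "?G' = (\<lambda>\<omega>. (X \<omega>, Y' \<omega>)) -` D \<inter> space M"
    using XS by (auto simp: D_def \<Lambda>Y' space_pair_measure)
  have "prob ?G = measure (distr M (?P \<Otimes>\<^sub>M ?P) (\<lambda>\<omega>. (X \<omega>, Y \<omega>))) D"
    unfolding G by (rule measure_distr[OF pairm(1) Dm, symmetric])
  also have "\<dots> = prob ?G'"
    unfolding G' joint by (rule measure_distr[OF pairm(2) Dm])
  finally have prob_eq: "prob ?G = prob ?G'" .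
  let ?S = "PiM I (\<lambda>_. count_space (UNIV :: int set))"
  define g where "g x = (\<lambda>a\<in>I. \<lfloor>\<Lambda> a x / \<epsilon> a + 1 / 2\<rfloor>)" for x
  have gm: "g \<in> measurable ?P ?S"
  proof -
    note [measurable] = \<Lambda>m
    show ?thesis unfolding g_def by (intro measurable_restrict) measurable
  qed
  \<comment> \<open>The product has total mass at most 1 and an additive logarithm, so its expected
    length involves only the marginals, whatever the dependence between the coordinates.\<close>
  define q where "q n = (\<Prod>a\<in>I. code_weight (\<eta> a) (n a))" for n
  let ?E = "sum ?cost I"
  have C0: "0 \<le> C a" if "a \<in> I" for a using C[OF that] by (simp add: moment_const_def)
  have cw: "0 < code_weight (\<eta> a) n" "code_weight (\<eta> a) n \<le> 1" if "a \<in> I" for a n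
    using \<eta>[OF that] by (auto intro: code_weight_pos code_weight_le_1)
  have cw0: "0 \<le> code_weight (\<eta> a) n" if "a \<in> I" for a n
    using cw(1)[OF that] by (rule less_imp_le)
  have cwm: "(\<lambda>x. ?cw a (\<Lambda> a x)) \<in> borel_measurable ?P" for a
  proof -
    note [measurable] = \<Lambda>m
    have "(\<lambda>x. \<lfloor>\<Lambda> a x / \<epsilon> a + 1 / 2\<rfloor>) \<in> measurable ?P (count_space UNIV)" by measurable
    then show ?thesis by (rule measurable_compose) simp
  qed
  have "exp (- 2 * ?E) / 4 \<le> prob ?G'"
  proof (rule collision_probability[where S = ?S and X = "g \<circ> X" and Y = "g \<circ> Y" and q = q])
    show "g \<circ> X \<in> measurable M ?S" "g \<circ> Y \<in> measurable M ?S" using gm Xm Ym by (auto intro: measurable_comp)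
    show "{n} \<in> sets ?S" if "n \<in> space ?S" for n
    proof -
      have "{n} = (\<Pi>\<^sub>E a\<in>I. {n a})" using that by (auto simp: space_PiM PiE_iff extensional_def fun_eq_iff) metis
      also have "\<dots> \<in> sets ?S" using I(1) by (intro sets_PiM_I_finite) auto
      finally show ?thesis .
    qed
    show "indep_var ?S (g \<circ> X) ?S (g \<circ> Y)" by (rule indep_var_compose[OF indXY gm gm])
    show "distr M ?S (g \<circ> X) = distr M ?S (g \<circ> Y)"
      using distr_distr[OF gm Xm] distr_distr[OF gm Ym] XY by simp
    show "0 < q n" "q n \<le> 1" for n unfolding q_def using cw cw0 by (auto intro!: prod_pos prod_le_1)
    show "(\<Sum>n\<in>A. q n) \<le> 1" if A: "finite A" "A \<subseteq> space ?S" for A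
    proof -
      \<comment> \<open>A finite set of integer vectors lies in the product of its projections, over
        which a sum of products is a product of sums.\<close>
      define T where "T a = (\<lambda>n. n a) ` A" for a
      have "A \<subseteq> Pi\<^sub>E I T" using A(2) by (auto simp: space_PiM PiE_iff T_def)
      then have "(\<Sum>n\<in>A. q n) \<le> (\<Sum>n\<in>Pi\<^sub>E I T. q n)"
        using A(1) I(1) cw0 by (intro sum_mono2 finite_PiE) (auto simp: T_def q_def intro!: prod_nonneg)
      also have "\<dots> = (\<Prod>a\<in>I. \<Sum>n\<in>T a. code_weight (\<eta> a) n)"
        unfolding q_def using I(1) A(1) by (subst prod_sum_PiE) (auto simp: T_def)
      also have "\<dots> \<le> 1"
        using A(1) \<eta> cw0 by (intro prod_le_1 conjI sum_nonneg sum_code_weight_le_1) (auto simp: T_def)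
      finally show ?thesis .
    qed
    have qg: "q (g x) = (\<Prod>a\<in>I. ?cw a (\<Lambda> a x))" for x
      by (simp add: q_def g_def)
    have "(\<lambda>x. q (g x)) \<in> borel_measurable ?P" unfolding qg by (intro borel_measurable_prod cwm)
    then show "(\<lambda>\<omega>. q ((g \<circ> X) \<omega>)) \<in> borel_measurable M" using measurable_compose[OF Xm] by simp
    show "0 < ?E" using I \<eta> s C0 by (intro sum_pos coding_cost_pos) auto
    show "(\<integral>\<^sup>+\<omega>. ennreal (- ln (q ((g \<circ> X) \<omega>))) \<partial>M) \<le> ennreal ?E"
    proof -
      have "(\<integral>\<^sup>+\<omega>. ennreal (- ln (q ((g \<circ> X) \<omega>))) \<partial>M)
        = (\<integral>\<^sup>+\<omega>. (\<Sum>a\<in>I. ennreal (- ln (?cw a (\<Lambda> a (X \<omega>))))) \<partial>M)"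
      proof (intro nn_integral_cong)
        fix \<omega>
        have "ln (q (g (X \<omega>))) = (\<Sum>a\<in>I. ln (?cw a (\<Lambda> a (X \<omega>))))"
          unfolding qg using I cw(1) by (intro ln_prod) (auto simp: less_imp_neq[THEN not_sym])
        then show "ennreal (- ln (q ((g \<circ> X) \<omega>)))
          = (\<Sum>a\<in>I. ennreal (- ln (?cw a (\<Lambda> a (X \<omega>)))))"
          using cw by (subst sum_ennreal) (auto simp: sum_negf ln_le_zero_iff)
      qed
      also have "\<dots> = (\<Sum>a\<in>I. \<integral>\<^sup>+\<omega>. ennreal (- ln (?cw a (\<Lambda> a (X \<omega>)))) \<partial>M)"
        by (intro nn_integral_sum measurable_compose[OF _ measurable_ennreal] borel_measurable_uminus
            borel_measurable_ln measurable_compose[OF Xm cwm])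
      also have "\<dots> \<le> (\<Sum>a\<in>I. ennreal (?cost a))"
      proof (rule sum_mono)
        fix a assume a: "a \<in> I"
        let ?\<mu> = "?d (\<lambda>\<omega>. \<Lambda> a (X \<omega>))"
        \<comment> \<open>The scale parameter of \<open>\<Lambda> a\<close> evaluated at
          \<open>X\<close>: half cells yield half of the sum that \<open>B a\<close> bounds.\<close>
        define A where "A = (\<Sum>j<N. \<bar>b a j\<bar> powr \<alpha> * h j)"
        have A0: "0 \<le> A" unfolding A_def using h0 by (intro sum_nonneg) auto
        have AB: "A \<le> B a"
        proof -
          have "A \<le> (\<Sum>j<N. \<bar>b a j\<bar> powr \<alpha> * (v (Suc j) - v j))"
            unfolding A_def using h0 by (intro sum_mono mult_left_mono) (auto simp: h_def field_simps)
          then show ?thesis using B(1)[OF a] by linarith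
        qed
        have lm: "(\<lambda>\<omega>. \<Lambda> a (X \<omega>)) \<in> borel_measurable M" by (rule measurable_compose[OF Xm \<Lambda>m])
        have "char ?\<mu> x = of_real (exp (- A * \<bar>x\<bar> powr \<alpha>))" for x
        proof -
          have "indep_vars (\<lambda>_. borel) (\<lambda>j \<omega>. b a j * W (2 * j) \<omega>) {..<N}"
            using indep_vars_compose2[OF ind_even, of "\<lambda>j x. b a j * x" "\<lambda>_. borel"] by simp
          then have "char (?d (\<lambda>\<omega>. \<Sum>j<N. b a j * W (2 * j) \<omega>)) x
            = (\<Prod>j<N. char (?d (\<lambda>\<omega>. b a j * W (2 * j) \<omega>)) x)" by (rule char_distr_sum)
          also have "\<dots> = (\<Prod>j<N. of_real (exp (- h j * \<bar>b a j * x\<bar> powr \<alpha>)))"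
            using Wm' chW by (intro prod.cong) (auto simp: char_distr_cmult)
          also have "\<dots> = of_real (exp (\<Sum>j<N. - h j * \<bar>b a j * x\<bar> powr \<alpha>))"
            by (simp add: exp_sum)
          also have "(\<Sum>j<N. - h j * \<bar>b a j * x\<bar> powr \<alpha>) = - A * \<bar>x\<bar> powr \<alpha>"
            by (simp add: A_def abs_mult powr_mult sum_distrib_left sum_negf mult_ac)
          finally show ?thesis by (simp add: \<Lambda>_def X_def)
        qed
        then have "(\<integral>\<^sup>+x. ennreal (- ln (?cw a x)) \<partial>?\<mu>)
            \<le> ennreal (?cost a)"
          by (intro nn_integral_coding_cost[OF real_distribution_distr[OF lm] A0 AB B(2)[OF a] _ \<eta>[OF a] s[OF a] C[OF a] \<epsilon>[OF a]]) auto
        moreover have "(\<lambda>x. ennreal (- ln (?cw a x))) \<in> borel_measurable borel"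
        proof -
          have "(\<lambda>x::real. \<lfloor>x / \<epsilon> a + 1 / 2\<rfloor>) \<in> measurable borel (count_space UNIV)" by measurable
          then show ?thesis by (rule measurable_compose) simp
        qed
        ultimately show "(\<integral>\<^sup>+\<omega>. ennreal (- ln (?cw a (\<Lambda> a (X \<omega>)))) \<partial>M)
          \<le> ennreal (?cost a)"
          by (simp add: nn_integral_distr[OF lm])
      qed
      also have "\<dots> = ennreal ?E"
        by (intro sum_ennreal less_imp_le[OF coding_cost_pos[OF \<eta> s C0]])
      finally show ?thesis .
    qed
    show "?G' \<in> events" unfolding G' by (rule measurable_sets[OF pairm(2) Dm])
    fix \<omega> assume \<omega>: "\<omega> \<in> space M" "(g \<circ> X) \<omega> = (g \<circ> Y) \<omega>"
    show "\<omega> \<in> ?G'"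
    proof (safe intro!: \<omega>(1))
      fix a assume a: "a \<in> I"
      have "g (X \<omega>) a = g (Y \<omega>) a" using \<omega>(2) by simp
      then have "\<lfloor>\<Lambda> a (X \<omega>) / \<epsilon> a + 1 / 2\<rfloor> = \<lfloor>\<Lambda> a (Y \<omega>) / \<epsilon> a + 1 / 2\<rfloor>"
        using a by (simp add: g_def)
      then have "\<bar>\<Lambda> a (X \<omega>) / \<epsilon> a - \<Lambda> a (Y \<omega>) / \<epsilon> a\<bar> \<le> 1" by linarith
      then show "\<bar>\<Lambda> a (X \<omega>) - \<Lambda> a (Y \<omega>)\<bar> \<le> \<epsilon> a"
        using \<epsilon>[OF a] by (simp add: diff_divide_distrib[symmetric] abs_divide divide_le_eq)
    qed
  qed
  then show ?thesis unfolding prob_eq .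
qed

end

section \<open>Passage to the Riemann-Liouville process\<close>

lemma chain_mono:
  fixes u :: "nat \<Rightarrow> 'a :: order"
  assumes "\<And>i. i < n \<Longrightarrow> u i \<le> u (Suc i)" "i \<le> j" "j \<le> n"
  shows "u i \<le> u j"
  using assms(2,3)
proof (induction j rule: dec_induct)
  case (step k)
  then show ?case using assms(1)[of k] by (auto intro: order_trans)
qed simp

text \<open>Comparing all terms with the largest one gives a constant valid for every \<alpha> in
  (0, 2], whether the power is concave or convex. For two terms it is 9.\<close>

lemma abs_sum_powr_le:
  assumes "0 < \<alpha>" "\<alpha> \<le> 2" "finite A"
  shows "\<bar>\<Sum>i\<in>A. x i\<bar> powr \<alpha> \<le> (real (card A) + 1)\<^sup>2 * (\<Sum>i\<in>A. \<bar>x i\<bar> powr \<alpha>)"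
proof (cases "A = {}")
  case False
  define m where "m = Max ((\<lambda>i. \<bar>x i\<bar>) ` A)"
  have "m \<in> (\<lambda>i. \<bar>x i\<bar>) ` A" unfolding m_def using assms False by (intro Max_in) auto
  then obtain k where k: "k \<in> A" "m = \<bar>x k\<bar>" by auto
  have m: "\<bar>x i\<bar> \<le> m" if "i \<in> A" for i unfolding m_def using assms that by (intro Max_ge) auto
  have "\<bar>\<Sum>i\<in>A. x i\<bar> \<le> (\<Sum>i\<in>A. \<bar>x i\<bar>)" by (rule sum_abs)
  also have "\<dots> \<le> real (card A) * m" using m sum_bounded_above[of A "\<lambda>i. \<bar>x i\<bar>" m] by simp
  also have "\<dots> \<le> (real (card A) + 1) * m" using k by (intro mult_right_mono) auto
  finally have "\<bar>\<Sum>i\<in>A. x i\<bar> powr \<alpha> \<le> ((real (card A) + 1) * m) powr \<alpha>"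
    using assms by (intro powr_mono2) auto
  also have "\<dots> = (real (card A) + 1) powr \<alpha> * m powr \<alpha>" by (rule powr_mult)
  also have "\<dots> \<le> (real (card A) + 1)\<^sup>2 * (\<Sum>i\<in>A. \<bar>x i\<bar> powr \<alpha>)"
  proof (rule mult_mono)
    have "(real (card A) + 1) powr \<alpha> \<le> (real (card A) + 1) powr 2" using assms by (intro powr_mono) auto
    then show "(real (card A) + 1) powr \<alpha> \<le> (real (card A) + 1)\<^sup>2" by simp
    show "m powr \<alpha> \<le> (\<Sum>i\<in>A. \<bar>x i\<bar> powr \<alpha>)"
      unfolding k(2) using k(1) assms by (intro member_le_sum) auto
  qed auto
  finally show ?thesis .
qed (use assms in simp)

text \<open>\<open>y\<close> is the left endpoint of a grid cell. The intervals of a step function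
  are open on the left and closed on the right, so the cell lies in the \<open>i\<close>-th one when
  \<open>y\<close> is at least its left and below its right endpoint.\<close>

definition cell_coeff :: "nat \<Rightarrow> (nat \<Rightarrow> real) \<Rightarrow> (nat \<Rightarrow> real) \<Rightarrow> real \<Rightarrow> real" where
  "cell_coeff n u c y = (\<Sum>i<n. c i * of_bool (u i \<le> y \<and> y < u (Suc i)))"

lemma increment_on_grid:
  fixes v :: "nat \<Rightarrow> real" and g :: "real \<Rightarrow> real"
  assumes v: "\<And>i. i < N \<Longrightarrow> v i < v (Suc i)" and ab: "a \<le> N" "b \<le> N" "v a \<le> v b"
  shows "g (v b) - g (v a) = (\<Sum>j<N. of_bool (v a \<le> v j \<and> v j < v b) * (g (v (Suc j)) - g (v j)))"
proof -
  have sm: "v i < v j" if "i < j" "j \<le> N" for i j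
    using that
  proof (induction j)
    case (Suc j)
    then show ?case using v[of j] by (cases "i = j") auto
  qed simp
  have vle: "v i \<le> v j \<longleftrightarrow> i \<le> j" if "i \<le> N" "j \<le> N" for i j
    using sm[of i j] sm[of j i] that by (cases i j rule: linorder_cases) auto
  have vless: "v i < v j \<longleftrightarrow> i < j" if "i \<le> N" "j \<le> N" for i j
    using vle[of j i] that by auto
  have "a \<le> b" using vle ab by auto
  have "(\<Sum>j<N. of_bool (v a \<le> v j \<and> v j < v b) * (g (v (Suc j)) - g (v j)))
    = (\<Sum>j<N. of_bool (a \<le> j \<and> j < b) * (g (v (Suc j)) - g (v j)))"
    using vle vless ab by (intro sum.cong) auto
  also have "\<dots> = (\<Sum>j\<in>{a..<b}. g (v (Suc j)) - g (v j))"
    using ab by (intro sum.mono_neutral_cong_right) auto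
  also have "\<dots> = g (v b) - g (v a)" using \<open>a \<le> b\<close> by (rule sum_Suc_diff')
  finally show ?thesis by simp
qed

text \<open>\<open>g\<close> is arbitrary because the identity is used twice: for a path of
  \<open>Z\<close>, which gives the integral, and for the map taking t to
  \<open>of_bool (x \<le> t)\<close>, which gives the integrand. Both therefore have the same
  coefficients on the refined grid.\<close>

lemma combination_on_grid:
  fixes v :: "nat \<Rightarrow> real" and g :: "real \<Rightarrow> real"
  assumes v: "\<And>i. i < N \<Longrightarrow> v i < v (Suc i)"
    and u: "\<And>i. i < n \<Longrightarrow> u i \<le> u (Suc i)" "\<And>i. i \<le> n \<Longrightarrow> u i \<in> v ` {..N}"
  shows "(\<Sum>i<n. c i * (g (u (Suc i)) - g (u i))) = (\<Sum>j<N. cell_coeff n u c (v j) * (g (v (Suc j)) - g (v j)))"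
proof -
  have "c i * (g (u (Suc i)) - g (u i))
    = (\<Sum>j<N. c i * of_bool (u i \<le> v j \<and> v j < u (Suc i)) * (g (v (Suc j)) - g (v j)))" if i: "i < n" for i
  proof -
    from u(2)[of i] i obtain a where a: "a \<le> N" "u i = v a" by auto
    from u(2)[of "Suc i"] i obtain b where b: "b \<le> N" "u (Suc i) = v b" by auto
    have "v a \<le> v b" using u(1)[OF i] a b by simp
    from increment_on_grid[where v = v and g = g, OF v a(1) b(1) this] show ?thesis
      by (simp only: a(2) b(2) sum_distrib_left mult.assoc)
  qed
  then have "(\<Sum>i<n. c i * (g (u (Suc i)) - g (u i)))
    = (\<Sum>i<n. \<Sum>j<N. c i * of_bool (u i \<le> v j \<and> v j < u (Suc i)) * (g (v (Suc j)) - g (v j)))" by simp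
  also have "\<dots> = (\<Sum>j<N. \<Sum>i<n. c i * of_bool (u i \<le> v j \<and> v j < u (Suc i)) * (g (v (Suc j)) - g (v j)))"
    by (rule sum.swap)
  finally show ?thesis by (simp only: cell_coeff_def sum_distrib_right)
qed

lemma step_integral_on_grid:
  assumes "\<And>i. i < N \<Longrightarrow> v i < v (Suc i)"
    "\<And>i. i < n \<Longrightarrow> u i \<le> u (Suc i)" "\<And>i. i \<le> n \<Longrightarrow> u i \<in> v ` {..N}"
  shows "step_integral Z n u c \<omega> = (\<Sum>j<N. cell_coeff n u c (v j) * (Z (v (Suc j)) \<omega> - Z (v j) \<omega>))"
  unfolding step_integral_def by (rule combination_on_grid[of N v n u c "\<lambda>t. Z t \<omega>", OF assms])

lemma step_function_on_grid:
  assumes v: "\<And>i. i < N \<Longrightarrow> v i < v (Suc i)"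
    and u: "\<And>i. i < n \<Longrightarrow> u i \<le> u (Suc i)" "\<And>i. i \<le> n \<Longrightarrow> u i \<in> v ` {..N}"
  shows "step_function n u c x = (\<Sum>j<N. cell_coeff n u c (v j) * indicator {v j<..v (Suc j)} x)"
proof -
  have ind: "indicator {s<..t} x = of_bool (x \<le> t) - (of_bool (x \<le> s) :: real)" if "s \<le> t" for s t
    using that by (auto split: split_indicator)
  have "step_function n u c x = (\<Sum>i<n. c i * (of_bool (x \<le> u (Suc i)) - of_bool (x \<le> u i)))"
    unfolding step_function_def using u(1) by (intro sum.cong) (simp_all add: ind)
  also have "\<dots> = (\<Sum>j<N. cell_coeff n u c (v j) * (of_bool (x \<le> v (Suc j)) - of_bool (x \<le> v j)))"
    by (rule combination_on_grid[of N v n u c "\<lambda>t. of_bool (x \<le> t)", OF v u])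
  also have "\<dots> = (\<Sum>j<N. cell_coeff n u c (v j) * indicator {v j<..v (Suc j)} x)"
    using v by (intro sum.cong) (auto simp: ind less_imp_le)
  finally show ?thesis .
qed

text \<open>The cells are disjoint, so at every point at most one term is nonzero and the power
  passes inside the sum.\<close>

lemma nn_integral_grid_step:
  fixes v b :: "nat \<Rightarrow> real"
  assumes v: "\<And>i. i < N \<Longrightarrow> v i < v (Suc i)" and \<alpha>: "0 < \<alpha>"
  shows "(\<integral>\<^sup>+x. ennreal (\<bar>\<Sum>j<N. b j * indicator {v j<..v (Suc j)} x\<bar> powr \<alpha>) \<partial>lborel)
    = ennreal (\<Sum>j<N. \<bar>b j\<bar> powr \<alpha> * (v (Suc j) - v j))"
proof -
  have mono: "v i \<le> v j" if "i \<le> j" "j \<le> N" for i j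
    by (rule chain_mono[of N v, OF less_imp_le[OF v]]) (use that in auto)
  have pt: "\<bar>\<Sum>j<N. b j * indicator {v j<..v (Suc j)} x\<bar> powr \<alpha>
    = (\<Sum>j<N. \<bar>b j\<bar> powr \<alpha> * indicator {v j<..v (Suc j)} x)" for x
  proof (cases "\<exists>k<N. x \<in> {v k<..v (Suc k)}")
    case True
    then obtain k where k: "k < N" "x \<in> {v k<..v (Suc k)}" by auto
    have other: "indicator {v j<..v (Suc j)} x = (of_bool (j = k) :: real)" if "j < N" for j
    proof (cases j k rule: linorder_cases)
      case less
      then show ?thesis using mono[of "Suc j" k] k by (auto split: split_indicator)
    next
      case greater
      then show ?thesis using mono[of "Suc k" j] k that by (auto split: split_indicator)
    qed (use k in auto)
    have "(\<Sum>j<N. b j * indicator {v j<..v (Suc j)} x) = (\<Sum>j<N. if j = k then b k else 0)"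
      by (intro sum.cong) (auto simp: other)
    moreover have "(\<Sum>j<N. \<bar>b j\<bar> powr \<alpha> * indicator {v j<..v (Suc j)} x) = (\<Sum>j<N. if j = k then \<bar>b k\<bar> powr \<alpha> else 0)"
      by (intro sum.cong) (auto simp: other)
    ultimately show ?thesis using k(1) by simp
  next
    case False
    then have "indicator {v j<..v (Suc j)} x = (0::real)" if "j < N" for j using that by (auto split: split_indicator)
    then show ?thesis by simp
  qed
  have "(\<integral>\<^sup>+x. ennreal (\<bar>\<Sum>j<N. b j * indicator {v j<..v (Suc j)} x\<bar> powr \<alpha>) \<partial>lborel)
    = (\<integral>\<^sup>+x. (\<Sum>j<N. ennreal (\<bar>b j\<bar> powr \<alpha>) * indicator {v j<..v (Suc j)} x) \<partial>lborel)"
  proof (rule nn_integral_cong)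
    fix x
    have "ennreal (\<Sum>j<N. \<bar>b j\<bar> powr \<alpha> * indicator {v j<..v (Suc j)} x)
      = (\<Sum>j<N. ennreal (\<bar>b j\<bar> powr \<alpha> * indicator {v j<..v (Suc j)} x))"
      by (rule sum_ennreal[symmetric]) simp
    also have "\<dots> = (\<Sum>j<N. ennreal (\<bar>b j\<bar> powr \<alpha>) * indicator {v j<..v (Suc j)} x)"
      by (intro sum.cong refl) (simp split: split_indicator)
    finally show "ennreal (\<bar>\<Sum>j<N. b j * indicator {v j<..v (Suc j)} x\<bar> powr \<alpha>)
      = (\<Sum>j<N. ennreal (\<bar>b j\<bar> powr \<alpha>) * indicator {v j<..v (Suc j)} x)"
      unfolding pt .
  qed
  also have "\<dots> = (\<Sum>j<N. ennreal (\<bar>b j\<bar> powr \<alpha>) * emeasure lborel {v j<..v (Suc j)})"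
    by (subst nn_integral_sum) (auto simp: nn_integral_cmult_indicator)
  also have "\<dots> = (\<Sum>j<N. ennreal (\<bar>b j\<bar> powr \<alpha> * (v (Suc j) - v j)))"
  proof (intro sum.cong refl)
    fix j assume "j \<in> {..<N}"
    then have "v j \<le> v (Suc j)" using v[of j] by simp
    then show "ennreal (\<bar>b j\<bar> powr \<alpha>) * emeasure lborel {v j<..v (Suc j)} = ennreal (\<bar>b j\<bar> powr \<alpha> * (v (Suc j) - v j))"
      by (simp add: ennreal_mult')
  qed
  also have "\<dots> = ennreal (\<Sum>j<N. \<bar>b j\<bar> powr \<alpha> * (v (Suc j) - v j))"
    using mono by (intro sum_ennreal mult_nonneg_nonneg) auto
  finally show ?thesis .
qed

lemma finite_set_grid:
  fixes V :: "real set"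
  assumes "finite V" "2 \<le> card V"
  obtains N v where "0 < N" "\<And>i. i < N \<Longrightarrow> v i < v (Suc i)" "v ` {..N} = V"
proof -
  let ?l = "sorted_list_of_set V"
  have len: "length ?l = card V" "set ?l = V" using assms by auto
  show ?thesis
  proof (rule that[of "card V - 1" "\<lambda>i. ?l ! i"])
    show "0 < card V - 1" using assms by simp
    show "?l ! i < ?l ! Suc i" if "i < card V - 1" for i
      using that len sorted_wrt_nth_less[OF strict_sorted_list_of_set, of i "Suc i" V] by simp
    have "{..card V - 1} = {..<length ?l}" using assms len by auto
    then show "(\<lambda>i. ?l ! i) ` {..card V - 1} = V"
      using len by (metis atLeast_upt image_set map_nth)
  qed
qed

context riemann_liouville_process
begin

text \<open>
  Extended by zero to negative times, so that interpolation nodes to the left of the origin need no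
  special treatment.
\<close>

definition R0 :: "real \<Rightarrow> 'w \<Rightarrow> real" where
  "R0 t \<omega> = (if t \<le> 0 then 0 else R t \<omega>)"

definition kernel :: "real \<Rightarrow> real \<Rightarrow> real" where
  "kernel t s = (if 0 \<le> s \<and> s < t then (t - s) powr (H - 1 / \<alpha>) else 0)"

lemma measurable_R0: "R0 t \<in> borel_measurable M"
  using measurable_R[of t] by (cases "t \<le> 0") (auto simp: R0_def[abs_def])

lemma measurable_kernel: "kernel t \<in> borel_measurable borel"
  unfolding kernel_def by measurable

lemma measurable_step_function: "step_function n u c \<in> borel_measurable borel"
  unfolding step_function_def by measurable

text \<open>The data of \<open>has_stable_integral\<close> in a form common to all times: the error
  is taken over the whole line against the kernel extended by zero, so that approximations for
  different times can be combined linearly.\<close>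

definition step_approximates ::
    "real \<Rightarrow> (nat \<Rightarrow> nat) \<Rightarrow> (nat \<Rightarrow> nat \<Rightarrow> real) \<Rightarrow> (nat \<Rightarrow> nat \<Rightarrow> real) \<Rightarrow> bool" where
  "step_approximates t n u c \<longleftrightarrow> (\<forall>k. 0 \<le> u k 0 \<and> (\<forall>i<n k. u k i \<le> u k (Suc i))) \<and>
     (\<lambda>k. \<integral>\<^sup>+s. ennreal (\<bar>step_function (n k) (u k) (c k) s - kernel t s\<bar> powr \<alpha>) \<partial>lborel) \<longlonglongrightarrow> 0 \<and>
     (\<forall>\<delta>>0. (\<lambda>k. prob {\<omega> \<in> space M. \<delta> < \<bar>step_integral Z (n k) (u k) (c k) \<omega> - R0 t \<omega>\<bar>}) \<longlonglongrightarrow> 0)"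

lemma step_approximation_exists: "\<exists>n u c. step_approximates t n u c"
proof (cases "t \<le> 0")
  case True
  then have "kernel t s = 0" for s by (simp add: kernel_def)
  with True stability_index show ?thesis
    by (intro exI[of _ "\<lambda>_. 0"] exI[of _ "\<lambda>_ _. 0"])
      (auto simp: step_approximates_def step_function_def step_integral_def R0_def)
next
  case False
  then have t: "0 < t" by simp
  define P where "P n u c \<longleftrightarrow> (\<forall>k. 0 \<le> u k 0 \<and> (\<forall>i<n k. u k i \<le> u k (Suc i)) \<and> u k (n k) \<le> t) \<and>
    (\<lambda>k. \<integral>\<^sup>+s\<in>{0..t}. ennreal (\<bar>step_function (n k) (u k) (c k) s - (t - s) powr (H - 1 / \<alpha>)\<bar> powr \<alpha>) \<partial>lborel) \<longlonglongrightarrow> 0 \<and>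
    (\<forall>\<delta>>0. (\<lambda>k. prob {\<omega> \<in> space M. \<delta> < \<bar>step_integral Z (n k) (u k) (c k) \<omega> - R t \<omega>\<bar>}) \<longlonglongrightarrow> 0)"
    for n :: "nat \<Rightarrow> nat" and u c :: "nat \<Rightarrow> nat \<Rightarrow> real"
  have "\<exists>n u c. P n u c"
    using integral_R[OF t] unfolding has_stable_integral_def P_def by (rule conjunct2[THEN conjunct2])
  then obtain n where "\<exists>u c. P n u c" ..
  then obtain u where "\<exists>c. P n u c" ..
  then obtain c where P: "P n u c" ..
  have nuc1: "\<forall>k. 0 \<le> u k 0 \<and> (\<forall>i<n k. u k i \<le> u k (Suc i)) \<and> u k (n k) \<le> t"
    using P unfolding P_def by (rule conjunct1)
  have nuc2: "(\<lambda>k. \<integral>\<^sup>+s\<in>{0..t}. ennreal (\<bar>step_function (n k) (u k) (c k) s - (t - s) powr (H - 1 / \<alpha>)\<bar> powr \<alpha>) \<partial>lborel) \<longlonglongrightarrow> 0"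
    using P unfolding P_def by (elim conjE)
  have nuc3: "\<forall>\<delta>>0. (\<lambda>k. prob {\<omega> \<in> space M. \<delta> < \<bar>step_integral Z (n k) (u k) (c k) \<omega> - R t \<omega>\<bar>}) \<longlonglongrightarrow> 0"
    using P unfolding P_def by (elim conjE)
  have eq: "(\<integral>\<^sup>+s\<in>{0..t}. ennreal (\<bar>step_function (n k) (u k) (c k) s - (t - s) powr (H - 1 / \<alpha>)\<bar> powr \<alpha>) \<partial>lborel)
    = (\<integral>\<^sup>+s. ennreal (\<bar>step_function (n k) (u k) (c k) s - kernel t s\<bar> powr \<alpha>) \<partial>lborel)" for k
  proof (intro nn_integral_cong)
    fix s
    \<comment> \<open>All steps lie between \<open>u k 0 \<ge> 0\<close> and
      \<open>u k (n k) \<le> t\<close>, so extending the integral to the line adds nothing.\<close>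
    have "step_function (n k) (u k) (c k) s = 0" if "s \<notin> {0..t}"
      unfolding step_function_def
    proof (rule sum.neutral, rule ballI)
      fix i assume i: "i \<in> {..<n k}"
      have mono: "u k i' \<le> u k (Suc i')" if "i' < n k" for i' using nuc1 that by blast
      have "u k 0 \<le> u k i" "u k (Suc i) \<le> u k (n k)"
        by (rule chain_mono[of "n k" "u k", OF mono]; use i in simp)+
      then have "s \<notin> {u k i<..u k (Suc i)}" using nuc1[rule_format, of k] that by auto
      then show "c k i * indicator {u k i<..u k (Suc i)} s = 0" by simp
    qed
    \<comment> \<open>At \<open>s = t\<close> both sides vanish, since \<open>0 powr x = 0\<close>
      for every exponent.\<close>
    moreover have "kernel t s = (t - s) powr (H - 1 / \<alpha>)" if "s \<in> {0..t}"
      using that by (auto simp: kernel_def)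
    ultimately show "ennreal (\<bar>step_function (n k) (u k) (c k) s - (t - s) powr (H - 1 / \<alpha>)\<bar> powr \<alpha>) * indicator {0..t} s
      = ennreal (\<bar>step_function (n k) (u k) (c k) s - kernel t s\<bar> powr \<alpha>)"
      using stability_index by (cases "s \<in> {0..t}") (auto simp: kernel_def)
  qed
  from t have "R0 t = R t" by (auto simp: R0_def fun_eq_iff)
  show ?thesis
    unfolding step_approximates_def
  proof (rule exI[of _ n], rule exI[of _ u], rule exI[of _ c], intro conjI)
    show "\<forall>k. 0 \<le> u k 0 \<and> (\<forall>i<n k. u k i \<le> u k (Suc i))" using nuc1 by blast
    show "(\<lambda>k. \<integral>\<^sup>+s. ennreal (\<bar>step_function (n k) (u k) (c k) s - kernel t s\<bar> powr \<alpha>) \<partial>lborel) \<longlonglongrightarrow> 0"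
      using nuc2 by (simp only: eq)
    show "\<forall>\<delta>>0. (\<lambda>k. prob {\<omega> \<in> space M. \<delta> < \<bar>step_integral Z (n k) (u k) (c k) \<omega> - R0 t \<omega>\<bar>}) \<longlonglongrightarrow> 0"
      using nuc3 by (simp only: \<open>R0 t = R t\<close>)
  qed
qed

text \<open>The values of the process are replaced by step integrals on one common grid, and the
  approximation is then removed by convergence in probability. The constant is 18 = 9 * 2: the
  factor 9 from \<open>abs_sum_powr_le\<close> with two terms, and an approximation error of at most
  \<open>B a\<close> on top of \<open>B a\<close>. Doubling the tolerance leaves room for the error
  in probability.\<close>

lemma small_ball_functionals:
  fixes wt tm :: "'i \<Rightarrow> nat \<Rightarrow> real"
  assumes I: "finite I" "I \<noteq> {}"
    and B: "\<And>a. a \<in> I \<Longrightarrow> (\<integral>\<^sup>+x. ennreal (\<bar>\<Sum>l<q. wt a l * kernel (tm a l) x\<bar> powr \<alpha>) \<partial>lborel) \<le> ennreal (B a)"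
      "\<And>a. a \<in> I \<Longrightarrow> 0 < B a"
    and \<epsilon>: "\<And>a. a \<in> I \<Longrightarrow> 0 < \<epsilon> a"
    and \<eta>: "\<And>a. a \<in> I \<Longrightarrow> 0 < \<eta> a" "\<And>a. a \<in> I \<Longrightarrow> \<eta> a \<le> 1 / 2"
    and s: "\<And>a. a \<in> I \<Longrightarrow> 0 < s a" and C: "\<And>a. a \<in> I \<Longrightarrow> moment_const \<alpha> (s a) (C a)"
  shows "exp (- 2 * (\<Sum>a\<in>I. coding_cost \<alpha> (s a) (C a) (\<eta> a) (18 * B a) (\<epsilon> a))) / 4
    \<le> prob {\<omega>\<in>space M. \<forall>a\<in>I. \<bar>\<Sum>l<q. wt a l * R0 (tm a l) \<omega>\<bar> \<le> 2 * \<epsilon> a}"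
    (is "?p \<le> prob ?G")
proof -
  let ?int = "\<lambda>f. \<integral>\<^sup>+x. ennreal (\<bar>f x :: real\<bar> powr \<alpha>) \<partial>lborel"
  obtain n u c where nuc: "\<And>t. step_approximates t (n t) (u t) (c t)"
    using step_approximation_exists by metis
  note nuc = nuc[unfolded step_approximates_def]
  have u0: "0 \<le> u t k 0" and umono: "i < n t k \<Longrightarrow> u t k i \<le> u t k (Suc i)" for t k i
    using nuc[of t, THEN conjunct1] by blast+
  note L\<alpha> = nuc[THEN conjunct2, THEN conjunct1]
  note inprob = nuc[THEN conjunct2, THEN conjunct2, rule_format]
  define st where "st t k = step_function (n t k) (u t k) (c t k)" for t k
  define SI where "SI t k \<omega> = step_integral Z (n t k) (u t k) (c t k) \<omega>" for t k \<omega>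
  let ?Lst = "\<lambda>a k x. \<Sum>l<q. wt a l * st (tm a l) k x"
  let ?LS = "\<lambda>a k \<omega>. \<Sum>l<q. wt a l * SI (tm a l) k \<omega>"
  let ?LR = "\<lambda>a \<omega>. \<Sum>l<q. wt a l * R0 (tm a l) \<omega>"
  have stm [measurable]: "st t k \<in> borel_measurable borel" for t k
    unfolding st_def by (rule measurable_step_function)
  note [measurable] = measurable_kernel
  have "\<forall>\<^sub>F k in sequentially. ?int (?Lst a k) \<le> ennreal (18 * B a)"
    if a: "a \<in> I" for a
  proof -
    define K where "K = (real q + 1)\<^sup>2"
    define d where "d k = ennreal K * (\<Sum>l<q. ennreal (\<bar>wt a l\<bar> powr \<alpha>) * ?int (\<lambda>x. st (tm a l) k x - kernel (tm a l) x))" for k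
    have "d \<longlonglongrightarrow> ennreal K * (\<Sum>l<q. ennreal (\<bar>wt a l\<bar> powr \<alpha>) * 0)"
      unfolding d_def st_def
      by (intro tendsto_mult_ennreal tendsto_const tendsto_sum L\<alpha>) auto
    then have "d \<longlonglongrightarrow> 0" by simp
    then have "\<forall>\<^sub>F k in sequentially. d k < ennreal (B a)"
      using B(2)[OF a] by (intro order_tendstoD) auto
    then show ?thesis
    proof eventually_elim
      case (elim k)
      let ?g = "\<lambda>x. \<Sum>l<q. wt a l * kernel (tm a l) x" and ?gk = "?Lst a k"
      have "?int (\<lambda>x. ?gk x - ?g x)
        \<le> (\<integral>\<^sup>+x. ennreal K * (\<Sum>l<q. ennreal (\<bar>wt a l\<bar> powr \<alpha>) * ennreal (\<bar>st (tm a l) k x - kernel (tm a l) x\<bar> powr \<alpha>)) \<partial>lborel)"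
      proof (rule nn_integral_mono)
        fix x
        have "?gk x - ?g x = (\<Sum>l<q. wt a l * (st (tm a l) k x - kernel (tm a l) x))"
          by (simp add: right_diff_distrib sum_subtractf)
        also have "\<bar>\<dots>\<bar> powr \<alpha> \<le> K * (\<Sum>l<q. \<bar>wt a l\<bar> powr \<alpha> * \<bar>st (tm a l) k x - kernel (tm a l) x\<bar> powr \<alpha>)"
          using abs_sum_powr_le[OF stability_index, of "{..<q}" "\<lambda>l. wt a l * (st (tm a l) k x - kernel (tm a l) x)"]
          by (simp add: K_def abs_mult powr_mult)
        finally show "ennreal (\<bar>?gk x - ?g x\<bar> powr \<alpha>) \<le> ennreal K * (\<Sum>l<q. ennreal (\<bar>wt a l\<bar> powr \<alpha>) * ennreal (\<bar>st (tm a l) k x - kernel (tm a l) x\<bar> powr \<alpha>))"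
          by (simp add: K_def sum_nonneg ennreal_leI flip: ennreal_mult)
      qed
      also have "\<dots> = d k"
        unfolding d_def by (simp add: nn_integral_cmult nn_integral_sum)
      finally have diff: "?int (\<lambda>x. ?gk x - ?g x) \<le> ennreal (B a)"
        using elim by (auto intro: order_trans less_imp_le)
      have "?int ?gk
        \<le> (\<integral>\<^sup>+x. ennreal 9 * (ennreal (\<bar>?g x\<bar> powr \<alpha>) + ennreal (\<bar>?gk x - ?g x\<bar> powr \<alpha>)) \<partial>lborel)"
      proof (rule nn_integral_mono)
        fix x
        have "\<bar>?g x + (?gk x - ?g x)\<bar> powr \<alpha> \<le> 9 * (\<bar>?g x\<bar> powr \<alpha> + \<bar>?gk x - ?g x\<bar> powr \<alpha>)"
          using abs_sum_powr_le[OF stability_index, of "UNIV :: bool set" "\<lambda>b. if b then ?g x else ?gk x - ?g x"]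
          by (simp add: UNIV_bool add.commute)
        then show "ennreal (\<bar>?gk x\<bar> powr \<alpha>) \<le> ennreal 9 * (ennreal (\<bar>?g x\<bar> powr \<alpha>) + ennreal (\<bar>?gk x - ?g x\<bar> powr \<alpha>))"
          by (simp add: ennreal_leI flip: ennreal_mult ennreal_plus del: ennreal_numeral)
      qed
      also have "\<dots> = ennreal 9 * (?int ?g + ?int (\<lambda>x. ?gk x - ?g x))"
        by (simp add: nn_integral_cmult nn_integral_add)
      also have "\<dots> \<le> ennreal 9 * (ennreal (B a) + ennreal (B a))"
        by (intro mult_left_mono add_mono B(1)[OF a] diff) auto
      also have "\<dots> = ennreal (18 * B a)"
        using B(2)[OF a] by (simp flip: ennreal_mult ennreal_plus del: ennreal_numeral)
      finally show ?case .
    qed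
  qed
  then have ev: "\<forall>\<^sub>F k in sequentially. \<forall>a\<in>I. ?int (?Lst a k) \<le> ennreal (18 * B a)"
    using I(1) by (simp add: eventually_ball_finite)
  define T where "T = (\<lambda>(a, l). tm a l) ` (I \<times> {..<q})"
  have T: "finite T" "\<And>a l. a \<in> I \<Longrightarrow> l < q \<Longrightarrow> tm a l \<in> T" using I(1) by (auto simp: T_def)
  have step_bound: "?p \<le> prob {\<omega>\<in>space M. \<forall>a\<in>I. \<bar>?LS a k \<omega>\<bar> \<le> \<epsilon> a}"
    if k: "\<forall>a\<in>I. ?int (?Lst a k) \<le> ennreal (18 * B a)" for k
  proof -
    \<comment> \<open>The points 0 and 1 ensure that the grid has at least one cell.\<close>
    define V where "V = {0, 1} \<union> (\<Union>t\<in>T. u t k ` {..n t k})"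
    have finV: "finite V" using T(1) by (simp add: V_def)
    have "card {0, 1::real} \<le> card V" using finV by (intro card_mono) (auto simp: V_def)
    then have "2 \<le> card V" by simp
    with finV obtain N v where v: "0 < N" "\<And>i. i < N \<Longrightarrow> v i < v (Suc i)" "v ` {..N} = V"
      by (rule finite_set_grid) blast
    have V0: "0 \<le> y" if "y \<in> V" for y
    proof -
      have "0 \<le> u t k i" if "i \<le> n t k" for t i
        using chain_mono[of "n t k" "u t k" 0 i, OF umono] that u0[of t k] by simp
      with that show ?thesis by (auto simp: V_def)
    qed
    have uV: "u t k i \<in> v ` {..N}" if "t \<in> T" "i \<le> n t k" for t i using that unfolding v(3) V_def by blast
    define b where "b a j = (\<Sum>l<q. wt a l * cell_coeff (n (tm a l) k) (u (tm a l) k) (c (tm a l) k) (v j))" for a j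
    have grid: "(\<Sum>l<q. wt a l * f l) = (\<Sum>j<N. b a j * g j)"
      if "a \<in> I" and f: "\<And>l. tm a l \<in> T \<Longrightarrow> f l = (\<Sum>j<N. cell_coeff (n (tm a l) k) (u (tm a l) k) (c (tm a l) k) (v j) * g j)"
      for a f g
    proof -
      have "(\<Sum>l<q. wt a l * f l) = (\<Sum>l<q. \<Sum>j<N. wt a l *
        cell_coeff (n (tm a l) k) (u (tm a l) k) (c (tm a l) k) (v j) * g j)"
        by (intro sum.cong refl) (simp add: f T(2)[OF that(1)] sum_distrib_left mult.assoc)
      also have "\<dots> = (\<Sum>j<N. b a j * g j)"
        unfolding b_def sum_distrib_right by (rule sum.swap)
      finally show ?thesis .
    qed
    have SI: "?LS a k \<omega> = (\<Sum>j<N. b a j * (Z (v (Suc j)) \<omega> - Z (v j) \<omega>))" if "a \<in> I" for a \<omega>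
      using that unfolding SI_def by (rule grid) (rule step_integral_on_grid; use v(2) umono uV in blast)
    have st: "?Lst a k x = (\<Sum>j<N. b a j * indicator {v j<..v (Suc j)} x)" if "a \<in> I" for a x
      using that unfolding st_def by (rule grid) (rule step_function_on_grid; use v(2) umono uV in blast)
    have "?p \<le> prob {\<omega>\<in>space M. \<forall>a\<in>I. \<bar>\<Sum>j<N. b a j * (Z (v (Suc j)) \<omega> - Z (v j) \<omega>)\<bar> \<le> \<epsilon> a}"
    proof (rule small_ball_grid[OF _ _ v(1) I _ _ \<epsilon> \<eta> s C])
      show "0 \<le> v 0" using V0 v(3) by auto
      show "v j \<le> v (Suc j)" if "j < N" for j using v(2)[OF that] by simp
      show "0 < 18 * B a" if "a \<in> I" for a using B(2)[OF that] by simp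
      fix a assume a: "a \<in> I"
      have "?int (\<lambda>x. \<Sum>j<N. b a j * indicator {v j<..v (Suc j)} x)
        = ennreal (\<Sum>j<N. \<bar>b a j\<bar> powr \<alpha> * (v (Suc j) - v j))"
        by (rule nn_integral_grid_step) (use v(2) stability_index in auto)
      then have "ennreal (\<Sum>j<N. \<bar>b a j\<bar> powr \<alpha> * (v (Suc j) - v j)) \<le> ennreal (18 * B a)"
        using k[rule_format, OF a] unfolding st[OF a] by simp
      then show "(\<Sum>j<N. \<bar>b a j\<bar> powr \<alpha> * (v (Suc j) - v j)) \<le> 18 * B a"
        using B(2)[OF a] by (simp add: ennreal_le_iff)
    qed auto
    also have "{\<omega>\<in>space M. \<forall>a\<in>I. \<bar>\<Sum>j<N. b a j * (Z (v (Suc j)) \<omega> - Z (v j) \<omega>)\<bar> \<le> \<epsilon> a}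
      = {\<omega>\<in>space M. \<forall>a\<in>I. \<bar>?LS a k \<omega>\<bar> \<le> \<epsilon> a}"
      by (auto simp: SI)
    finally show ?thesis .
  qed
  have SIm [measurable]: "SI t k \<in> borel_measurable M" for t k
  proof -
    have "0 \<le> u t k i" if "i \<le> n t k" for i
      using chain_mono[of "n t k" "u t k" 0 i, OF umono] that u0[of t k] by simp
    then show ?thesis unfolding SI_def step_integral_def
      by (intro borel_measurable_sum borel_measurable_times borel_measurable_const measurable_increment) auto
  qed
  note [measurable] = measurable_R0
  \<comment> \<open>An error of \<delta> at every time moves each functional by at most its own
    \<open>\<epsilon> a\<close>; the summand 1 keeps the denominator positive.\<close>
  define \<delta> where "\<delta> = Min ((\<lambda>a. \<epsilon> a / (1 + (\<Sum>l<q. \<bar>wt a l\<bar>))) ` I)"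
  have pos: "0 < 1 + (\<Sum>l<q. \<bar>wt a l\<bar>)" for a by (simp add: add_pos_nonneg sum_nonneg)
  have \<delta>: "0 < \<delta>" unfolding \<delta>_def using I \<epsilon> pos by (subst Min_gr_iff) auto
  have \<delta>\<epsilon>: "(\<Sum>l<q. \<bar>wt a l\<bar>) * \<delta> \<le> \<epsilon> a" if "a \<in> I" for a
  proof -
    have "\<delta> \<le> \<epsilon> a / (1 + (\<Sum>l<q. \<bar>wt a l\<bar>))" unfolding \<delta>_def using I that by (intro Min_le) auto
    then have "\<delta> * (1 + (\<Sum>l<q. \<bar>wt a l\<bar>)) \<le> \<epsilon> a" using pos[of a] by (simp add: pos_le_divide_eq)
    then show ?thesis using \<delta> by (simp add: algebra_simps)
  qed
  define E where "E t k = {\<omega> \<in> space M. \<delta> < \<bar>SI t k \<omega> - R0 t \<omega>\<bar>}" for t k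
  have Em: "E t k \<in> events" for t k unfolding E_def by measurable
  have Gm: "?G \<in> events" using I(1) by measurable
  have "?p \<le> prob ?G + (\<Sum>t\<in>T. prob (E t k))"
    if k: "\<forall>a\<in>I. ?int (?Lst a k) \<le> ennreal (18 * B a)" for k
  proof -
    let ?A = "{\<omega>\<in>space M. \<forall>a\<in>I. \<bar>?LS a k \<omega>\<bar> \<le> \<epsilon> a}"
    have "?A \<subseteq> ?G \<union> (\<Union>t\<in>T. E t k)"
    proof
      fix \<omega> assume \<omega>: "\<omega> \<in> ?A"
      show "\<omega> \<in> ?G \<union> (\<Union>t\<in>T. E t k)"
      proof (cases "\<omega> \<in> (\<Union>t\<in>T. E t k)")
        case False
        then have close: "\<bar>SI t k \<omega> - R0 t \<omega>\<bar> \<le> \<delta>" if "t \<in> T" for t using \<omega> that by (auto simp: E_def not_less)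
        have "\<bar>?LR a \<omega>\<bar> \<le> 2 * \<epsilon> a" if a: "a \<in> I" for a
        proof -
          have "?LR a \<omega>
            = ?LS a k \<omega> - (\<Sum>l<q. wt a l * (SI (tm a l) k \<omega> - R0 (tm a l) \<omega>))"
            by (simp add: right_diff_distrib sum_subtractf)
          moreover have "\<bar>\<Sum>l<q. wt a l * (SI (tm a l) k \<omega> - R0 (tm a l) \<omega>)\<bar> \<le> (\<Sum>l<q. \<bar>wt a l\<bar> * \<delta>)"
            using close T(2)[OF a]
            by (intro order_trans[OF sum_abs] sum_mono) (auto simp: abs_mult intro!: mult_left_mono)
          moreover have "(\<Sum>l<q. \<bar>wt a l\<bar> * \<delta>) \<le> \<epsilon> a" using \<delta>\<epsilon>[OF a] by (simp add: sum_distrib_right)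
          moreover have "\<bar>?LS a k \<omega>\<bar> \<le> \<epsilon> a" using \<omega> a by auto
          ultimately show ?thesis by linarith
        qed
        then show ?thesis using \<omega> by auto
      qed auto
    qed
    moreover have UE: "(\<Union>t\<in>T. E t k) \<in> events" using T(1) Em by (rule sets.finite_UN)
    ultimately have "prob ?A \<le> prob (?G \<union> (\<Union>t\<in>T. E t k))"
      by (intro finite_measure_mono sets.Un Gm)
    also have "\<dots> \<le> prob ?G + prob (\<Union>t\<in>T. E t k)"
      using Gm UE by (rule measure_Un_le)
    also have "prob (\<Union>t\<in>T. E t k) \<le> (\<Sum>t\<in>T. prob (E t k))"
      using T(1) Em by (rule measure_UNION_le)
    finally show ?thesis using step_bound[OF k] by linarith
  qed
  with ev have "\<forall>\<^sub>F k in sequentially. ?p \<le> prob ?G + (\<Sum>t\<in>T. prob (E t k))"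
    by (rule eventually_mono) blast
  \<comment> \<open>The lower bound does not depend on \<open>k\<close>, while the finitely many
    exceptional probabilities tend to 0.\<close>
  moreover have "(\<lambda>k. prob ?G + (\<Sum>t\<in>T. prob (E t k))) \<longlonglongrightarrow> prob ?G + (\<Sum>t\<in>T. 0)"
    unfolding E_def SI_def using inprob[OF \<delta>] by (intro tendsto_add tendsto_const tendsto_sum)
  ultimately show ?thesis
    using tendsto_lowerbound[of "\<lambda>k. prob ?G + (\<Sum>t\<in>T. prob (E t k))" "prob ?G" sequentially ?p] by simp
qed

end

section \<open>Interpolation errors of the fractional kernel\<close>

definition pospow :: "real \<Rightarrow> real \<Rightarrow> real" where
  "pospow a x = (if 0 < x then x powr a else 0)"

lemma measurable_pospow [measurable]: "pospow a \<in> borel_measurable borel"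
  unfolding pospow_def by measurable

lemma pospow_nonneg: "0 \<le> pospow a x"
  by (simp add: pospow_def)

lemma pospow_scale: "0 < c \<Longrightarrow> pospow a (c * x) = c powr a * pospow a x"
  by (simp add: pospow_def powr_mult zero_less_mult_iff)

lemma nn_integral_powr_near_0:
  assumes "- 1 < b"
  shows "(\<integral>\<^sup>+x. ennreal (x powr b) * indicator {0<..c} x \<partial>lborel) < \<infinity>"
proof (cases "0 \<le> c")
  case True
  have "(\<integral>\<^sup>+x. ennreal (x powr b) * indicator {0<..c} x \<partial>lborel)
    \<le> (\<integral>\<^sup>+x. ennreal (indicator {0..c} x * x powr b) \<partial>lborel)"
    by (intro nn_integral_mono) (auto split: split_indicator)
  also have "\<dots> = ennreal (c powr (b + 1) / (b + 1))"
    by (rule nn_integral_has_integral_lebesgue[OF _ has_integral_powr_from_0]) (use assms True in auto)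
  finally show ?thesis by (auto simp: ennreal_less_top le_less_trans top.not_eq_extremum)
qed simp

lemma nn_integral_powr_tail:
  assumes "b < - 1" "0 < c"
  shows "(\<integral>\<^sup>+x. ennreal (x powr b) * indicator {c..} x \<partial>lborel) < \<infinity>"
proof -
  have "(\<integral>\<^sup>+x. ennreal (x powr b) * indicator {c..} x \<partial>lborel)
    = (\<integral>\<^sup>+x. ennreal (indicator {c..} x * x powr b) \<partial>lborel)"
    by (intro nn_integral_cong) (auto split: split_indicator)
  also have "\<dots> = ennreal (- (c powr (b + 1)) / (b + 1))"
    by (rule nn_integral_has_integral_lebesgue[OF _ has_integral_powr_to_inf]) (use assms in auto)
  finally show ?thesis by simp
qed

definition powr_deriv :: "real \<Rightarrow> nat \<Rightarrow> real \<Rightarrow> real" where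
  "powr_deriv a i x = (\<Prod>k<i. a - real k) * x powr (a - real i)"

lemma has_derivative_powr_deriv:
  assumes "0 < x"
  shows "(powr_deriv a i has_real_derivative powr_deriv a (Suc i) x) (at x)"
proof -
  have "((\<lambda>x. (\<Prod>k<i. a - real k) * x powr (a - real i)) has_real_derivative
      (\<Prod>k<i. a - real k) * ((a - real i) * x powr (a - real i - 1))) (at x)"
    using assms by (intro DERIV_cmult has_real_derivative_powr) auto
  then show ?thesis by (simp add: powr_deriv_def[abs_def] mult_ac diff_diff_eq add.commute)
qed

text \<open>The condition \<open>2 * \<bar>\<tau>\<bar> \<le> u\<close> keeps the intermediate point
  of the Lagrange remainder above \<open>u / 2\<close>, where the power of negative exponent
  \<open>a - m\<close> is at most its value at \<open>u / 2\<close>.\<close>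

lemma powr_taylor_bound:
  assumes m: "0 < m" "a < real m" and u: "0 < u" "2 * \<bar>\<tau>\<bar> \<le> u"
  shows "\<bar>(u + \<tau>) powr a - (\<Sum>i<m. powr_deriv a i u / fact i * \<tau> ^ i)\<bar>
    \<le> \<bar>\<Prod>k<m. a - real k\<bar> / fact m * \<bar>\<tau>\<bar> ^ m * 2 powr (real m - a) * u powr (a - real m)"
proof (cases "\<tau> = 0")
  case True
  have "(\<Sum>i<m. powr_deriv a i u / fact i * 0 ^ i) = (\<Sum>i<m. if i = 0 then u powr a else 0)"
    by (intro sum.cong) (auto simp: powr_deriv_def)
  then show ?thesis using True m by simp
next
  case False
  have "\<exists>t. (if u + \<tau> < u then u + \<tau> < t \<and> t < u else u < t \<and> t < u + \<tau>) \<and>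
    (u + \<tau>) powr a = (\<Sum>i<m. powr_deriv a i u / fact i * (u + \<tau> - u) ^ i) + powr_deriv a m t / fact m * (u + \<tau> - u) ^ m"
  proof (rule Taylor[OF m(1), where a = "u / 2" and b = "3 * u / 2" and f = "\<lambda>x. x powr a"])
    show "powr_deriv a 0 = (\<lambda>x. x powr a)" by (simp add: powr_deriv_def fun_eq_iff)
    show "\<forall>k t. k < m \<and> u / 2 \<le> t \<and> t \<le> 3 * u / 2 \<longrightarrow> (powr_deriv a k has_real_derivative powr_deriv a (Suc k) t) (at t)"
      using u by (auto intro!: has_derivative_powr_deriv)
  qed (use u False in auto)
  then obtain t where t0: "if u + \<tau> < u then u + \<tau> < t \<and> t < u else u < t \<and> t < u + \<tau>"
    and t1: "(u + \<tau>) powr a = (\<Sum>i<m. powr_deriv a i u / fact i * (u + \<tau> - u) ^ i) + powr_deriv a m t / fact m * (u + \<tau> - u) ^ m"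
    by blast
  have t: "u / 2 \<le> t"
    "(u + \<tau>) powr a = (\<Sum>i<m. powr_deriv a i u / fact i * \<tau> ^ i) + powr_deriv a m t / fact m * \<tau> ^ m"
    using t0 t1 u by (auto split: if_splits)
  have "t powr (a - real m) \<le> (u / 2) powr (a - real m)"
    using t(1) u m by (intro powr_mono2') auto
  also have "\<dots> = 2 powr (real m - a) * u powr (a - real m)"
    using u powr_minus_divide[of 2 "a - real m"] by (simp add: powr_divide)
  finally have 1: "t powr (a - real m) \<le> 2 powr (real m - a) * u powr (a - real m)" .
  have "\<bar>powr_deriv a m t / fact m * \<tau> ^ m\<bar> = \<bar>\<Prod>k<m. a - real k\<bar> / fact m * \<bar>\<tau>\<bar> ^ m * t powr (a - real m)"
    by (simp add: powr_deriv_def abs_mult power_abs)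
  also have "\<dots> \<le> \<bar>\<Prod>k<m. a - real k\<bar> / fact m * \<bar>\<tau>\<bar> ^ m * (2 powr (real m - a) * u powr (a - real m))"
    by (intro mult_left_mono 1) auto
  finally show ?thesis using t(2) by (simp add: mult.assoc)
qed

text \<open>The interpolation error at \<open>y\<close> of the truncated power shifted by
  \<open>u\<close>. Apart from the cut at time 0, every interpolation error of the kernel in its
  time variable is a translated and rescaled copy of it.\<close>

definition fractional_error :: "real \<Rightarrow> nat \<Rightarrow> real \<Rightarrow> real \<Rightarrow> real" where
  "fractional_error a m y u = pospow a (y + u) - (\<Sum>k<m. pospow a (real k + u) * lagrange m k y)"

lemma measurable_fractional_error [measurable]: "fractional_error a m y \<in> borel_measurable borel"
  unfolding fractional_error_def by measurable

text \<open>Interpolation is exact on the Taylor polynomial of degree below \<open>m\<close> at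
  \<open>u\<close>, so only remainders survive, and these gain \<open>m\<close> powers of
  \<open>u\<close>. The threshold on \<open>u\<close> brings \<open>y\<close> and all nodes within
  the reach of \<open>powr_taylor_bound\<close>.\<close>

lemma fractional_error_tail:
  assumes m: "0 < m" "a < real m"
  shows "\<exists>K\<ge>0. \<forall>u\<ge>2 * (real m + \<bar>y\<bar>) + 1. \<bar>fractional_error a m y u\<bar> \<le> K * u powr (a - real m)"
proof -
  define D where "D \<tau> = \<bar>\<Prod>k<m. a - real k\<bar> / fact m * \<bar>\<tau>\<bar> ^ m * 2 powr (real m - a)" for \<tau>
  have D0: "0 \<le> D \<tau>" for \<tau> by (simp add: D_def)
  define K where "K = D y + (\<Sum>k<m. D (real k) * \<bar>lagrange m k y\<bar>)"
  have "\<bar>fractional_error a m y u\<bar> \<le> K * u powr (a - real m)" if u: "2 * (real m + \<bar>y\<bar>) + 1 \<le> u" for u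
  proof -
    have "0 \<le> 2 * (real m + \<bar>y\<bar>)" by simp
    then have u0: "0 < u" using u by linarith
    define p where "p = (\<Sum>i<m. monom (powr_deriv a i u / fact i) i)"
    have p: "poly p \<tau> = (\<Sum>i<m. powr_deriv a i u / fact i * \<tau> ^ i)" for \<tau>
      by (simp add: p_def poly_sum poly_monom)
    have "degree p \<le> m - 1" unfolding p_def
      by (rule degree_sum_le) (auto intro!: order_trans[OF degree_monom_le])
    then have "degree p < m" using m by linarith
    from lagrange_reproduce[OF this] have rep: "(\<Sum>k<m. poly p (real k) * lagrange m k y) = poly p y" .
    have rem: "\<bar>pospow a (\<tau> + u) - poly p \<tau>\<bar> \<le> D \<tau> * u powr (a - real m)" if "2 * \<bar>\<tau>\<bar> < u" for \<tau>
    proof -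
      have "0 < \<tau> + u" using that by linarith
      then show ?thesis
        using powr_taylor_bound[OF m u0, of \<tau>] that by (simp add: pospow_def p D_def add.commute)
    qed
    have "fractional_error a m y u = (pospow a (y + u) - poly p y)
       - (\<Sum>k<m. (pospow a (real k + u) - poly p (real k)) * lagrange m k y)"
      by (simp add: fractional_error_def left_diff_distrib sum_subtractf rep)
    also have "\<bar>\<dots>\<bar> \<le> \<bar>pospow a (y + u) - poly p y\<bar> + (\<Sum>k<m. \<bar>(pospow a (real k + u) - poly p (real k)) * lagrange m k y\<bar>)"
      by (intro order_trans[OF abs_triangle_ineq4] add_left_mono sum_abs)
    also have "\<dots> \<le> D y * u powr (a - real m) + (\<Sum>k<m. D (real k) * u powr (a - real m) * \<bar>lagrange m k y\<bar>)"
      unfolding abs_mult using u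
      by (intro add_mono rem sum_mono mult_right_mono) auto
    also have "\<dots> = K * u powr (a - real m)"
      by (simp add: K_def distrib_left sum_distrib_left mult_ac)
    finally show ?thesis .
  qed
  moreover have "0 \<le> K" unfolding K_def by (intro add_nonneg_nonneg sum_nonneg mult_nonneg_nonneg D0) auto
  ultimately show ?thesis by auto
qed

lemma nn_integral_pospow_shift:
  assumes "- 1 < a * \<alpha>"
  shows "(\<integral>\<^sup>+u. ennreal (pospow a (\<tau> + u) powr \<alpha>) * indicator {..T} u \<partial>lborel) < \<infinity>"
proof -
  have "(\<integral>\<^sup>+x. ennreal (x powr (a * \<alpha>)) * indicator {0<..\<tau> + T} x \<partial>lborel)
    = ennreal \<bar>1\<bar> * (\<integral>\<^sup>+u. ennreal ((\<tau> + 1 * u) powr (a * \<alpha>)) * indicator {0<..\<tau> + T} (\<tau> + 1 * u) \<partial>lborel)"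
    by (rule nn_integral_real_affine) auto
  also have "\<dots> = (\<integral>\<^sup>+u. ennreal (pospow a (\<tau> + u) powr \<alpha>) * indicator {..T} u \<partial>lborel)"
    by (simp, intro nn_integral_cong) (auto simp: pospow_def powr_powr split: split_indicator)
  finally show ?thesis using nn_integral_powr_near_0[OF assms, of "\<tau> + T"] by simp
qed

text \<open>Raised to the power \<alpha>, the singularities have exponent
  \<open>H * \<alpha> - 1 > - 1\<close> and the tail has exponent
  \<open>(H - m) * \<alpha> - 1 < - 1\<close>. Positivity of \<open>H\<close> settles the former,
  \<open>H < m\<close> the latter.\<close>

lemma fractional_error_integrable:
  assumes \<alpha>: "0 < \<alpha>" "\<alpha> \<le> 2" and H: "0 < H" "H < real m"
  shows "(\<integral>\<^sup>+u. ennreal (\<bar>fractional_error (H - 1 / \<alpha>) m y u\<bar> powr \<alpha>) \<partial>lborel) < \<infinity>"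
proof -
  let ?a = "H - 1 / \<alpha>" and ?T = "2 * (real m + \<bar>y\<bar>) + 1"
  have m: "0 < m" "?a < real m" using H \<alpha> by (auto intro!: Nat.gr0I simp: less_diff_eq intro: less_trans) (smt (verit) divide_pos_pos)
  have a\<alpha>: "?a * \<alpha> = H * \<alpha> - 1" using \<alpha> by (simp add: left_diff_distrib)
  have near: "- 1 < ?a * \<alpha>" unfolding a\<alpha> using H \<alpha> by simp
  have far: "(?a - real m) * \<alpha> < - 1"
    using H \<alpha> mult_strict_right_mono[of H "real m" \<alpha>] by (simp add: left_diff_distrib a\<alpha>[simplified left_diff_distrib])
  obtain K where K: "0 \<le> K" "\<forall>u\<ge>?T. \<bar>fractional_error ?a m y u\<bar> \<le> K * u powr (?a - real m)"
    using fractional_error_tail[OF m, of y] by blast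
  \<comment> \<open>The evaluation point \<open>y\<close> is treated as one more shift, with index
    \<open>m\<close> and weight 1.\<close>
  define w where "w l = (if l < m then - lagrange m l y else 1)" for l
  define \<tau> where "\<tau> l = (if l < m then real l else y)" for l
  have fe: "fractional_error ?a m y u = (\<Sum>l<Suc m. w l * pospow ?a (\<tau> l + u))" for u
    by (simp add: fractional_error_def w_def \<tau>_def sum_negf mult.commute)
  define c where "c = (real (Suc m) + 1)\<^sup>2"
  have pt: "ennreal (\<bar>fractional_error ?a m y u\<bar> powr \<alpha>)
    \<le> ennreal c * (\<Sum>l<Suc m. ennreal (\<bar>w l\<bar> powr \<alpha>) * (ennreal (pospow ?a (\<tau> l + u) powr \<alpha>) * indicator {..?T} u))
      + ennreal (K powr \<alpha>) * (ennreal (u powr ((?a - real m) * \<alpha>)) * indicator {?T..} u)" for u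
  proof (cases "u < ?T")
    case True
    have "\<bar>fractional_error ?a m y u\<bar> powr \<alpha> \<le> c * (\<Sum>l<Suc m. \<bar>w l\<bar> powr \<alpha> * pospow ?a (\<tau> l + u) powr \<alpha>)"
      unfolding fe c_def
      using abs_sum_powr_le[OF \<alpha>, of "{..<Suc m}" "\<lambda>l. w l * pospow ?a (\<tau> l + u)"]
      by (simp add: abs_mult powr_mult pospow_nonneg del: sum.lessThan_Suc)
    then have "ennreal (\<bar>fractional_error ?a m y u\<bar> powr \<alpha>)
      \<le> ennreal c * (\<Sum>l<Suc m. ennreal (\<bar>w l\<bar> powr \<alpha>) * ennreal (pospow ?a (\<tau> l + u) powr \<alpha>))"
      by (simp add: c_def sum_nonneg ennreal_leI flip: ennreal_mult del: sum.lessThan_Suc)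
    then show ?thesis using True by simp
  next
    case False
    then have u: "0 < u" "?T \<le> u" by auto
    have "\<bar>fractional_error ?a m y u\<bar> powr \<alpha> \<le> (K * u powr (?a - real m)) powr \<alpha>"
      using K(2) u \<alpha> by (intro powr_mono2) auto
    also have "\<dots> = K powr \<alpha> * u powr ((?a - real m) * \<alpha>)" using K(1) by (simp add: powr_mult powr_powr)
    finally have "ennreal (\<bar>fractional_error ?a m y u\<bar> powr \<alpha>) \<le> ennreal (K powr \<alpha>) * ennreal (u powr ((?a - real m) * \<alpha>))"
      by (simp add: ennreal_leI flip: ennreal_mult)
    then show ?thesis using u by (simp add: add_increasing)
  qed
  have "(\<integral>\<^sup>+u. ennreal (\<bar>fractional_error ?a m y u\<bar> powr \<alpha>) \<partial>lborel)
    \<le> (\<integral>\<^sup>+u. (ennreal c * (\<Sum>l<Suc m. ennreal (\<bar>w l\<bar> powr \<alpha>) * (ennreal (pospow ?a (\<tau> l + u) powr \<alpha>) * indicator {..?T} u))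
      + ennreal (K powr \<alpha>) * (ennreal (u powr ((?a - real m) * \<alpha>)) * indicator {?T..} u)) \<partial>lborel)"
    by (intro nn_integral_mono pt)
  also have "\<dots> = ennreal c * (\<Sum>l<Suc m. ennreal (\<bar>w l\<bar> powr \<alpha>) * (\<integral>\<^sup>+u. ennreal (pospow ?a (\<tau> l + u) powr \<alpha>) * indicator {..?T} u \<partial>lborel))
      + ennreal (K powr \<alpha>) * (\<integral>\<^sup>+u. ennreal (u powr ((?a - real m) * \<alpha>)) * indicator {?T..} u \<partial>lborel)"
    by (simp add: nn_integral_add nn_integral_cmult nn_integral_sum del: sum.lessThan_Suc)
  also have "\<dots> < \<infinity>"
  proof -
    have 1: "(\<integral>\<^sup>+u. ennreal (pospow ?a (\<tau> l + u) powr \<alpha>) * indicator {..?T} u \<partial>lborel) < top" for l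
      using nn_integral_pospow_shift[OF near] by simp
    have 2: "(\<integral>\<^sup>+u. ennreal (u powr ((?a - real m) * \<alpha>)) * indicator {?T..} u \<partial>lborel) < top"
      using nn_integral_powr_tail[OF far, of ?T] by simp
    have "(\<Sum>l<Suc m. ennreal (\<bar>w l\<bar> powr \<alpha>) * (\<integral>\<^sup>+u. ennreal (pospow ?a (\<tau> l + u) powr \<alpha>) * indicator {..?T} u \<partial>lborel)) < top"
      using 1 by (auto simp: ennreal_mult_less_top simp del: sum.lessThan_Suc)
    with 2 show ?thesis by (simp add: ennreal_mult_less_top del: sum.lessThan_Suc)
  qed
  finally show ?thesis .
qed

context riemann_liouville_process
begin

lemma kernel_pospow: "kernel t s = indicator {0..} s * pospow (H - 1 / \<alpha>) (t - s)"
  by (auto simp: kernel_def pospow_def split: split_indicator)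

lemma interp_error_functional:
  "interp_error m j f (int n) y =
    (\<Sum>l<Suc m. (if l < m then - lagrange m l y else 1) * f ((real n + (if l < m then real l else y)) / 2 ^ j))"
  by (simp add: interp_error_def interp_def sum_negf mult.commute)

text \<open>The substitution \<open>x = (n - u) / 2 ^ j\<close> reduces every position to
  \<open>fractional_error\<close>. Dropping the restriction to \<open>x \<ge> 0\<close> beforehand
  makes the bound uniform in \<open>n\<close>.\<close>

lemma interp_error_kernel_bound:
  assumes m: "H < real m"
  shows "\<exists>B>0. \<forall>j n. (\<integral>\<^sup>+x. ennreal (\<bar>interp_error m j (\<lambda>t. kernel t x) (int n) y\<bar> powr \<alpha>) \<partial>lborel)
     \<le> ennreal (B * 2 powr (- real j * (H * \<alpha>)))"
proof -
  let ?a = "H - 1 / \<alpha>"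
  let ?J = "\<integral>\<^sup>+u. ennreal (\<bar>fractional_error ?a m y u\<bar> powr \<alpha>) \<partial>lborel"
  have fin: "?J < top" using fractional_error_integrable[OF stability_index hurst_pos m, of y] by simp
  define B where "B = enn2real ?J + 1"
  have JB: "?J \<le> ennreal B" using fin unfolding B_def by (cases ?J) (auto simp flip: ennreal_plus ennreal_1)
  have B: "0 < B" unfolding B_def by (simp add: add_nonneg_pos)
  have "(\<integral>\<^sup>+x. ennreal (\<bar>interp_error m j (\<lambda>t. kernel t x) (int n) y\<bar> powr \<alpha>) \<partial>lborel)
     \<le> ennreal (B * 2 powr (- real j * (H * \<alpha>)))" for j n
  proof -
    define h where "h = inverse (2 ^ j :: real)"
    have h: "0 < h" by (simp add: h_def)
    let ?g = "\<lambda>x. \<bar>pospow ?a ((real n + y) * h - x) - (\<Sum>k<m. pospow ?a ((real n + real k) * h - x) * lagrange m k y)\<bar> powr \<alpha>"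
    have "(\<integral>\<^sup>+x. ennreal (\<bar>interp_error m j (\<lambda>t. kernel t x) (int n) y\<bar> powr \<alpha>) \<partial>lborel)
      \<le> (\<integral>\<^sup>+x. ennreal (?g x) \<partial>lborel)"
    proof (intro nn_integral_mono ennreal_leI)
      fix x
      have "interp_error m j (\<lambda>t. kernel t x) (int n) y = indicator {0..} x *
        (pospow ?a ((real n + y) * h - x) - (\<Sum>k<m. pospow ?a ((real n + real k) * h - x) * lagrange m k y))"
        by (simp add: interp_error_def interp_def kernel_pospow h_def divide_inverse right_diff_distrib sum_distrib_left mult.assoc)
      then show "\<bar>interp_error m j (\<lambda>t. kernel t x) (int n) y\<bar> powr \<alpha> \<le> ?g x"
        by (simp split: split_indicator)
    qed
    also have "\<dots> = ennreal \<bar>- h\<bar> * (\<integral>\<^sup>+u. ennreal (?g (real n * h + (- h) * u)) \<partial>lborel)"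
      using h by (intro nn_integral_real_affine) auto
    also have "(\<integral>\<^sup>+u. ennreal (?g (real n * h + (- h) * u)) \<partial>lborel)
      = (\<integral>\<^sup>+u. ennreal (h powr (?a * \<alpha>)) * ennreal (\<bar>fractional_error ?a m y u\<bar> powr \<alpha>) \<partial>lborel)"
    proof (intro nn_integral_cong)
      fix u
      have arg: "(real n + \<tau>) * h - (real n * h + (- h) * u) = h * (\<tau> + u)" for \<tau> by (simp add: algebra_simps)
      have "pospow ?a ((real n + y) * h - (real n * h + (- h) * u))
         - (\<Sum>k<m. pospow ?a ((real n + real k) * h - (real n * h + (- h) * u)) * lagrange m k y)
        = h powr ?a * fractional_error ?a m y u"
        unfolding arg pospow_scale[OF h] fractional_error_def by (simp add: right_diff_distrib sum_distrib_left mult.assoc)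
      then show "ennreal (?g (real n * h + (- h) * u))
        = ennreal (h powr (?a * \<alpha>)) * ennreal (\<bar>fractional_error ?a m y u\<bar> powr \<alpha>)"
        by (simp add: abs_mult powr_mult powr_powr ennreal_mult')
    qed
    also have "\<dots> = ennreal (h powr (?a * \<alpha>)) * ?J" by (rule nn_integral_cmult) measurable
    also have "ennreal \<bar>- h\<bar> * (ennreal (h powr (?a * \<alpha>)) * ?J) \<le> ennreal h * (ennreal (h powr (?a * \<alpha>)) * ennreal B)"
      using h JB by (intro mult_mono) auto
    also have "\<dots> = ennreal (B * (h * h powr (?a * \<alpha>)))"
      using h B by (simp add: mult_ac flip: ennreal_mult)
    also have "h * h powr (?a * \<alpha>) = 2 powr (- real j * (H * \<alpha>))"
    proof -
      have hp: "h = 2 powr (- real j)" by (simp add: h_def powr_minus powr_realpow)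
      \<comment> \<open>The 1 is the contribution of the Jacobian \<open>h\<close> of the
        substitution.\<close>
      have e: "1 + ?a * \<alpha> = H * \<alpha>" using stability_index by (simp add: left_diff_distrib)
      have "h * h powr (?a * \<alpha>) = h powr (1 + ?a * \<alpha>)" using h by (simp add: powr_add)
      also have "\<dots> = (2 powr (- real j)) powr (H * \<alpha>)" unfolding e hp ..
      also have "\<dots> = 2 powr (- real j * (H * \<alpha>))" by (rule powr_powr)
      finally show ?thesis .
    qed
    finally show ?thesis .
  qed
  with B show ?thesis by blast
qed

lemma kernel_bound: "\<exists>B>0. (\<integral>\<^sup>+x. ennreal (\<bar>kernel t x\<bar> powr \<alpha>) \<partial>lborel) \<le> ennreal B"
proof -
  let ?a = "H - 1 / \<alpha>"
  let ?J = "\<integral>\<^sup>+x. ennreal (\<bar>kernel t x\<bar> powr \<alpha>) \<partial>lborel"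
  have near: "- 1 < ?a * \<alpha>" using hurst_pos stability_index by (simp add: left_diff_distrib)
  have "?J \<le> (\<integral>\<^sup>+x. ennreal (pospow ?a (t - x) powr \<alpha>) * indicator {0..} x \<partial>lborel)"
    by (intro nn_integral_mono) (auto simp: kernel_pospow pospow_nonneg split: split_indicator)
  also have "\<dots> = ennreal \<bar>-1\<bar> * (\<integral>\<^sup>+u. ennreal (pospow ?a (t - (0 + (-1) * u)) powr \<alpha>) * indicator {0..} (0 + (-1) * u) \<partial>lborel)"
    by (rule nn_integral_real_affine) auto
  also have "\<dots> = (\<integral>\<^sup>+u. ennreal (pospow ?a (t + u) powr \<alpha>) * indicator {..0} u \<partial>lborel)"
    by (simp, intro nn_integral_cong) (auto split: split_indicator)
  also have "\<dots> < \<infinity>" by (rule nn_integral_pospow_shift[OF near])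
  finally have "?J < top" by simp
  then have "?J \<le> ennreal (enn2real ?J + 1)" by (cases ?J) (auto simp flip: ennreal_plus ennreal_1)
  moreover have "0 < enn2real ?J + 1" by (simp add: add_nonneg_pos)
  ultimately show ?thesis by blast
qed

end

section \<open>Summation over the levels\<close>

lemma sum_reindex_le_suminf:
  fixes g :: "nat \<Rightarrow> real"
  assumes "summable g" "\<And>i. 0 \<le> g i" "finite A" "inj_on h A"
  shows "(\<Sum>j\<in>A. g (h j)) \<le> suminf g"
proof -
  have "(\<Sum>j\<in>A. g (h j)) = sum g (h ` A)" using assms(4) by (simp add: sum.reindex)
  also have "\<dots> \<le> suminf g" using assms by (intro sum_le_suminf) auto
  finally show ?thesis .
qed

text \<open>\<open>g1\<close> and \<open>g2\<close> are decay profiles on the two sides of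
  \<open>J\<close>. Their summability makes the total comparable to the weight \<open>c\<close> of
  level \<open>J\<close>, uniformly in \<open>J\<close> and \<open>L\<close>.\<close>

lemma sum_two_sided_le:
  fixes f g1 g2 :: "nat \<Rightarrow> real"
  assumes g: "summable g1" "summable g2" "\<And>i. 0 \<le> g1 i" "\<And>i. 0 \<le> g2 i" and c: "0 \<le> c"
    and f: "\<And>j. j \<le> J \<Longrightarrow> f j \<le> c * g1 (J - j)" "\<And>j. J < j \<Longrightarrow> f j \<le> c * g2 (j - J)"
  shows "(\<Sum>j<L. f j) \<le> c * (suminf g1 + suminf g2)"
proof -
  have "(\<Sum>j<L. f j) = (\<Sum>j\<in>{..<L} \<inter> {..J}. f j) + (\<Sum>j\<in>{..<L} - {..J}. f j)"
    by (rule sum.Int_Diff) simp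
  also have "\<dots> \<le> (\<Sum>j\<in>{..<L} \<inter> {..J}. c * g1 (J - j)) + (\<Sum>j\<in>{..<L} - {..J}. c * g2 (j - J))"
    using f by (intro add_mono sum_mono) auto
  also have "\<dots> = c * ((\<Sum>j\<in>{..<L} \<inter> {..J}. g1 (J - j)) + (\<Sum>j\<in>{..<L} - {..J}. g2 (j - J)))"
    by (simp add: distrib_left sum_distrib_left)
  also have "\<dots> \<le> c * (suminf g1 + suminf g2)"
    using g by (intro mult_left_mono c add_mono sum_reindex_le_suminf) (auto simp: inj_on_def)
  finally show ?thesis .
qed

lemma affine_le_mult_Suc: "0 \<le> x \<Longrightarrow> 0 \<le> y \<Longrightarrow> x + y * real d \<le> (x + y) * real (Suc d)" for x y :: real
  by (simp add: distrib_left distrib_right)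

lemma two_powr_nat: "2 powr (- (c * real i)) = (2 powr (- c)) ^ i"
  by (simp add: powr_power mult.commute)

text \<open>
  Tolerance at level \<open>j\<close> relative to the typical size \<open>2 powr (- j * H)\<close> of the coefficients there: it
  decays fast enough below \<open>J\<close> and grows slowly enough above \<open>J\<close> for the semi-norms of all levels to
  add up to a multiple of that of level \<open>J\<close>.
\<close>

definition level_ratio :: "real \<Rightarrow> real \<Rightarrow> nat \<Rightarrow> nat \<Rightarrow> real" where
  "level_ratio \<theta> \<delta> J j =
     (if j \<le> J then 2 powr (- ((\<theta> + 1) * real (J - j))) else 2 powr (\<delta> * real (j - J)))"

definition level_tol :: "real \<Rightarrow> real \<Rightarrow> real \<Rightarrow> nat \<Rightarrow> nat \<Rightarrow> real" where
  "level_tol H \<theta> \<delta> J j = 2 powr (- real j * H) * level_ratio \<theta> \<delta> J j"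

lemma level_ratio_pos: "0 < level_ratio \<theta> \<delta> J j"
  by (simp add: level_ratio_def)

text \<open>Tolerance and scale carry the same power of \<open>2 ^ j\<close>, which cancels by
  self-similarity; the level survives only through the ratio \<rho> and the reserved mass
  \<eta>.\<close>

lemma coding_cost_level:
  assumes "0 < \<rho>" "0 < \<alpha>" "0 < s" "0 < B"
  shows "coding_cost \<alpha> s C \<eta> (18 * (B * 2 powr (- real j * (H * \<alpha>)))) (2 powr (- real j * H) * \<rho>)
    = 2 * \<eta> + (ln (4 / \<eta>) + 2 / s) * ((2 powr s * C * (18 * B) powr (s / \<alpha>)) * \<rho> powr (- s))"
proof -
  have 1: "(2 / (2 powr (- real j * H) * \<rho>)) powr s = 2 powr s * 2 powr (real j * H * s) * \<rho> powr (- s)"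
  proof -
    have "2 / (2 powr (- real j * H) * \<rho>) = 2 * (2 powr (real j * H) * inverse \<rho>)"
      by (simp add: powr_minus divide_inverse)
    also have "\<dots> powr s = 2 powr s * ((2 powr (real j * H)) powr s * inverse \<rho> powr s)"
      by (simp add: powr_mult)
    also have "inverse \<rho> powr s = \<rho> powr (- s)" using assms by (simp add: powr_minus inverse_powr)
    finally show ?thesis by (simp add: powr_powr)
  qed
  have 2: "(18 * (B * 2 powr (- real j * (H * \<alpha>)))) powr (s / \<alpha>) = (18 * B) powr (s / \<alpha>) * 2 powr (- (real j * H * s))"
  proof -
    have "(18 * (B * 2 powr (- real j * (H * \<alpha>)))) powr (s / \<alpha>)
      = (18 * B) powr (s / \<alpha>) * (2 powr (- real j * (H * \<alpha>))) powr (s / \<alpha>)"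
      by (simp add: powr_mult)
    also have "(2 powr (- real j * (H * \<alpha>))) powr (s / \<alpha>) = 2 powr (- (real j * H * s))"
      unfolding powr_powr using assms by (simp add: mult_ac)
    finally show ?thesis .
  qed
  have 3: "2 powr (real j * H * s) * 2 powr (- (real j * H * s)) = 1"
    by (simp flip: powr_add)
  have "(2 powr s * 2 powr (real j * H * s) * \<rho> powr (- s)) * (C * ((18 * B) powr (s / \<alpha>) * 2 powr (- (real j * H * s))))
    = (2 powr s * C * (18 * B) powr (s / \<alpha>)) * \<rho> powr (- s) * (2 powr (real j * H * s) * 2 powr (- (real j * H * s)))"
    by (simp only: mult_ac)
  then show ?thesis unfolding coding_cost_def 1 2 3 by simp
qed

text \<open>Above \<open>J\<close> the reserved mass is chosen of the same order as the moment term,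
  \<open>2 powr (- \<delta> * s2 * (j - J))\<close>. The logarithm of the reserved mass then loses
  only a factor linear in \<open>j - J\<close>.\<close>

definition level_cost ::
    "real \<Rightarrow> real \<Rightarrow> real \<Rightarrow> real \<Rightarrow> real \<Rightarrow> real \<Rightarrow> real \<Rightarrow> real \<Rightarrow> real \<Rightarrow> nat \<Rightarrow> nat \<Rightarrow> real" where
  "level_cost \<alpha> H \<theta> \<delta> B s1 C1 s2 C2 J j =
     coding_cost \<alpha> (if j \<le> J then s1 else s2) (if j \<le> J then C1 else C2)
       (if j \<le> J then 1 / 2 else 2 powr (- (\<delta> * s2 * real (j - J))) / 2)
       (18 * (B * 2 powr (- real j * (H * \<alpha>)))) (level_tol H \<theta> \<delta> J j)"

text \<open>Let \<open>d\<close> be the distance to \<open>J\<close>. Below \<open>J\<close> the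
  weight \<open>2 ^ J / 2 ^ d\<close> meets a cost of order
  \<open>2 powr ((\<theta> + 1) * s1 * d)\<close>; above \<open>J\<close> the weight
  \<open>2 ^ J * 2 ^ d\<close> meets a cost of order
  \<open>(d + 1) * 2 powr (- \<delta> * s2 * d)\<close>. The two conditions on \<open>s1\<close> and
  \<open>s2\<close> make both products summable in \<open>d\<close>.\<close>

lemma sum_coding_cost_levels:
  assumes \<alpha>: "0 < \<alpha>" and \<theta>: "0 < \<theta>" and \<delta>: "0 < \<delta>" and B: "0 < B"
    and s1: "0 < s1" "(\<theta> + 1) * s1 < 1" and s2: "0 < s2" "1 < \<delta> * s2" and C: "0 \<le> C1" "0 \<le> C2"
  shows "\<exists>G\<ge>0. \<forall>J L. (\<Sum>j<L. 2 ^ j * level_cost \<alpha> H \<theta> \<delta> B s1 C1 s2 C2 J j) \<le> G * 2 ^ J"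
proof -
  \<comment> \<open>\<open>ln 8\<close> is \<open>ln (4 / \<eta>)\<close> for
    \<open>\<eta> = 1 / 2\<close>; above \<open>J\<close> the same logarithm becomes
    \<open>ln 8 + \<delta> * s2 * d * ln 2\<close>.\<close>
  define K1 where "K1 = (ln 8 + 2 / s1) * (2 powr s1 * C1 * (18 * B) powr (s1 / \<alpha>))"
  define K2' where "K2' = 2 powr s2 * C2 * (18 * B) powr (s2 / \<alpha>)"
  define K2 where "K2 = 1 + (ln 8 + 2 / s2 + \<delta> * s2 * ln 2) * K2'"
  define r1 where "r1 = 2 powr (- (1 - (\<theta> + 1) * s1))"
  define r2 where "r2 = 2 powr (- (\<delta> * s2 - 1))"
  define g1 where "g1 i = (1 / 2) ^ i + K1 * r1 ^ i" for i
  define g2 where "g2 i = K2 * (real (Suc i) * r2 ^ i)" for i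
  have K1: "0 \<le> K1" using s1 C by (auto simp: K1_def intro!: mult_nonneg_nonneg)
  have K2': "0 \<le> K2'" using C by (simp add: K2'_def)
  have K2: "0 \<le> K2" using s2 \<delta> K2' by (auto simp: K2_def intro!: add_nonneg_nonneg mult_nonneg_nonneg)
  have r1: "0 \<le> r1" "r1 < 1" using s1 by (auto simp: r1_def powr_less_one)
  have r2: "0 \<le> r2" "r2 < 1" using s2 by (auto simp: r2_def powr_less_one)
  have g1s: "summable g1" unfolding g1_def using r1 by (intro summable_add summable_mult summable_geometric) auto
  have g2s: "summable g2" unfolding g2_def
    using geometric_deriv_sums[of r2] r2 by (intro summable_mult) (auto simp: sums_iff)
  have g10: "0 \<le> g1 i" for i using K1 r1 by (simp add: g1_def)
  have g20: "0 \<le> g2 i" for i using K2 r2 by (simp add: g2_def)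
  have "(\<Sum>j<L. 2 ^ j * level_cost \<alpha> H \<theta> \<delta> B s1 C1 s2 C2 J j)
      \<le> 2 ^ J * (suminf g1 + suminf g2)" for J L
  proof (rule sum_two_sided_le[OF g1s g2s g10 g20])
    fix j assume j: "j \<le> J"
    define d where "d = J - j"
    have J: "J = j + d" using j by (simp add: d_def)
    have e: "(2 powr (- ((\<theta> + 1) * real d))) powr (- s1) = 2 powr ((\<theta> + 1) * s1 * real d)"
      by (simp add: powr_powr mult_ac)
    have "coding_cost \<alpha> s1 C1 (1 / 2) (18 * (B * 2 powr (- real j * (H * \<alpha>)))) (level_tol H \<theta> \<delta> J j)
      = 1 + K1 * 2 powr ((\<theta> + 1) * s1 * real d)"
      unfolding level_tol_def coding_cost_level[OF level_ratio_pos \<alpha> s1(1) B]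
      using j by (simp add: K1_def level_ratio_def e d_def[symmetric])
    then have "2 ^ j * coding_cost \<alpha> s1 C1 (1 / 2) (18 * (B * 2 powr (- real j * (H * \<alpha>)))) (level_tol H \<theta> \<delta> J j)
      = 2 ^ j * (1 + K1 * 2 powr ((\<theta> + 1) * s1 * real d))" by simp
    also have "\<dots> = 2 ^ J * g1 d"
    proof -
      have "r1 ^ d = 2 powr ((\<theta> + 1) * s1 * real d) * 2 powr (- real d)"
        unfolding r1_def two_powr_nat[symmetric] powr_add[symmetric] by (simp add: algebra_simps)
      moreover have "2 powr (- real d) = (1 / 2) ^ d"
        by (simp add: powr_minus powr_realpow power_one_over inverse_eq_divide)
      ultimately have "g1 d = (1 / 2) ^ d * (1 + K1 * 2 powr ((\<theta> + 1) * s1 * real d))"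
        by (simp add: g1_def algebra_simps)
      moreover have "(2::real) ^ J * (1 / 2) ^ d = 2 ^ j" by (simp add: J power_add power_one_over)
      ultimately show ?thesis by (simp only: mult.assoc[symmetric])
    qed
    finally show "2 ^ j * level_cost \<alpha> H \<theta> \<delta> B s1 C1 s2 C2 J j \<le> 2 ^ J * g1 (J - j)"
      using j by (simp add: level_cost_def d_def)
  next
    fix j assume j: "J < j"
    define d where "d = j - J"
    have J: "j = J + d" using j by (simp add: d_def)
    define w where "w = 2 powr (- (\<delta> * s2 * real d))"
    have w: "0 < w" by (simp add: w_def)
    have e: "(2 powr (\<delta> * real d)) powr (- s2) = w" by (simp add: w_def powr_powr mult_ac)
    have lnw: "ln (4 / (w / 2)) = ln 8 + \<delta> * s2 * real d * ln 2"
    proof -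
      have "4 / (w / 2) = 8 / w" by simp
      then have "ln (4 / (w / 2)) = ln 8 - ln w" using w by (simp add: ln_div)
      then show ?thesis by (simp add: w_def)
    qed
    have "coding_cost \<alpha> s2 C2 (w / 2) (18 * (B * 2 powr (- real j * (H * \<alpha>)))) (level_tol H \<theta> \<delta> J j)
      = w + (ln (4 / (w / 2)) + 2 / s2) * (K2' * w)"
      unfolding level_tol_def coding_cost_level[OF level_ratio_pos \<alpha> s2(1) B]
      using j by (simp add: K2'_def level_ratio_def e d_def[symmetric])
    also have "\<dots> = w * (1 + (ln 8 + 2 / s2 + \<delta> * s2 * ln 2 * real d) * K2')"
      unfolding lnw by (simp add: algebra_simps)
    also have "\<dots> \<le> w * (K2 * real (Suc d))"
    proof (rule mult_left_mono)
      have "(ln 8 + 2 / s2 + \<delta> * s2 * ln 2 * real d) \<le> (ln 8 + 2 / s2 + \<delta> * s2 * ln 2) * real (Suc d)"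
        by (rule affine_le_mult_Suc) (use s2 \<delta> in auto)
      then have "(ln 8 + 2 / s2 + \<delta> * s2 * ln 2 * real d) * K2' \<le> (ln 8 + 2 / s2 + \<delta> * s2 * ln 2) * real (Suc d) * K2'"
        using K2' by (rule mult_right_mono)
      moreover have "K2 * real (Suc d) = real (Suc d) + (ln 8 + 2 / s2 + \<delta> * s2 * ln 2) * real (Suc d) * K2'"
        by (simp only: K2_def) algebra
      ultimately show "1 + (ln 8 + 2 / s2 + \<delta> * s2 * ln 2 * real d) * K2' \<le> K2 * real (Suc d)" by simp
    qed (use w in simp)
    finally have "2 ^ j * coding_cost \<alpha> s2 C2 (w / 2) (18 * (B * 2 powr (- real j * (H * \<alpha>)))) (level_tol H \<theta> \<delta> J j)
      \<le> 2 ^ j * (w * (K2 * real (Suc d)))" by (rule mult_left_mono) simp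
    also have "\<dots> = 2 ^ J * g2 d"
    proof -
      have "r2 ^ d = w * 2 powr real d"
        unfolding r2_def w_def two_powr_nat[symmetric] powr_add[symmetric] by (simp add: algebra_simps)
      then have "r2 ^ d = w * 2 ^ d" by (simp add: powr_realpow)
      then show ?thesis by (simp add: g2_def J power_add mult_ac)
    qed
    finally show "2 ^ j * level_cost \<alpha> H \<theta> \<delta> B s1 C1 s2 C2 J j \<le> 2 ^ J * g2 (j - J)"
      using j by (simp add: level_cost_def d_def w_def)
  qed simp
  moreover have "0 \<le> suminf g1 + suminf g2" using g1s g2s g10 g20 by (intro add_nonneg_nonneg suminf_nonneg)
  ultimately show ?thesis by (intro exI[of _ "suminf g1 + suminf g2"]) (simp add: mult.commute)
qed

text \<open>Relative to \<open>2 powr (- J * \<theta>)\<close>, level \<open>j\<close> contributes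
  \<open>2 powr (- (J - j))\<close> below \<open>J\<close>, which is why the exponent in
  \<open>level_ratio\<close> is \<open>\<theta> + 1\<close> and not just \<theta>, and
  \<open>2 powr (- (\<theta> - \<delta>) * (j - J))\<close> above \<open>J\<close>.\<close>

lemma sum_level_tolerances:
  assumes \<theta>: "\<theta> = H - \<phi>" and \<delta>: "\<delta> < \<theta>"
  shows "\<exists>G\<ge>0. \<forall>J L. (\<Sum>j<L. 2 powr (real j * \<phi>) * (2 * level_tol H \<theta> \<delta> J j))
    \<le> G * 2 powr (- (real J * \<theta>))"
proof -
  define r where "r = 2 powr (- (\<theta> - \<delta>))"
  have r: "0 \<le> r" "r < 1" using \<delta> by (auto simp: r_def powr_less_one)
  have s1: "summable (\<lambda>i. 2 * (1 / 2 :: real) ^ i)" "summable (\<lambda>i. 2 * r ^ i)"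
    using r by (auto intro!: summable_mult summable_geometric)
  have "(\<Sum>j<L. 2 powr (real j * \<phi>) * (2 * level_tol H \<theta> \<delta> J j))
    \<le> 2 powr (- (real J * \<theta>)) * ((\<Sum>i. 2 * (1 / 2) ^ i) + (\<Sum>i. 2 * r ^ i))" for J L
  proof (rule sum_two_sided_le[OF s1])
    fix j assume j: "j \<le> J"
    have "2 powr (real j * \<phi>) * (2 powr (- real j * H) * 2 powr (- ((\<theta> + 1) * real (J - j))))
      = 2 powr (- (real J * \<theta>)) * 2 powr (- real (J - j))"
      unfolding powr_add[symmetric] using j by (simp add: \<theta> of_nat_diff algebra_simps)
    also have "2 powr (- real (J - j)) = (1 / 2) ^ (J - j)"
      by (simp add: powr_minus powr_realpow power_one_over inverse_eq_divide del: of_nat_diff)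
    finally show "2 powr (real j * \<phi>) * (2 * level_tol H \<theta> \<delta> J j)
      \<le> 2 powr (- (real J * \<theta>)) * (2 * (1 / 2) ^ (J - j))"
      using j by (simp add: level_tol_def level_ratio_def mult_ac)
  next
    fix j assume j: "J < j"
    have "2 powr (real j * \<phi>) * (2 powr (- real j * H) * 2 powr (\<delta> * real (j - J)))
      = 2 powr (- (real J * \<theta>)) * 2 powr (- ((\<theta> - \<delta>) * real (j - J)))"
      unfolding powr_add[symmetric] using j by (simp add: \<theta> of_nat_diff algebra_simps)
    also have "2 powr (- ((\<theta> - \<delta>) * real (j - J))) = r ^ (j - J)"
      unfolding r_def by (rule two_powr_nat)
    finally have "2 powr (real j * \<phi>) * (level_tol H \<theta> \<delta> J j)
      = 2 powr (- (real J * \<theta>)) * r ^ (j - J)"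
      unfolding level_tol_def level_ratio_def using j by (simp only: not_le[symmetric] if_False)
    then have "2 * (2 powr (real j * \<phi>) * (level_tol H \<theta> \<delta> J j))
      \<le> 2 * (2 powr (- (real J * \<theta>)) * r ^ (j - J))" by simp
    then show "2 powr (real j * \<phi>) * (2 * level_tol H \<theta> \<delta> J j)
      \<le> 2 powr (- (real J * \<theta>)) * (2 * r ^ (j - J))"
      by (simp only: mult.left_commute)
  qed (use r in auto)
  moreover have "0 \<le> (\<Sum>i. 2 * (1 / 2 :: real) ^ i) + (\<Sum>i. 2 * r ^ i)"
    using s1 r by (intro add_nonneg_nonneg suminf_nonneg) auto
  ultimately show ?thesis
    by (intro exI[of _ "(\<Sum>i. 2 * (1 / 2 :: real) ^ i) + (\<Sum>i. 2 * r ^ i)"]) (simp add: mult.commute)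
qed

context riemann_liouville_process
begin

text \<open>The event involves infinitely many coefficients. For the first \<open>L\<close> levels
  the bound is uniform in \<open>L\<close>, and the corresponding events decrease in
  \<open>L\<close>, so continuity of the measure from above yields it for all levels
  together.\<close>

lemma small_ball_coefficients:
  assumes m: "H < real m" and \<theta>: "0 < \<theta>" and \<delta>: "0 < \<delta>" "0 < s2" "1 < \<delta> * s2" and C2: "moment_const \<alpha> s2 C2"
  shows "\<exists>c\<ge>0. \<forall>J. \<exists>E\<in>events. exp (- c * 2 ^ J) / 4 \<le> prob E \<and>
    (\<forall>\<omega>\<in>E. coefficients_le m (\<lambda>t. R0 t \<omega>) (2 * level_tol H \<theta> \<delta> J 0) (\<lambda>j. 2 * level_tol H \<theta> \<delta> J j))"
proof -
  \<comment> \<open>Below \<alpha>, so that the moment exists, and small enough for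
    \<open>(\<theta> + 1) * s1 \<le> 1 / 2\<close>.\<close>
  define s1 where "s1 = min (\<alpha> / 2) (1 / (2 * (\<theta> + 1)))"
  have s1: "0 < s1" "s1 < \<alpha>" using stability_index \<theta> by (auto simp: s1_def min_def)
  have "(\<theta> + 1) * s1 \<le> (\<theta> + 1) * (1 / (2 * (\<theta> + 1)))"
    unfolding s1_def using \<theta> by (intro mult_left_mono) auto
  also have "\<dots> = 1 / 2" using \<theta> by (simp add: field_simps)
  finally have s1': "(\<theta> + 1) * s1 < 1" by simp
  obtain C1 where C1: "moment_const \<alpha> s1 C1" using moment_const_subcritical[OF s1] by auto
  have C0: "0 \<le> C1" "0 \<le> C2" using C1 C2 by (auto simp: moment_const_def)
  obtain B0 where B0: "\<And>t. 0 < B0 t \<and> (\<integral>\<^sup>+x. ennreal (\<bar>kernel t x\<bar> powr \<alpha>) \<partial>lborel) \<le> ennreal (B0 t)"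
    using kernel_bound by metis
  obtain B1 where B1: "\<And>y. 0 < B1 y \<and> (\<forall>j n. (\<integral>\<^sup>+x. ennreal (\<bar>interp_error m j (\<lambda>t. kernel t x) (int n) y\<bar> powr \<alpha>) \<partial>lborel)
     \<le> ennreal (B1 y * 2 powr (- real j * (H * \<alpha>))))"
    using interp_error_kernel_bound[OF m] by metis
  \<comment> \<open>One constant above all those in use, so that the bound on a functional depends
    on its level only.\<close>
  define Bc where "Bc = (\<Sum>q\<le>m. B0 (real q)) + (\<Sum>r\<in>{-2..2}. \<Sum>i<m. B1 (node r i))"
  have B1s: "0 \<le> (\<Sum>r\<in>{-2..2}. \<Sum>i<m. B1 (node r i))" using B1 by (intro sum_nonneg less_imp_le) auto
  have B0s: "0 < (\<Sum>q\<le>m. B0 (real q))" using B0 by (intro sum_pos) auto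
  have Bc: "0 < Bc" using B0s B1s by (simp add: Bc_def)
  have Bc0: "B0 (real q) \<le> Bc" if "q \<le> m" for q
    using member_le_sum[of q "{..m}" "\<lambda>q. B0 (real q)"] that B0 B1s by (auto simp: Bc_def less_imp_le intro: order_trans)
  have Bc1: "B1 (node r i) \<le> Bc" if "r \<in> {-2..2}" "i < m" for r i
  proof -
    have "B1 (node r i) \<le> (\<Sum>i<m. B1 (node r i))"
      using that B1 by (intro member_le_sum) (auto simp: less_imp_le)
    also have "\<dots> \<le> (\<Sum>r\<in>{-2..2}. \<Sum>i<m. B1 (node r i))"
      using that(1) B1 by (intro member_le_sum[of r _ "\<lambda>r. \<Sum>i<m. B1 (node r i)"]) (auto intro!: sum_nonneg simp: less_imp_le)
    finally show ?thesis using B0s by (simp add: Bc_def)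
  qed
  define cost where "cost = level_cost \<alpha> H \<theta> \<delta> Bc s1 C1 s2 C2"
  have "\<exists>G\<ge>0. \<forall>J L. (\<Sum>j<L. 2 ^ j * cost J j) \<le> G * 2 ^ J"
    unfolding cost_def
    by (rule sum_coding_cost_levels[OF stability_index(1) \<theta> \<delta>(1) Bc s1(1) s1' \<delta>(2,3) C0])
  then obtain G where "0 \<le> G \<and> (\<forall>J L. (\<Sum>j<L. 2 ^ j * cost J j) \<le> G * 2 ^ J)" ..
  then have G: "0 \<le> G" "(\<Sum>j<L. 2 ^ j * cost J j) \<le> G * 2 ^ J" for J L by auto
  have \<eta>: "0 < (if j \<le> J then 1 / 2 else 2 powr (- (\<delta> * s2 * real (j - J))) / 2 :: real)"
    "(if j \<le> J then 1 / 2 else 2 powr (- (\<delta> * s2 * real (j - J))) / 2 :: real) \<le> 1 / 2" for j J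
  proof -
    have "2 powr (- (\<delta> * s2 * real (j - J))) \<le> 2 powr (0::real)"
      using \<delta> by (intro powr_mono) auto
    then show "(if j \<le> J then 1 / 2 else 2 powr (- (\<delta> * s2 * real (j - J))) / 2 :: real) \<le> 1 / 2" by (simp del: of_nat_diff)
  qed simp
  have cost0: "0 \<le> cost J j" for J j
    unfolding cost_def level_cost_def using \<eta>[of j J] s1(1) \<delta>(2) C0 by (intro less_imp_le[OF coding_cost_pos]) auto
  \<comment> \<open>A level has \<open>(2 ^ j + 1) * 5 * m \<le> 10 * m * 2 ^ j\<close>
    coefficients, and \<open>m + 1\<close> integer times are added at level 0; the leading 2 is the
    one in \<open>exp (- 2 * E)\<close>.\<close>
  define c where "c = 2 * ((11 * real m + 1) * G)"
  have c: "0 \<le> c" using G(1) by (simp add: c_def)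
  define T where "T j = {..2 ^ j :: nat} \<times> {-2..2 :: int} \<times> {..<m}" for j :: nat
  define II where "II L = {..m} <+> Sigma {..<L} T" for L :: nat
  define wt :: "nat + nat \<times> nat \<times> int \<times> nat \<Rightarrow> nat \<Rightarrow> real" where
    "wt a l = (case a of Inl q \<Rightarrow> (if l = 0 then 1 else 0)
       | Inr (j, n, r, i) \<Rightarrow> (if l < m then - lagrange m l (node r i) else 1))" for a l
  define tm :: "nat + nat \<times> nat \<times> int \<times> nat \<Rightarrow> nat \<Rightarrow> real" where
    "tm a l = (case a of Inl q \<Rightarrow> real q
       | Inr (j, n, r, i) \<Rightarrow> (real n + (if l < m then real l else node r i)) / 2 ^ j)" for a l
  define lev :: "nat + nat \<times> nat \<times> int \<times> nat \<Rightarrow> nat" where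
    "lev a = (case a of Inl q \<Rightarrow> 0 | Inr x \<Rightarrow> fst x)" for a
  have finI: "finite (II L)" for L by (auto simp: II_def T_def)
  have fun_Inl: "(\<Sum>l<Suc m. wt (Inl q) l * f (tm (Inl q) l)) = f (real q)" for q and f :: "real \<Rightarrow> real"
  proof -
    have "(\<Sum>l<Suc m. wt (Inl q) l * f (tm (Inl q) l)) = (\<Sum>l<Suc m. if l = 0 then f (real q) else 0)"
      by (intro sum.cong) (auto simp: wt_def tm_def)
    then show ?thesis by simp
  qed
  have fun_Inr: "(\<Sum>l<Suc m. wt (Inr (j, n, r, i)) l * f (tm (Inr (j, n, r, i)) l)) = interp_error m j f (int n) (node r i)"
    for j n r i and f :: "real \<Rightarrow> real"
    unfolding interp_error_functional by (simp only: wt_def tm_def sum.case prod.case)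
  define EE where "EE J L = {\<omega>\<in>space M. \<forall>a\<in>II L. \<bar>\<Sum>l<Suc m. wt a l * R0 (tm a l) \<omega>\<bar>
       \<le> 2 * level_tol H \<theta> \<delta> J (lev a)}" for J L
  have EE: "exp (- c * 2 ^ J) / 4 \<le> prob (EE J L)" if L: "0 < L" for J L
  proof -
    have "exp (- 2 * (\<Sum>a\<in>II L. cost J (lev a))) / 4 \<le> prob (EE J L)"
      unfolding cost_def level_cost_def EE_def
    proof (rule small_ball_functionals[OF finI])
      show "II L \<noteq> {}" by (auto simp: II_def)
      fix a assume a: "a \<in> II L"
      show "0 < Bc * 2 powr (- real (lev a) * (H * \<alpha>))" using Bc by simp
      show "0 < level_tol H \<theta> \<delta> J (lev a)" using level_ratio_pos by (simp add: level_tol_def)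
      show "0 < (if lev a \<le> J then s1 else s2)" using s1 \<delta> by simp
      show "moment_const \<alpha> (if lev a \<le> J then s1 else s2) (if lev a \<le> J then C1 else C2)"
        using C1 C2 by simp
      show "(\<integral>\<^sup>+x. ennreal (\<bar>\<Sum>l<Suc m. wt a l * kernel (tm a l) x\<bar> powr \<alpha>) \<partial>lborel)
        \<le> ennreal (Bc * 2 powr (- real (lev a) * (H * \<alpha>)))"
      proof (cases a)
        case (Inl q)
        then have q: "q \<le> m" using a by (auto simp: II_def)
        have "(\<integral>\<^sup>+x. ennreal (\<bar>kernel (real q) x\<bar> powr \<alpha>) \<partial>lborel) \<le> ennreal (B0 (real q))" using B0 by blast
        also have "\<dots> \<le> ennreal Bc" using Bc0[OF q] by (rule ennreal_leI)
        finally show ?thesis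
          unfolding Inl fun_Inl[of q "\<lambda>t. kernel t _"]
          by (simp add: lev_def)
      next
        case (Inr x)
        obtain j n r i where x: "x = (j, n, r, i)" by (cases x)
        have ri: "r \<in> {-2..2}" "i < m" using a Inr x by (auto simp: II_def T_def)
        have "(\<integral>\<^sup>+x. ennreal (\<bar>interp_error m j (\<lambda>t. kernel t x) (int n) (node r i)\<bar> powr \<alpha>) \<partial>lborel)
          \<le> ennreal (B1 (node r i) * 2 powr (- real j * (H * \<alpha>)))" using B1 by blast
        also have "\<dots> \<le> ennreal (Bc * 2 powr (- real j * (H * \<alpha>)))"
          using Bc1[OF ri] by (intro ennreal_leI mult_right_mono) auto
        finally show ?thesis
          unfolding Inr x fun_Inr[of j n r i "\<lambda>t. kernel t _"]
          by (simp add: lev_def)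
      qed
    qed (use \<eta> in blast)+
    moreover have "(\<Sum>a\<in>II L. cost J (lev a)) \<le> (11 * real m + 1) * (G * 2 ^ J)"
    proof -
      have "(\<Sum>a\<in>II L. cost J (lev a)) = (\<Sum>q\<le>m. cost J 0) + (\<Sum>x\<in>Sigma {..<L} T. cost J (fst x))"
        unfolding II_def by (subst sum.Plus) (auto simp: T_def lev_def)
      also have "(\<Sum>x\<in>Sigma {..<L} T. cost J (fst x)) = (\<Sum>j<L. \<Sum>y\<in>T j. cost J j)"
        by (subst sum.Sigma) (auto simp: T_def case_prod_beta')
      also have "\<dots> \<le> (\<Sum>j<L. 10 * real m * (2 ^ j * cost J j))"
      proof (rule sum_mono)
        fix j
        have "card (T j) = (2 ^ j + 1) * (5 * m)" by (simp add: T_def card_cartesian_product)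
        moreover have "real ((2 ^ j + 1) * (5 * m)) \<le> 10 * real m * 2 ^ j"
        proof -
          have "(2::real) ^ j + 1 \<le> 2 * 2 ^ j" by simp
          then have "(2 ^ j + 1) * (5 * real m) \<le> 2 * 2 ^ j * (5 * real m)" by (rule mult_right_mono) simp
          moreover have "real ((2 ^ j + 1) * (5 * m)) = (2 ^ j + 1) * (5 * real m)"
            by (simp only: of_nat_mult of_nat_add of_nat_power of_nat_numeral of_nat_1)
          moreover have "2 * 2 ^ j * (5 * real m) = 10 * real m * 2 ^ j" by simp
          ultimately show ?thesis by linarith
        qed
        ultimately have "real (card (T j)) * cost J j \<le> 10 * real m * 2 ^ j * cost J j"
          using cost0 by (intro mult_right_mono) auto
        then show "(\<Sum>y\<in>T j. cost J j) \<le> 10 * real m * (2 ^ j * cost J j)" by (simp add: mult.assoc)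
      qed
      also have "(\<Sum>q\<le>m. cost J 0) = (real m + 1) * (2 ^ 0 * cost J 0)" by simp
      also have "(real m + 1) * (2 ^ 0 * cost J 0) \<le> (real m + 1) * (\<Sum>j<L. 2 ^ j * cost J j)"
        using L cost0 member_le_sum[of 0 "{..<L}" "\<lambda>j. 2 ^ j * cost J j"] by (intro mult_left_mono) auto
      finally have "(\<Sum>a\<in>II L. cost J (lev a)) \<le> (11 * real m + 1) * (\<Sum>j<L. 2 ^ j * cost J j)"
        unfolding sum_distrib_left[symmetric] by (simp add: distrib_right)
      also have "\<dots> \<le> (11 * real m + 1) * (G * 2 ^ J)" using G(2) by (intro mult_left_mono) auto
      finally show ?thesis .
    qed
    then have "exp (- c * 2 ^ J) \<le> exp (- 2 * (\<Sum>a\<in>II L. cost J (lev a)))"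
      by (simp add: c_def)
    ultimately show ?thesis by linarith
  qed
  have EEm: "EE J L \<in> events" for J L
  proof -
    note [measurable] = measurable_R0
    show ?thesis unfolding EE_def using finI by measurable
  qed
  have "\<exists>E\<in>events. exp (- c * 2 ^ J) / 4 \<le> prob E \<and>
    (\<forall>\<omega>\<in>E. coefficients_le m (\<lambda>t. R0 t \<omega>) (2 * level_tol H \<theta> \<delta> J 0) (\<lambda>j. 2 * level_tol H \<theta> \<delta> J j))" for J
  proof (intro bexI conjI ballI)
    let ?E = "\<Inter>L. EE J (Suc L)"
    show "?E \<in> events" using EEm by (intro sets.countable_INT) auto
    have "decseq (\<lambda>L. EE J (Suc L))"
    proof (rule decseq_SucI)
      fix L show "EE J (Suc (Suc L)) \<subseteq> EE J (Suc L)"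
        unfolding EE_def II_def by fastforce
    qed
    then have "(\<lambda>L. prob (EE J (Suc L))) \<longlonglongrightarrow> prob ?E" using EEm by (intro finite_Lim_measure_decseq) auto
    then show "exp (- c * 2 ^ J) / 4 \<le> prob ?E"
      by (rule LIMSEQ_le_const) (intro exI[of _ 0] allI impI EE zero_less_Suc)
    fix \<omega> assume \<omega>: "\<omega> \<in> ?E"
    have \<omega>': "\<bar>\<Sum>l<Suc m. wt a l * R0 (tm a l) \<omega>\<bar> \<le> 2 * level_tol H \<theta> \<delta> J (lev a)" if "a \<in> II (Suc L)" for L a
    proof -
      have "\<omega> \<in> EE J (Suc L)" using \<omega> by blast
      with that show ?thesis unfolding EE_def by blast
    qed
    show "coefficients_le m (\<lambda>t. R0 t \<omega>) (2 * level_tol H \<theta> \<delta> J 0) (\<lambda>j. 2 * level_tol H \<theta> \<delta> J j)"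
      unfolding coefficients_le_def
    proof (intro conjI allI impI)
      fix q assume "q \<le> m"
      then have "Inl q \<in> II (Suc 0)" by (auto simp: II_def)
      from \<omega>'[OF this] show "\<bar>R0 (real q) \<omega>\<bar> \<le> 2 * level_tol H \<theta> \<delta> J 0"
        unfolding fun_Inl[of q "\<lambda>t. R0 t \<omega>"] by (simp add: lev_def)
    next
      fix j n i :: nat and r :: int assume "n \<le> 2 ^ j" "r \<in> {-2..2}" "i < m"
      then have "Inr (j, n, r, i) \<in> II (Suc j)" by (auto simp: II_def T_def)
      from \<omega>'[OF this] show "\<bar>interp_error m j (\<lambda>t. R0 t \<omega>) (int n) (node r i)\<bar> \<le> 2 * level_tol H \<theta> \<delta> J j"
        unfolding fun_Inr[of j n r i "\<lambda>t. R0 t \<omega>"] by (simp add: lev_def)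
    qed
  qed
  with c show ?thesis by blast
qed

end

section \<open>Measurability of sublevel sets\<close>

definition rational_bernstein :: "nat \<times> rat list \<Rightarrow> real \<Rightarrow> real" where
  "rational_bernstein = (\<lambda>(n, qs) t. \<Sum>k\<le>n. of_rat (qs ! k) * Bernstein n k t)"

lemma continuous_on_rational_bernstein: "continuous_on A (rational_bernstein d)"
  by (cases d) (auto simp: rational_bernstein_def Bernstein_def intro!: continuous_intros)

text \<open>The coefficients of a Bernstein polynomial of \<open>f\<close> are rounded to rationals.
  As the Bernstein basis is nonnegative with sum 1, the error of rounding is not amplified.\<close>

lemma rational_bernstein_dense:
  assumes f: "continuous_on {0..1} f" and e: "0 < e"
  shows "\<exists>d. \<forall>t\<in>{0..1}. \<bar>f t - rational_bernstein d t\<bar> \<le> e"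
proof -
  have e2: "0 < e / 2" using e by simp
  obtain n where n: "\<forall>k x. n \<le> k \<and> x \<in> {0..1} \<longrightarrow> \<bar>f x - (\<Sum>i\<le>k. f (i / k) * Bernstein k i x)\<bar> < e / 2"
    using Bernstein_Weierstrass[OF f e2] by auto
  have "\<exists>q. \<bar>f (real k / real n) - of_rat q\<bar> < e / 2" for k
  proof -
    obtain q where "f (real k / real n) - e / 2 < of_rat q" "of_rat q < f (real k / real n)"
      using of_rat_dense[of "f (real k / real n) - e / 2" "f (real k / real n)"] e by auto
    then show ?thesis by (intro exI[of _ q]) linarith
  qed
  then obtain q where q: "\<And>k. \<bar>f (real k / real n) - of_rat (q k)\<bar> < e / 2" by metis
  define d where "d = (n, map q [0..<Suc n])"
  have "\<bar>f t - rational_bernstein d t\<bar> \<le> e" if t: "t \<in> {0..1}" for t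
  proof -
    have nth: "map q [0..<Suc n] ! k = q k" if "k \<le> n" for k using that by (simp del: upt_Suc)
    have "\<bar>(\<Sum>k\<le>n. f (real k / real n) * Bernstein n k t) - rational_bernstein d t\<bar>
      = \<bar>\<Sum>k\<le>n. (f (real k / real n) - of_rat (q k)) * Bernstein n k t\<bar>"
      using nth by (simp add: rational_bernstein_def d_def left_diff_distrib sum_subtractf del: upt_Suc)
    also have "\<dots> \<le> (\<Sum>k\<le>n. e / 2 * Bernstein n k t)"
    proof (rule order_trans[OF sum_abs], rule sum_mono)
      fix k
      have "0 \<le> Bernstein n k t" using t by (auto intro: Bernstein_nonneg)
      then show "\<bar>(f (real k / real n) - of_rat (q k)) * Bernstein n k t\<bar> \<le> e / 2 * Bernstein n k t"
        using q[of k] e unfolding abs_mult by (intro mult_mono) auto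
    qed
    also have "\<dots> = e / 2" by (simp only: sum_distrib_left[symmetric] sum_Bernstein mult_1_right)
    finally have 1: "\<bar>(\<Sum>k\<le>n. f (real k / real n) * Bernstein n k t) - rational_bernstein d t\<bar> \<le> e / 2" .
    have "\<bar>f t - (\<Sum>k\<le>n. f (real k / real n) * Bernstein n k t)\<bar> < e / 2" using n t by simp
    with 1 show ?thesis by linarith
  qed
  then show ?thesis by blast
qed

lemma continuous_le_on_rationals:
  assumes f: "continuous_on {0..1} f" and le: "\<And>t. t \<in> {0..1} \<inter> \<rat> \<Longrightarrow> f t \<le> (c :: real)" and t: "t \<in> {0..1::real}"
  shows "f t \<le> c"
proof -
  have "closure ({0..1} \<inter> \<rat>) = closure {0..1::real}"
  proof
    show "closure ({0..1} \<inter> \<rat>) \<subseteq> closure {0..1::real}" by (intro closure_mono) auto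
    have "{0..1::real} \<subseteq> closure ({0..1} \<inter> \<rat>)"
    proof
      fix x :: real assume x: "x \<in> {0..1}"
      show "x \<in> closure ({0..1} \<inter> \<rat>)"
      proof (rule closure_approachable[THEN iffD2], intro allI impI)
        fix e :: real assume e: "0 < e"
        have "max 0 (x - e) < min 1 (x + e)" using x e by auto
        from Rats_dense_in_real[OF this] obtain r where "r \<in> \<rat>" "max 0 (x - e) < r" "r < min 1 (x + e)" by auto
        then show "\<exists>y\<in>{0..1} \<inter> \<rat>. dist y x < e"
          by (intro bexI[of _ r]) (auto simp: dist_real_def abs_less_iff)
      qed
    qed
    then show "closure {0..1::real} \<subseteq> closure ({0..1} \<inter> \<rat>)" by (intro closure_minimal) auto
  qed
  then have cl: "closure ({0..1} \<inter> \<rat>) = {0..1::real}" by simp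
  show ?thesis
    by (rule continuous_le_on_closure[of "{0..1} \<inter> \<rat>"]) (use f le t in \<open>simp_all only: cl\<close>)
qed

text \<open>Continuity of the paths and membership in the function space hold only almost surely, so
  the event of interest is identified with a measurable one up to a null set; hence the
  completion.\<close>

lemma sets_completion_if_AE_iff:
  assumes "G \<in> sets M" "AE \<omega> in M. \<omega> \<in> G \<longleftrightarrow> Q \<omega>"
  shows "{\<omega> \<in> space M. Q \<omega>} \<in> sets (completion M)"
proof -
  obtain N where N: "{\<omega> \<in> space M. \<not> (\<omega> \<in> G \<longleftrightarrow> Q \<omega>)} \<subseteq> N" "N \<in> null_sets M"
    using assms(2) unfolding eventually_ae_filter by auto
  have "{\<omega> \<in> space M. Q \<omega>} = (G - N) \<union> ({\<omega> \<in> space M. Q \<omega>} \<inter> N)"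
    using N(1) sets.sets_into_space[OF assms(1)] by blast
  moreover have "G - N \<in> sets (completion M)" using assms(1) N(2) by auto
  moreover have "{\<omega> \<in> space M. Q \<omega>} \<inter> N \<in> sets (completion M)" using N(2) by (intro sets_completionI_sub[of N]) auto
  ultimately show ?thesis by (metis sets.Un)
qed

lemma sets_Collect_countable_Ball_dep:
  assumes "\<And>i. i \<in> A \<Longrightarrow> {x \<in> space M. Q i x} \<in> sets M" "countable A"
  shows "{x \<in> space M. \<forall>i\<in>A. Q i x} \<in> sets M"
proof -
  show ?thesis
  proof (cases "A = {}")
    case False
    then have "{x \<in> space M. \<forall>i\<in>A. Q i x} = (\<Inter>i\<in>A. {x \<in> space M. Q i x})" by auto
    also have "\<dots> \<in> sets M" using assms False by (intro sets.countable_INT') auto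
    finally show ?thesis .
  qed simp
qed

text \<open>
  By lower semicontinuity the sublevel sets of the semi-norm are relatively closed for uniform
  convergence, hence described by countably many balls.
\<close>

lemma (in seminorm_family) sublevel_set_measurable:
  fixes X :: "real \<Rightarrow> 'w \<Rightarrow> real"
  assumes lsc: "\<And>f fs. f \<in> FI {0..1} \<Longrightarrow> (\<And>n. fs n \<in> FI {0..1}) \<Longrightarrow>
           uniform_limit {0..1} fs f sequentially \<Longrightarrow> ereal (N {0..1} f) \<le> limsup (\<lambda>n. ereal (N {0..1} (fs n)))"
    and X: "\<And>t. t \<in> {0..1} \<Longrightarrow> X t \<in> borel_measurable M"
    and cont: "AE \<omega> in M. continuous_on {0..1} (\<lambda>t. X t \<omega>)"
    and mem: "AE \<omega> in M. (\<lambda>t\<in>{0..1}. X t \<omega>) \<in> FI {0..1}"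
  shows "{\<omega> \<in> space M. N {0..1} (\<lambda>t\<in>{0..1}. X t \<omega>) \<le> \<epsilon>} \<in> sets (completion M)"
proof -
  define K where "K = {g \<in> FI {0..1}. N {0..1} g \<le> \<epsilon>}"
  \<comment> \<open>The function \<open>g\<close> does not depend on \<omega>, so for fixed
    \<open>d\<close> and \<open>k\<close> this is a constant proposition, and \<open>G\<close> is
    built from countably many measurable conditions.\<close>
  define P where "P d k \<longleftrightarrow> (\<exists>g\<in>K. \<forall>t\<in>{0..1}. \<bar>g t - rational_bernstein d t\<bar> \<le> inverse (real (Suc k)))" for d k
  define G where "G = {\<omega> \<in> space M. \<forall>k. \<exists>d. P d k \<and> (\<forall>t\<in>{0..1} \<inter> \<rat>. \<bar>X t \<omega> - rational_bernstein d t\<bar> \<le> inverse (real (Suc k)))}"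
  have cr: "countable ({0..1} \<inter> \<rat> :: real set)" using countable_rat by blast
  have "G \<in> sets M"
  proof -
    have "{\<omega> \<in> space M. P d k \<and> (\<forall>t\<in>{0..1} \<inter> \<rat>. \<bar>X t \<omega> - rational_bernstein d t\<bar> \<le> inverse (real (Suc k)))} \<in> sets M" for d k
    proof -
      have "{\<omega> \<in> space M. \<bar>X t \<omega> - rational_bernstein d t\<bar> \<le> inverse (real (Suc k))} \<in> sets M"
        if "t \<in> {0..1} \<inter> \<rat>" for t
      proof -
        have [measurable]: "X t \<in> borel_measurable M" using X that by auto
        show ?thesis by measurable
      qed
      then have "{\<omega> \<in> space M. \<forall>t\<in>{0..1} \<inter> \<rat>. \<bar>X t \<omega> - rational_bernstein d t\<bar> \<le> inverse (real (Suc k))} \<in> sets M"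
        by (intro sets_Collect_countable_Ball_dep cr)
      then show ?thesis by (intro sets.sets_Collect_conj sets.sets_Collect_const)
    qed
    then show ?thesis
      unfolding G_def by (intro sets.sets_Collect_countable_All sets.sets_Collect_countable_Ex)
  qed
  moreover have "AE \<omega> in M. \<omega> \<in> G \<longleftrightarrow> N {0..1} (\<lambda>t\<in>{0..1}. X t \<omega>) \<le> \<epsilon>"
    using cont mem AE_space
  proof eventually_elim
    case (elim \<omega>)
    let ?f = "\<lambda>t\<in>{0..1}. X t \<omega>"
    show ?case
    proof
      assume G: "\<omega> \<in> G"
      have "\<exists>g\<in>K. \<forall>t\<in>{0..1}. \<bar>g t - X t \<omega>\<bar> \<le> 2 * inverse (real (Suc k))" for k
      proof -
        obtain d where d: "P d k" "\<forall>t\<in>{0..1} \<inter> \<rat>. \<bar>X t \<omega> - rational_bernstein d t\<bar> \<le> inverse (real (Suc k))"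
          using G unfolding G_def by blast
        have 1: "\<bar>X t \<omega> - rational_bernstein d t\<bar> \<le> inverse (real (Suc k))" if "t \<in> {0..1}" for t
        proof (rule continuous_le_on_rationals[where f = "\<lambda>t. \<bar>X t \<omega> - rational_bernstein d t\<bar>", OF _ _ that])
          show "continuous_on {0..1} (\<lambda>t. \<bar>X t \<omega> - rational_bernstein d t\<bar>)"
            using elim(1) by (intro continuous_intros continuous_on_rational_bernstein)
        qed (use d(2) in blast)
        from d(1) obtain g where g: "g \<in> K" "\<forall>t\<in>{0..1}. \<bar>g t - rational_bernstein d t\<bar> \<le> inverse (real (Suc k))"
          unfolding P_def by blast
        have "\<bar>g t - X t \<omega>\<bar> \<le> 2 * inverse (real (Suc k))" if "t \<in> {0..1}" for t
          using 1[OF that] g(2)[rule_format, OF that] by linarith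
        with g(1) show ?thesis by blast
      qed
      then obtain g where g: "\<And>k. g k \<in> K" "\<And>k t. t \<in> {0..1} \<Longrightarrow> \<bar>g k t - X t \<omega>\<bar> \<le> 2 * inverse (real (Suc k))"
        by metis
      have "uniform_limit {0..1} g ?f sequentially"
      proof (rule uniform_limitI)
        fix e :: real assume e: "0 < e"
        have "(\<lambda>k. 2 * inverse (real (Suc k))) \<longlonglongrightarrow> 2 * 0"
          by (intro tendsto_mult tendsto_const LIMSEQ_inverse_real_of_nat)
        then have "\<forall>\<^sub>F k in sequentially. 2 * inverse (real (Suc k)) < e" using e by (intro order_tendstoD) auto
        then show "\<forall>\<^sub>F k in sequentially. \<forall>t\<in>{0..1}. dist (g k t) (?f t) < e"
        proof eventually_elim
          case (elim k)
          then show ?case using g(2)[of _ k] by (fastforce simp: dist_real_def simp del: of_nat_Suc)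
        qed
      qed
      then have "ereal (N {0..1} ?f) \<le> limsup (\<lambda>n. ereal (N {0..1} (g n)))"
        using g(1) elim(2) by (intro lsc) (auto simp: K_def)
      also have "\<dots> \<le> ereal \<epsilon>" using g(1) by (intro Limsup_bounded always_eventually) (auto simp: K_def)
      finally show "N {0..1} ?f \<le> \<epsilon>" by simp
    next
      assume le: "N {0..1} ?f \<le> \<epsilon>"
      have "\<exists>d. P d k \<and> (\<forall>t\<in>{0..1} \<inter> \<rat>. \<bar>X t \<omega> - rational_bernstein d t\<bar> \<le> inverse (real (Suc k)))" for k
      proof -
        obtain d where d: "\<forall>t\<in>{0..1}. \<bar>X t \<omega> - rational_bernstein d t\<bar> \<le> inverse (real (Suc k))"
          using rational_bernstein_dense[OF elim(1), of "inverse (real (Suc k))"] by auto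
        have "?f \<in> K" using elim(2) le by (simp add: K_def)
        with d have "P d k" unfolding P_def by (intro bexI[of _ ?f]) auto
        with d show ?thesis by blast
      qed
      then show "\<omega> \<in> G" using elim(3) by (simp add: G_def)
    qed
  qed
  ultimately show ?thesis by (rule sets_completion_if_AE_iff)
qed

section \<open>The lower bound\<close>

text \<open>For \<alpha> < 2 an order \<open>s < \<alpha>\<close> with
  \<open>1 < \<delta> * s\<close> exists as soon as \<open>\<delta> > 1 / \<alpha>\<close>, and the
  second hypothesis on \<theta> leaves room for such a \<delta>. For \<alpha> = 2 all even orders
  are available, so \<open>\<delta> = \<theta> / 2\<close> works with a large
  \<open>s\<close>.\<close>

lemma moment_exponent_exists:
  assumes \<alpha>: "0 < \<alpha>" "\<alpha> \<le> 2" and \<theta>: "0 < \<theta>" "\<alpha> < 2 \<Longrightarrow> 1 / \<alpha> < \<theta>"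
  shows "\<exists>\<delta> s C. 0 < \<delta> \<and> \<delta> < \<theta> \<and> 0 < s \<and> 1 < \<delta> * s \<and> moment_const \<alpha> s C"
proof (cases "\<alpha> < 2")
  case True
  obtain \<delta> where \<delta>: "1 / \<alpha> < \<delta>" "\<delta> < \<theta>" using dense[OF \<theta>(2)[OF True]] by auto
  have \<delta>0: "0 < \<delta>" using \<delta>(1) \<alpha> by (meson divide_pos_pos less_trans zero_less_one)
  have "1 / \<delta> < \<alpha>" using \<delta>(1) \<delta>0 \<alpha> by (simp add: divide_less_eq mult.commute)
  then obtain s where s: "1 / \<delta> < s" "s < \<alpha>" using dense by blast
  have s0: "0 < s" using s(1) \<delta>0 by (meson divide_pos_pos less_trans zero_less_one)
  have "1 < \<delta> * s" using s(1) \<delta>0 by (simp add: divide_less_eq mult.commute)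
  moreover obtain C where "moment_const \<alpha> s C" using moment_const_subcritical[OF s0 s(2)] by auto
  ultimately show ?thesis using \<delta>0 \<delta> s0 by blast
next
  case False
  then have \<alpha>2: "\<alpha> = 2" using \<alpha> by simp
  define k where "k = Suc (nat \<lceil>1 / \<theta>\<rceil>)"
  have "1 / \<theta> < real k" unfolding k_def by linarith
  then have "1 < \<theta> / 2 * real (2 * k)" using \<theta> by (simp add: divide_less_eq mult.commute)
  moreover obtain C where "moment_const 2 (real (2 * k)) C" using moment_const_gaussian[of k] by (auto simp: k_def)
  moreover have "0 < \<theta> / 2" "\<theta> / 2 < \<theta>" using \<theta> by auto
  moreover have "0 < real (2 * k)" unfolding of_nat_0_less_iff by (simp add: k_def)
  ultimately show ?thesis unfolding \<alpha>2 by blast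
qed

text \<open>\<open>J\<close> is the least integer above
  \<open>log 2 (D / \<epsilon>) / \<theta>\<close>; rounding up costs the factor 2.\<close>

lemma dyadic_level_for:
  assumes \<theta>: "0 < \<theta>" and \<epsilon>: "0 < \<epsilon>" "\<epsilon> < D"
  obtains J :: nat where "D * 2 powr (- (real J * \<theta>)) \<le> \<epsilon>" "2 ^ J \<le> 2 * (D / \<epsilon>) powr (1 / \<theta>)"
proof
  define x where "x = log 2 (D / \<epsilon>) / \<theta>"
  define J where "J = nat \<lceil>x\<rceil>"
  have D\<epsilon>: "1 < D / \<epsilon>" using \<epsilon> by simp
  have x: "0 < x" using D\<epsilon> \<theta> by (simp add: x_def)
  have J: "x \<le> real J" "real J \<le> x + 1" using x unfolding J_def by linarith+
  have "2 powr (- (real J * \<theta>)) \<le> 2 powr (- (x * \<theta>))" using J \<theta> by (intro powr_mono) auto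
  also have "\<dots> = inverse (2 powr log 2 (D / \<epsilon>))" using \<theta> by (simp add: x_def powr_minus)
  also have "\<dots> = \<epsilon> / D" using D\<epsilon> \<epsilon> by (subst powr_log_cancel) auto
  finally have "D * 2 powr (- (real J * \<theta>)) \<le> D * (\<epsilon> / D)" using \<epsilon> by (intro mult_left_mono) auto
  then show "D * 2 powr (- (real J * \<theta>)) \<le> \<epsilon>" using \<epsilon> by simp
  have "2 ^ J = 2 powr real J" by (simp add: powr_realpow)
  also have "\<dots> \<le> 2 powr (x + 1)" using J by (intro powr_mono) auto
  also have "\<dots> = 2 * (2 powr log 2 (D / \<epsilon>)) powr (1 / \<theta>)" by (simp add: powr_add powr_powr x_def)
  also have "2 powr log 2 (D / \<epsilon>) = D / \<epsilon>" using D\<epsilon> by (intro powr_log_cancel) auto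
  finally show "2 ^ J \<le> 2 * (D / \<epsilon>) powr (1 / \<theta>)" .
qed

theorem theorem7:
  fixes M :: "'w measure"
    and \<alpha> H \<beta> :: real and p :: ereal
    and Z R :: "real \<Rightarrow> 'w \<Rightarrow> real"
    and F :: "(real \<Rightarrow> real) set"
    and FI :: "real set \<Rightarrow> (real \<Rightarrow> real) set"
    and N :: "real set \<Rightarrow> (real \<Rightarrow> real) \<Rightarrow> real"
  assumes "lower_seminorm F FI N \<beta> p"
    and "riemann_liouville_process M \<alpha> Z H R"
    and "\<alpha> = 2 \<or> H > 1 / \<alpha>"
    and "AE \<omega> in M. continuous_on {0..} (\<lambda>t. R t \<omega>)"
    and "AE \<omega> in M. (\<lambda>t\<in>{0..1}. R t \<omega>) \<in> FI {0..1}"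
    and "\<alpha> = 2 \<Longrightarrow> H > \<beta> + real_of_ereal (1 / p)"
    and "\<alpha> < 2 \<Longrightarrow> H > \<beta> + real_of_ereal (1 / p) + 1 / \<alpha>"
  shows "Liminf (at_right 0)
           (\<lambda>\<epsilon>. ereal (\<epsilon> powr inverse (H - \<beta> - real_of_ereal (1 / p))) *
                ereal_ln (measure (completion M)
                  {\<omega> \<in> space M. N {0..1} (\<lambda>t\<in>{0..1}. R t \<omega>) \<le> \<epsilon>})) > -\<infinity>"
proof -
  interpret S: lower_seminorm F FI N \<beta> p by fact
  interpret R: riemann_liouville_process M \<alpha> Z H R by fact
  let ?P = "real_of_ereal (1 / p)"
  \<comment> \<open>The exponent \<gamma> is \<open>inverse \<theta>\<close>.\<close>
  define \<theta> where "\<theta> = H - \<beta> - ?P"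
  have \<alpha>: "0 < \<alpha>" "\<alpha> \<le> 2" by (fact R.stability_index)+
  have \<theta>0: "0 < \<theta>"
  proof (cases "\<alpha> = 2")
    case True
    then show ?thesis using assms(6) by (simp add: \<theta>_def)
  next
    case False
    then have "1 / \<alpha> < \<theta>" using assms(7) \<alpha> by (simp add: \<theta>_def)
    moreover have "0 < 1 / \<alpha>" using \<alpha> by simp
    ultimately show ?thesis by linarith
  qed
  have \<theta>1: "1 / \<alpha> < \<theta>" if "\<alpha> < 2" using assms(7)[OF that] by (simp add: \<theta>_def)
  obtain \<delta> s C where \<delta>: "0 < \<delta>" "\<delta> < \<theta>" "0 < s" "1 < \<delta> * s" and C: "moment_const \<alpha> s C"
    using moment_exponent_exists[OF \<alpha> \<theta>0 \<theta>1] by auto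
  obtain m :: nat where m: "H < real m" using reals_Archimedean2 by blast
  have m0: "0 < m" using m R.hurst_pos by (intro Nat.gr0I) auto
  define good where "good J \<omega> \<longleftrightarrow>
    coefficients_le m (\<lambda>t. R.R0 t \<omega>) (2 * level_tol H \<theta> \<delta> J 0) (\<lambda>j. 2 * level_tol H \<theta> \<delta> J j)" for J \<omega>
  have "\<exists>c\<ge>0. \<forall>J. \<exists>E\<in>R.events. exp (- c * 2 ^ J) / 4 \<le> R.prob E \<and> (\<forall>\<omega>\<in>E. good J \<omega>)"
    unfolding good_def by (rule R.small_ball_coefficients[OF m \<theta>0 \<delta>(1,3,4) C])
  then obtain c where "0 \<le> c \<and> (\<forall>J. \<exists>E\<in>R.events. exp (- c * 2 ^ J) / 4 \<le> R.prob E \<and> (\<forall>\<omega>\<in>E. good J \<omega>))" ..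
  then have c: "0 \<le> c" "\<exists>E\<in>R.events. exp (- c * 2 ^ J) / 4 \<le> R.prob E \<and> (\<forall>\<omega>\<in>E. good J \<omega>)" for J by auto
  define bounded_by where "bounded_by K \<longleftrightarrow> (\<forall>f b e S. continuous_on UNIV f \<longrightarrow> restrict f {0..1} \<in> FI {0..1} \<longrightarrow>
    coefficients_le m f b e \<longrightarrow>
    (\<forall>L. (\<Sum>j<L. 2 powr (real j * (\<beta> + ?P)) * e j) \<le> S) \<longrightarrow>
    N {0..1} (restrict f {0..1}) \<le> K * (b + S))" for K
  have "\<exists>K\<ge>0. bounded_by K"
    unfolding bounded_by_def by (rule S.seminorm_le_wavelet_coeffs[OF m0])
  then obtain K where K: "0 \<le> K" "bounded_by K" by auto
  have "\<exists>G\<ge>0. \<forall>J L. (\<Sum>j<L. 2 powr (real j * (\<beta> + ?P)) * (2 * level_tol H \<theta> \<delta> J j))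
    \<le> G * 2 powr (- (real J * \<theta>))"
    by (rule sum_level_tolerances) (use \<delta> in \<open>auto simp: \<theta>_def\<close>)
  then obtain G where "0 \<le> G \<and> (\<forall>J L. (\<Sum>j<L. 2 powr (real j * (\<beta> + ?P)) * (2 * level_tol H \<theta> \<delta> J j))
    \<le> G * 2 powr (- (real J * \<theta>)))" ..
  then have G: "0 \<le> G" "\<forall>L. (\<Sum>j<L. 2 powr (real j * (\<beta> + ?P)) * (2 * level_tol H \<theta> \<delta> J j))
    \<le> G * 2 powr (- (real J * \<theta>))" for J by auto
  \<comment> \<open>2 accounts for the values at integer times, \<open>G\<close> for the sum over
    all levels, and 1 makes \<open>D\<close> positive.\<close>
  define D where "D = K * (2 + G) + 1"
  have D: "0 < D" using K G(1) by (simp add: D_def add_nonneg_pos)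
  have norm_bound: "AE \<omega> in M. good J \<omega> \<longrightarrow> N {0..1} (\<lambda>t\<in>{0..1}. R t \<omega>) \<le> D * 2 powr (- (real J * \<theta>))" for J
    using assms(4,5) R.start_R
  proof eventually_elim
    case (elim \<omega>)
    show ?case
    proof
      assume g: "good J \<omega>"
      let ?f = "\<lambda>t. R.R0 t \<omega>"
      \<comment> \<open>As the path starts at 0, its extension by zero is the path stopped at time
        0, hence continuous on the whole line.\<close>
      have f: "?f = (\<lambda>t. R (max 0 t) \<omega>)" using elim(3) by (auto simp: R.R0_def fun_eq_iff max_def)
      have cont: "continuous_on UNIV ?f"
        unfolding f by (rule continuous_on_compose2[OF elim(1)]) (auto intro!: continuous_intros)
      have restr: "restrict ?f {0..1} = (\<lambda>t\<in>{0..1}. R t \<omega>)" unfolding f by (auto simp: fun_eq_iff max_def)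
      have "N {0..1} (restrict ?f {0..1}) \<le> K * (2 * level_tol H \<theta> \<delta> J 0 + G * 2 powr (- (real J * \<theta>)))"
        using K(2)[unfolded bounded_by_def, rule_format, where f = ?f and b = "2 * level_tol H \<theta> \<delta> J 0"
            and e = "\<lambda>j. 2 * level_tol H \<theta> \<delta> J j" and S = "G * 2 powr (- (real J * \<theta>))"]
          cont g[unfolded good_def] G(2)[of J] elim(2) restr by auto
      also have "\<dots> \<le> K * (2 * 2 powr (- (real J * \<theta>)) + G * 2 powr (- (real J * \<theta>)))"
      proof (intro mult_left_mono add_right_mono K)
        have "2 powr (- ((\<theta> + 1) * real J)) \<le> 2 powr (- (real J * \<theta>))"
          by (intro powr_mono) (auto simp: algebra_simps)
        then show "level_tol H \<theta> \<delta> J 0 \<le> 2 powr (- (real J * \<theta>))" by (simp add: level_tol_def level_ratio_def)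
      qed simp
      also have "\<dots> \<le> D * 2 powr (- (real J * \<theta>))" by (simp add: D_def algebra_simps)
      finally show "N {0..1} (\<lambda>t\<in>{0..1}. R t \<omega>) \<le> D * 2 powr (- (real J * \<theta>))" unfolding restr .
    qed
  qed
  have cM: "finite_measure (completion M)"
    by (intro finite_measureI) (use R.emeasure_space_1 in simp)
  \<comment> \<open>The bound obtained for \<open>- ln\<close> of the probability is
    \<open>2 * c * (D / \<epsilon>) powr (1 / \<theta>) + ln 4\<close>. Multiplication by
    \<open>\<epsilon> powr inverse \<theta>\<close> removes \<epsilon> from the first summand and,
    for \<open>\<epsilon> < 1\<close>, does not increase the second, which stems from the factor
    1/4.\<close>
  define Q where "Q = 2 * c * D powr (1 / \<theta>) + ln 4"
  let ?A = "\<lambda>\<epsilon>. {\<omega> \<in> space M. N {0..1} (\<lambda>t\<in>{0..1}. R t \<omega>) \<le> \<epsilon>}"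
  have meas: "?A \<epsilon> \<in> sets (completion M)" for \<epsilon>
  proof (rule S.sublevel_set_measurable)
    show "AE \<omega> in M. continuous_on {0..1} (\<lambda>t. R t \<omega>)"
      using assms(4) by eventually_elim (auto intro: continuous_on_subset)
    show "ereal (N {0..1} f) \<le> limsup (\<lambda>n. ereal (N {0..1} (fs n)))"
      if "f \<in> FI {0..1}" "\<And>n. fs n \<in> FI {0..1}" "uniform_limit {0..1} fs f sequentially" for f fs
      using that by (intro S.lower_semicontinuous) auto
  qed (use R.measurable_R assms(5) in auto)
  have lower: "ereal (- Q) \<le> ereal (\<epsilon> powr inverse \<theta>) * ereal_ln (measure (completion M) (?A \<epsilon>))"
    if \<epsilon>: "0 < \<epsilon>" "\<epsilon> < D" "\<epsilon> < 1" for \<epsilon>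
  proof -
    obtain J :: nat where J: "D * 2 powr (- (real J * \<theta>)) \<le> \<epsilon>" "2 ^ J \<le> 2 * (D / \<epsilon>) powr (1 / \<theta>)"
      using dyadic_level_for[OF \<theta>0 \<epsilon>(1,2)] by blast
    obtain E where E: "E \<in> R.events" "exp (- c * 2 ^ J) / 4 \<le> R.prob E" "\<forall>\<omega>\<in>E. good J \<omega>"
      using c(2)[of J] by blast
    have "AE \<omega> in M. \<omega> \<in> E \<longrightarrow> \<omega> \<in> ?A \<epsilon>"
      using norm_bound[of J] AE_space
    proof eventually_elim
      case (elim \<omega>)
      then show ?case using E(3) J(1) by auto
    qed
    \<comment> \<open>\<open>E\<close> is contained in the sublevel event only almost surely,
      because the norm bound is pathwise on continuous paths.\<close>
    then have "measure (completion M) E \<le> measure (completion M) (?A \<epsilon>)"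
      using meas by (intro finite_measure.finite_measure_mono_AE[OF cM] AE_completion)
    then have q: "exp (- c * 2 ^ J) / 4 \<le> measure (completion M) (?A \<epsilon>)" using E(1,2) by simp
    let ?q = "measure (completion M) (?A \<epsilon>)"
    have q0: "0 < ?q" by (rule less_le_trans[OF _ q]) simp
    have "- c * 2 ^ J - ln 4 = ln (exp (- c * 2 ^ J) / 4)" by (simp add: ln_div)
    also have "\<dots> \<le> ln ?q" using q q0 by (subst ln_le_cancel_iff) auto
    finally have lnq: "- c * 2 ^ J - ln 4 \<le> ln ?q" .
    have "c * 2 ^ J \<le> c * (2 * (D / \<epsilon>) powr (1 / \<theta>))" using J(2) c(1) by (rule mult_left_mono)
    with lnq have lnq': "- (2 * c * (D / \<epsilon>) powr (1 / \<theta>) + ln 4) \<le> ln ?q" by simp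
    have p1: "\<epsilon> powr inverse \<theta> \<le> 1" using \<epsilon> \<theta>0 by (intro powr_le1) auto
    have "\<epsilon> powr inverse \<theta> * (D / \<epsilon>) powr (1 / \<theta>) = D powr (1 / \<theta>)"
      using \<epsilon> D by (simp add: inverse_eq_divide flip: powr_mult)
    then have "\<epsilon> powr inverse \<theta> * (2 * c * (D / \<epsilon>) powr (1 / \<theta>) + ln 4) = 2 * c * D powr (1 / \<theta>) + \<epsilon> powr inverse \<theta> * ln 4"
      by (simp add: algebra_simps)
    also have "\<dots> \<le> Q" unfolding Q_def using mult_right_mono[OF p1, of "ln 4"] by simp
    finally have "- Q \<le> \<epsilon> powr inverse \<theta> * (- (2 * c * (D / \<epsilon>) powr (1 / \<theta>) + ln 4))"
      by (simp only: mult_minus_right neg_le_iff_le)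
    also have "\<dots> \<le> \<epsilon> powr inverse \<theta> * ln ?q" using lnq' by (rule mult_left_mono) simp
    finally show ?thesis using q0 by (simp add: ereal_ln_def)
  qed
  have "\<forall>\<^sub>F \<epsilon> in at_right 0. ereal (- Q) \<le> ereal (\<epsilon> powr inverse \<theta>) * ereal_ln (measure (completion M) (?A \<epsilon>))"
    by (rule eventually_mono[OF eventually_conj[OF eventually_at_right_real[OF D]
            eventually_at_right_real[OF zero_less_one]]])
      (auto intro!: lower)
  then have "ereal (- Q) \<le> Liminf (at_right 0) (\<lambda>\<epsilon>. ereal (\<epsilon> powr inverse \<theta>) * ereal_ln (measure (completion M) (?A \<epsilon>)))"
    by (rule Liminf_bounded)
  then show ?thesis unfolding \<theta>_def by (rule less_le_trans[rotated]) simp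
qed

end
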